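(* Let $k\ge 4$ and let $(b_1,\dots,b_{k-3})\in\{0,1\}^{k-3}$ have exactly one entry equal to $1$. Then $\mathcal{H}(b_1,\dots,b_{k-3},2) = \mathcal{G}_1(b_1,\dots,b_{k-3})$.
   Context: A connected dominating set of $G$ is a set $D$ such that every vertex is in $D$ or adjacent to a vertex of $D$ and $G[D]$ is connected; $\gamma_c(G)$ is its minimum size, and a minimum one is a $\gamma_c$-set. $G$ is $k$-$\gamma_c$-critical if $\gamma_c(G)=k$ and $\gamma_c(G+uv)<k$ for all non-adjacent $u,v$. $\mathcal{Z}(k,\zeta)$ is the class of $k$-$\gamma_c$-critical graphs with exactly $\zeta$ cut vertices. For $k\ge4$, every $G\in\mathcal{Z}(k,k-3)$ is known to have exactly two end blocks (blocks containing exactly one cut vertex), all other blocks containing exactly two cut vertices; so its blocks and cut vertices can be labeled $B_1,\dots,B_{k-2}$ and $c_1,\dots,c_{k-3}$ with $c_1\in V(B_1)$, $c_{k-3}\in V(B_{k-2})$, $c_{i-1},c_i\in V(B_i)$ for $2\le i\le k-3$. Let $C_i=V(B_i)$ minus the cut vertices of $G$. $\mathcal{H}(b_1,\dots,b_{k-2})$ is the class of $G\in\mathcal{Z}(k,k-3)$ admitting such a labeling and a $\gamma_c$-set $D$ with $|C_i\cap D|=b_i$ for all $1\le i\le k-2$. Class $\mathcal{B}_{2,2}$: take $l\ge 2$, $m_1,\dots,m_l\ge 1$, $r\ge 0$; let $T$ be the disjoint union of stars $K_{1,m_i}$ and $r$ isolated vertices; let $S$ be the set of all star leaves. A graph in $\mathcal{B}_{2,2}$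 is the complement $\overline T$ together with a new vertex $c$ (the head) adjacent exactly to the vertices of $S$. Class $\mathcal{G}_1(i_1,\dots,i_{k-3})$, where $i_l=1$ and the other entries are $0$: take the path $c_0c_1\cdots c_{k-3}$ with the edge $c_{l-1}c_l$ deleted; add a complete graph $K_{n_l}$ ($n_l\ge2$) each of whose vertices is adjacent to $c_{l-1}$ and $c_l$; attach a graph $B\in\mathcal{B}_{2,2}$ whose head is $c_{k-3}$ (no other edges). *)

theory Defs
  imports "Graph_Theory.Graph_Theory" "HOL-Library.Disjoint_Sets"
begin

text \<open>
  A finite simple graph is a \<^locale>\<open>pair_graph\<close>: a finite, loop-free, symmetric digraph
  whose arcs are ordered pairs. An undirected edge is thus a pair of opposite arcs.
  Note that \<^const>\<open>connected\<close> excludes the graph without vertices.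
\<close>

definition connected_dominating_set :: "'a pair_pre_digraph \<Rightarrow> 'a set \<Rightarrow> bool" where
  "connected_dominating_set G D \<longleftrightarrow>
     D \<subseteq> pverts G \<and>
     (\<forall>v \<in> pverts G. v \<in> D \<or> (\<exists>u \<in> D. (u, v) \<in> parcs G)) \<and>
     connected (with_proj G \<restriction> D)"

text \<open>Only meaningful for connected graphs: the others have no connected dominating set.\<close>

definition gamma_c :: "'a pair_pre_digraph \<Rightarrow> nat" where
  "gamma_c G = Min (card ` {D. connected_dominating_set G D})"

definition gamma_c_set :: "'a pair_pre_digraph \<Rightarrow> 'a set \<Rightarrow> bool" where
  "gamma_c_set G D \<longleftrightarrow> connected_dominating_set G D \<and> card D = gamma_c G"

definition add_edge :: "'a pair_pre_digraph \<Rightarrow> 'a \<Rightarrow> 'a \<Rightarrow> 'a pair_pre_digraph" where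
  "add_edge G u v = G\<lparr>parcs := parcs G \<union> {(u, v), (v, u)}\<rparr>"

definition gamma_c_critical :: "nat \<Rightarrow> 'a pair_pre_digraph \<Rightarrow> bool" where
  "gamma_c_critical k G \<longleftrightarrow>
     pair_graph G \<and> connected (with_proj G) \<and> gamma_c G = k \<and>
     (\<forall>u \<in> pverts G. \<forall>v \<in> pverts G. u \<noteq> v \<and> (u, v) \<notin> parcs G \<longrightarrow> gamma_c (add_edge G u v) < k)"

text \<open>
  Deleting a cut vertex increases the number of components. Since the graphs are symmetric,
  their strongly connected components \<^const>\<open>pre_digraph.sccs\<close> are their connected components.
\<close>

definition cut_vertices :: "('a, 'b) pre_digraph \<Rightarrow> 'a set" where
  "cut_vertices G =
     {v \<in> verts G. card (pre_digraph.sccs G) < card (pre_digraph.sccs (pre_digraph.del_vert G v))}"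

text \<open>
  A block is a maximal connected subgraph that has no cut vertex of its own. The condition
  \<^const>\<open>graph\<close> restricts \<^const>\<open>subgraph\<close>, which is a notion for digraphs, to undirected subgraphs.
\<close>

definition blocks :: "('a, 'b) pre_digraph \<Rightarrow> ('a, 'b) pre_digraph set" where
  "blocks G =
     {B. pre_digraph.max_subgraph G (\<lambda>H. graph H \<and> connected H \<and> cut_vertices H = {}) B}"

definition Z_class :: "nat \<Rightarrow> nat \<Rightarrow> 'a pair_pre_digraph set" where
  "Z_class k \<zeta> = {G. gamma_c_critical k G \<and> card (cut_vertices (with_proj G)) = \<zeta>}"

definition block_labeling ::
  "nat \<Rightarrow> 'a pair_pre_digraph \<Rightarrow> (nat \<Rightarrow> ('a, 'a \<times> 'a) pre_digraph) \<Rightarrow> (nat \<Rightarrow> 'a) \<Rightarrow> bool" where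
  "block_labeling k G B c \<longleftrightarrow>
     bij_betw B {1..k-2} (blocks (with_proj G)) \<and>
     bij_betw c {1..k-3} (cut_vertices (with_proj G)) \<and>
     c 1 \<in> verts (B 1) \<and> c (k-3) \<in> verts (B (k-2)) \<and>
     (\<forall>i \<in> {2..k-3}. c (i-1) \<in> verts (B i) \<and> c i \<in> verts (B i))"

text \<open>A tuple indexed by \<open>1..n\<close> is a function of which only the values on \<open>{1..n}\<close> matter.\<close>

definition H_class :: "nat \<Rightarrow> (nat \<Rightarrow> nat) \<Rightarrow> 'a pair_pre_digraph set" where
  "H_class k b =
     {G \<in> Z_class k (k-3).
        \<exists>B c D. block_labeling k G B c \<and> gamma_c_set G D \<and>
          (\<forall>i \<in> {1..k-2}. card ((verts (B i) - cut_vertices (with_proj G)) \<inter> D) = b i)}"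

text \<open>
  \<open>T\<close> is the disjoint union of stars \<open>K\<^bsub>1,m i\<^esub>\<close> for \<open>1 \<le> i \<le> l\<close>, with centre \<open>x i\<close> and leaf
  set \<open>L i\<close>, and of \<open>r\<close> isolated vertices \<open>R\<close>; \<open>S\<close> is the set of all leaves.
  If \<open>m i = 1\<close>, either end of the edge may be chosen as the leaf.
\<close>

definition stars_and_isolated ::
  "nat \<Rightarrow> (nat \<Rightarrow> nat) \<Rightarrow> nat \<Rightarrow> 'a pair_pre_digraph \<Rightarrow> 'a set \<Rightarrow> bool" where
  "stars_and_isolated l m r T S \<longleftrightarrow>
     (\<exists>x L R.
        (\<forall>i \<in> {1..l}. finite (L i) \<and> card (L i) = m i \<and> x i \<notin> L i) \<and>
        disjoint_family_on (\<lambda>i. insert (x i) (L i)) {1..l} \<and>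
        finite R \<and> card R = r \<and>
        (\<Union>i \<in> {1..l}. insert (x i) (L i)) \<inter> R = {} \<and>
        pverts T = (\<Union>i \<in> {1..l}. insert (x i) (L i)) \<union> R \<and>
        parcs T = (\<Union>i \<in> {1..l}. {x i} \<times> L i \<union> L i \<times> {x i}) \<and>
        S = (\<Union>i \<in> {1..l}. L i))"

definition complement :: "'a pair_pre_digraph \<Rightarrow> 'a pair_pre_digraph" where
  "complement G =
     \<lparr>pverts = pverts G, parcs = {(u, v) \<in> pverts G \<times> pverts G. u \<noteq> v \<and> (u, v) \<notin> parcs G}\<rparr>"

definition add_vertex :: "'a pair_pre_digraph \<Rightarrow> 'a \<Rightarrow> 'a set \<Rightarrow> 'a pair_pre_digraph" where
  "add_vertex G c S =
     \<lparr>pverts = insert c (pverts G), parcs = parcs G \<union> {c} \<times> S \<union> S \<times> {c}\<rparr>"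

definition B22 :: "'a pair_pre_digraph \<Rightarrow> 'a \<Rightarrow> bool" where
  "B22 B c \<longleftrightarrow>
     (\<exists>l m r T S. 2 \<le> l \<and> (\<forall>i \<in> {1..l}. 1 \<le> m i) \<and> stars_and_isolated l m r T S \<and>
        c \<notin> pverts T \<and> B = add_vertex (complement T) c S)"

text \<open>
  \<open>P\<close> lists the edges of the path without the edge from \<open>c (l-1)\<close> to \<open>c l\<close>, and \<open>J\<close> those
  between the complete graph \<open>Q\<close> and \<open>{c (l-1), c l}\<close>. All graphs of this shape with vertices
  in the given type are included, so the class is closed under isomorphism.
\<close>

definition G1_class :: "nat \<Rightarrow> (nat \<Rightarrow> nat) \<Rightarrow> 'a pair_pre_digraph set" where
  "G1_class k b =
     {G. \<exists>l c n Q B P J.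
        l \<in> {1..k-3} \<and> b l = 1 \<and> (\<forall>i \<in> {1..k-3} - {l}. b i = 0) \<and>
        inj_on c {0..k-3} \<and>
        2 \<le> n \<and> complete_digraph n (with_proj Q) \<and> pverts Q \<inter> c ` {0..k-3} = {} \<and>
        B22 B (c (k-3)) \<and> pverts B \<inter> (c ` {0..k-3} \<union> pverts Q) = {c (k-3)} \<and>
        P = {(c (i-1), c i) | i. i \<in> {1..k-3} - {l}} \<and>
        J = pverts Q \<times> {c (l-1), c l} \<and>
        pverts G = c ` {0..k-3} \<union> pverts Q \<union> pverts B \<and>
        parcs G = P \<union> P\<inverse> \<union> parcs Q \<union> J \<union> J\<inverse> \<union> parcs B}"

end

theory Submission
  imports Defs
begin

text \<open>
  Write \<open>k = n + 3\<close>. In a graph of the class \<open>H_class k\<close>, deleting the cut vertex \<open>c m\<close> separates the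
  blocks with index at most \<open>m\<close> from the others. Collapsing both sides of block \<open>j\<close> onto its cut
  vertices shows that a connected dominating set restricts to one of each block, and conversely
  such local sets can be exchanged block by block. So criticality can be tested inside a single
  block: blocks with \<open>b i = 0\<close> are complete, the block with \<open>b l = 1\<close> and the last block lack few
  edges. The degenerate cases that remain are graphs that become blown-up cycles after joining
  their two ends, and a connected dominating set of a cycle misses at most two classes.
  Conversely, a graph in \<open>G1_class\<close> is a path of cliques with a block in \<open>B22\<close> attached, and a new edge
  always allows one vertex to be dropped from a suitable minimum connected dominating set.
\<close>


section \<open>Connected sets and connected dominating sets\<close>

text \<open>The count behind the proof: \<open>n = k - 3\<close> is the number of cut vertices, all
  of which lie in every connected dominating set, and \<open>k = n + 1 + 2\<close> leaves one
  interior vertex for block \<open>l\<close> and two for the last block. A missing edge inside a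
  block must therefore lower the share of that very block, which pins down its non-edges. The
  obstacle is what this local test cannot see. A complete block has no missing edge, so nothing
  local bounds its number of interior vertices; in block \<open>l\<close> the two cut vertices might
  be adjacent; in the last block all neighbours of the head might miss the same vertex. Each of
  these is refuted by an edge between different blocks, which destroys the separation by cut
  vertices in between and so needs a global argument: a map that sends edges to edges or to single
  vertices carries connected dominating sets to connected dominating sets without enlarging them.
  The target is the graph itself when an interior vertex is folded onto a cut vertex, and otherwise
  a cycle of length \<open>N\<close>, where at least \<open>N - 2\<close> vertices are
  required.\<close>

text \<open>
  Stated through closed subsets instead of paths: for a symmetric relation \<open>E\<close> this is
  connectedness of the subgraph induced by \<open>X\<close>.
\<close>

definition conn :: "'a rel \<Rightarrow> 'a set \<Rightarrow> bool" where
  "conn E X \<longleftrightarrow> X \<noteq> {} \<and>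
     (\<forall>A. A \<noteq> {} \<and> A \<subseteq> X \<and> (\<forall>a \<in> A. \<forall>b \<in> X. (a, b) \<in> E \<longrightarrow> b \<in> A) \<longrightarrow> A = X)"

definition cds :: "'a rel \<Rightarrow> 'a set \<Rightarrow> 'a set \<Rightarrow> bool" where
  "cds E V D \<longleftrightarrow> D \<subseteq> V \<and> (\<forall>v \<in> V. v \<in> D \<or> (\<exists>u \<in> D. (u, v) \<in> E)) \<and> conn E D"

lemma connI:
  assumes "X \<noteq> {}"
    and "\<And>A. A \<noteq> {} \<Longrightarrow> A \<subseteq> X \<Longrightarrow> (\<And>a b. a \<in> A \<Longrightarrow> b \<in> X \<Longrightarrow> (a, b) \<in> E \<Longrightarrow> b \<in> A) \<Longrightarrow> X \<subseteq> A"
  shows "conn E X"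
  unfolding conn_def
proof (intro conjI allI impI)
  fix A assume A: "A \<noteq> {} \<and> A \<subseteq> X \<and> (\<forall>a \<in> A. \<forall>b \<in> X. (a, b) \<in> E \<longrightarrow> b \<in> A)"
  then have "X \<subseteq> A" by (intro assms(2)) auto
  then show "A = X" using A by auto
qed fact

text \<open>Used as an induction rule along edges inside \<open>X\<close>. The invariant
  \<open>A\<close> may reach outside \<open>X\<close>, which lets one side of a separation serve as
  \<open>A\<close>.\<close>

lemma connD:
  assumes "conn E X" "a \<in> A" "a \<in> X"
    and "\<And>a b. a \<in> A \<Longrightarrow> a \<in> X \<Longrightarrow> b \<in> X \<Longrightarrow> (a, b) \<in> E \<Longrightarrow> b \<in> A"
  shows "X \<subseteq> A"
proof -
  have "A \<inter> X = X" using assms unfolding conn_def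
    by (elim conjE allE[of _ "A \<inter> X"]) auto
  then show ?thesis by auto
qed

lemma conn_nonempty: "conn E X \<Longrightarrow> X \<noteq> {}"
  by (simp add: conn_def)

lemma conn_singleton [simp]: "conn E {x}"
  by (rule connI) auto

lemma conn_mono:
  assumes "conn E X" "E \<inter> X \<times> X \<subseteq> E'"
  shows "conn E' X"
proof (rule connI)
  show "X \<noteq> {}" using assms(1) by (rule conn_nonempty)
  fix A assume A: "A \<noteq> {}" "A \<subseteq> X" "\<And>a b. a \<in> A \<Longrightarrow> b \<in> X \<Longrightarrow> (a, b) \<in> E' \<Longrightarrow> b \<in> A"
  then obtain a where "a \<in> A" by auto
  then show "X \<subseteq> A" using A assms(2) by (intro connD[OF assms(1), of a]) auto
qed

lemma conn_pair:
  assumes "(x, y) \<in> E" "sym E"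
  shows "conn E {x, y}"
proof (rule connI)
  fix A assume A: "A \<noteq> {}" "A \<subseteq> {x, y}" "\<And>a b. a \<in> A \<Longrightarrow> b \<in> {x, y} \<Longrightarrow> (a, b) \<in> E \<Longrightarrow> b \<in> A"
  have "(y, x) \<in> E" using assms by (auto dest: symD)
  then show "{x, y} \<subseteq> A" using A assms(1) by blast
qed auto

lemma conn_pairD:
  assumes "conn E {x, y}" "x \<noteq> y"
  shows "(x, y) \<in> E"
proof (rule ccontr)
  assume "(x, y) \<notin> E"
  then have "{x, y} \<subseteq> {x}" by (intro connD[OF assms(1), of x]) auto
  then show False using assms(2) by auto
qed

lemma conn_Un:
  assumes "conn E X" "conn E Y" "x \<in> X" "y \<in> Y" "x = y \<or> (x, y) \<in> E" "sym E"
  shows "conn E (X \<union> Y)"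
proof (rule connI)
  show "X \<union> Y \<noteq> {}" using assms(3) by auto
  fix A assume A: "A \<noteq> {}" "A \<subseteq> X \<union> Y"
    "\<And>a b. a \<in> A \<Longrightarrow> b \<in> X \<union> Y \<Longrightarrow> (a, b) \<in> E \<Longrightarrow> b \<in> A"
  have yx: "x = y \<or> (y, x) \<in> E" using assms(5,6) by (auto dest: symD)
  have X: "X \<subseteq> A" if "a \<in> A" "a \<in> X" for a
    using that A(3) by (intro connD[OF assms(1), of a]) auto
  have Y: "Y \<subseteq> A" if "a \<in> A" "a \<in> Y" for a
    using that A(3) by (intro connD[OF assms(2), of a]) auto
  from A obtain a where "a \<in> A" "a \<in> X \<or> a \<in> Y" by auto
  then show "X \<union> Y \<subseteq> A"
  proof (elim disjE)
    assume "a \<in> X"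
    then have "X \<subseteq> A" using X \<open>a \<in> A\<close> by auto
    then have "y \<in> A" using assms A(3)[of x y] by auto
    then show ?thesis using Y[of y] \<open>X \<subseteq> A\<close> assms by auto
  next
    assume "a \<in> Y"
    then have "Y \<subseteq> A" using Y \<open>a \<in> A\<close> by auto
    then have "x \<in> A" using assms A(3)[of y x] yx by auto
    then show ?thesis using X[of x] \<open>Y \<subseteq> A\<close> assms by auto
  qed
qed

text \<open>Successive sets may share a vertex or be joined by an edge, which covers both
  overlapping blocks and single path vertices. A link makes both of its sets nonempty; the
  nonemptiness of the union settles the chain of one set.\<close>

lemma conn_chain:
  fixes a b :: nat
  assumes "a \<le> b"
    and "\<And>j. j \<in> {a..b} \<Longrightarrow> X j \<noteq> {} \<Longrightarrow> conn E (X j)"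
    and "\<And>j. j \<in> {a..<b} \<Longrightarrow> \<exists>x \<in> X j. \<exists>y \<in> X (Suc j). x = y \<or> (x, y) \<in> E"
    and "(\<Union>j \<in> {a..b}. X j) \<noteq> {}" "sym E"
  shows "conn E (\<Union>j \<in> {a..b}. X j)"
  using assms(1-4)
proof (induction b rule: dec_induct)
  case base
  then show ?case by simp
next
  case (step m)
  have *: "\<exists>x \<in> X m. \<exists>y \<in> X (Suc m). x = y \<or> (x, y) \<in> E" using step by auto
  then obtain x y where xy: "x \<in> X m" "y \<in> X (Suc m)" "x = y \<or> (x, y) \<in> E" by blast
  have 1: "conn E (\<Union>j \<in> {a..m}. X j)"
    using step.prems step.hyps xy by (intro step.IH) auto
  have "X (Suc m) \<noteq> {}" "Suc m \<in> {a..Suc m}" using xy step.hyps by auto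
  then have 2: "conn E (X (Suc m))" using step.prems(1) by blast
  have "conn E ((\<Union>j \<in> {a..m}. X j) \<union> X (Suc m))"
    using 1 2 xy step.hyps by (intro conn_Un[of E _ _ x y] assms(5)) auto
  moreover have "(\<Union>j \<in> {a..m}. X j) \<union> X (Suc m) = (\<Union>j \<in> {a..Suc m}. X j)"
    using step.hyps by (auto simp: atLeastAtMostSuc_conv)
  ultimately show ?case by simp
qed

lemma conn_image:
  assumes "conn E X"
    and "\<And>x y. x \<in> X \<Longrightarrow> y \<in> X \<Longrightarrow> (x, y) \<in> E \<Longrightarrow> f x = f y \<or> (f x, f y) \<in> E'"
  shows "conn E' (f ` X)"
proof (rule connI)
  show "f ` X \<noteq> {}" using conn_nonempty[OF assms(1)] by auto
  fix A assume A: "A \<noteq> {}" "A \<subseteq> f ` X" "\<And>a b. a \<in> A \<Longrightarrow> b \<in> f ` X \<Longrightarrow> (a, b) \<in> E' \<Longrightarrow> b \<in> A"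
  then obtain x where x: "x \<in> X" "f x \<in> A" by blast
  have "X \<subseteq> f -` A"
    using x
  proof (intro connD[OF assms(1), of x])
    fix a b assume "a \<in> f -` A" "a \<in> X" "b \<in> X" "(a, b) \<in> E"
    then show "b \<in> f -` A" using assms(2)[of a b] A(3)[of "f a" "f b"] by auto
  qed auto
  then show "f ` X \<subseteq> A" by auto
qed

text \<open>An image is no larger than a finite set itself, so this turns maps into bounds on
  cardinality: maps onto a cycle, onto a single block, or onto the graph without one vertex.\<close>

lemma cds_image:
  assumes "cds E V D"
    and "\<And>x y. x \<in> D \<Longrightarrow> y \<in> V \<Longrightarrow> (x, y) \<in> E \<Longrightarrow> f x = f y \<or> (f x, f y) \<in> E'"
    and "W \<subseteq> f ` V" "f ` D \<subseteq> W"
  shows "cds E' W (f ` D)"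
  unfolding cds_def
proof (intro conjI ballI)
  show "f ` D \<subseteq> W" by fact
  show "conn E' (f ` D)"
    using assms(1,2) by (intro conn_image[of E]) (auto simp: cds_def)
  fix w assume "w \<in> W"
  then obtain v where v: "v \<in> V" "w = f v" using assms(3) by auto
  show "w \<in> f ` D \<or> (\<exists>u \<in> f ` D. (u, w) \<in> E')"
  proof (cases "v \<in> D")
    case False
    then obtain u where u: "u \<in> D" "(u, v) \<in> E" using assms(1) v by (auto simp: cds_def)
    then have "f u = w \<or> (f u, w) \<in> E'" using assms(2)[of u v] v by auto
    then show ?thesis using u by force
  qed (use v in auto)
qed

text \<open>A set \<open>D\<close> dominating both sides of a separating vertex \<open>c\<close> can only be connected through \<open>c\<close>.\<close>

lemma cds_contains_separator:
  assumes "cds E V D" "V = A \<union> B" "A \<inter> B = {c}" "A \<noteq> {c}" "B \<noteq> {c}"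
    and "\<And>x y. (x, y) \<in> E \<Longrightarrow> x \<in> A \<Longrightarrow> y \<in> B \<Longrightarrow> x = c \<or> y = c"
    and "\<And>x y. (x, y) \<in> E \<Longrightarrow> y \<in> A \<Longrightarrow> x \<in> B \<Longrightarrow> x = c \<or> y = c"
  shows "c \<in> D"
proof (rule ccontr)
  assume c: "c \<notin> D"
  obtain a b where ab: "a \<in> A" "a \<noteq> c" "b \<in> B" "b \<noteq> c" using assms(3-5) by auto
  have DV: "D \<subseteq> A \<union> B" using assms(1,2) by (auto simp: cds_def)
  have "\<exists>a' \<in> D. a' \<in> A"
  proof (cases "a \<in> D")
    case False
    then obtain u where "u \<in> D" "(u, a) \<in> E" using ab assms(1,2) unfolding cds_def by blast
    then show ?thesis using c ab assms(7) DV by blast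
  qed (use ab in auto)
  then obtain a' where a': "a' \<in> D" "a' \<in> A" by auto
  have "\<exists>b' \<in> D. b' \<in> B"
  proof (cases "b \<in> D")
    case False
    then obtain u where "u \<in> D" "(u, b) \<in> E" using ab assms(1,2) unfolding cds_def by blast
    then show ?thesis using c ab assms(6) DV by blast
  qed (use ab in auto)
  then obtain b' where b': "b' \<in> D" "b' \<in> B" by auto
  have "conn E D" using assms(1) by (simp add: cds_def)
  then have "D \<subseteq> A"
  proof (rule connD)
    fix x y assume "x \<in> A" "x \<in> D" "y \<in> D" "(x, y) \<in> E"
    then show "y \<in> A" using assms(6)[of x y] c DV by auto
  qed (use a' in auto)
  then have "b' \<in> A \<inter> B" using b' by auto
  then show False using assms(3) b' c by auto
qed

section \<open>Connected dominating sets of cycles\<close>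

definition cycle_rel :: "nat \<Rightarrow> nat rel" where
  "cycle_rel N = {(i, j). i < N \<and> j < N \<and> (Suc i mod N = j \<or> Suc j mod N = i)}"

text \<open>A case distinction at the wrap-around replaces \<open>mod\<close>, so that adjacency is
  decided by linear arithmetic.\<close>

lemma cycle_rel_iff:
  "(i, j) \<in> cycle_rel N \<longleftrightarrow> i < N \<and> j < N \<and>
     ((if Suc i = N then 0 else Suc i) = j \<or> (if Suc j = N then 0 else Suc j) = i)"
  by (auto simp: cycle_rel_def mod_Suc)

text \<open>A set avoiding \<open>0\<close> cannot use the edge between \<open>N - 1\<close> and
  \<open>0\<close>, so the cycle is cut open to a path; a missing \<open>m\<close> between minimum
  and maximum would separate them.\<close>

lemma conn_cycle_interval:
  assumes "conn (cycle_rel N) D" "D \<subseteq> {1..<N}"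
  shows "D = {Min D..Max D}"
proof -
  have fin: "finite D" using assms(2) by (rule finite_subset) auto
  have ne: "D \<noteq> {}" using assms(1) by (rule conn_nonempty)
  have "m \<in> D" if m: "Min D \<le> m" "m \<le> Max D" for m
  proof (rule ccontr)
    assume mD: "m \<notin> D"
    have "Min D \<in> D" "Max D \<in> D" using fin ne by auto
    have "D \<subseteq> {..m}"
    proof (rule connD[OF assms(1)])
      show "Min D \<in> {..m}" "Min D \<in> D" using m fin ne by auto
      fix a b assume *: "a \<in> {..m}" "a \<in> D" "b \<in> D" "(a, b) \<in> cycle_rel N"
      then have ab: "a \<ge> 1" "b \<ge> 1" "a < N" "b < N" using assms(2) by auto
      have am: "a < m" using * mD by (metis atMost_iff le_neq_implies_less)
      have "Suc a = b \<or> Suc b = a"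
        using *(4) ab by (auto simp: cycle_rel_iff split: if_splits)
      then show "b \<in> {..m}" using am by auto
    qed
    then show False using \<open>Max D \<in> D\<close> m mD by (metis atMost_iff le_antisym subsetD)
  qed
  then show ?thesis using fin ne by (intro equalityI subsetI) auto
qed

lemma cycle_rel_rotate:
  assumes "(i, j) \<in> cycle_rel N"
  shows "((i + s) mod N, (j + s) mod N) \<in> cycle_rel N"
proof -
  have "N > 0" using assms by (auto simp: cycle_rel_def)
  have "Suc ((i + s) mod N) mod N = (Suc i mod N + s) mod N"
    "Suc ((j + s) mod N) mod N = (Suc j mod N + s) mod N" by (simp_all add: mod_simps)
  then show ?thesis using assms \<open>N > 0\<close> by (auto simp: cycle_rel_def)
qed

text \<open>A missed vertex can be rotated to \<open>0\<close>. What remains is an interval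
  \<open>{a..b}\<close> in \<open>{1..<N}\<close>, and the vertices next to the gap must be
  dominated from its two ends.\<close>

lemma card_cds_cycle:
  assumes "cds (cycle_rel N) {..<N} D"
  shows "N \<le> card D + 2"
proof (cases "D = {..<N}")
  case False
  then obtain m where m: "m < N" "m \<notin> D" using assms by (auto simp: cds_def)
  define f where "f i = (i + (N - m)) mod N" for i
  have inj: "inj_on f {..<N}"
  proof (rule inj_on_inverseI)
    fix x assume "x \<in> {..<N}"
    moreover have "(f x + m) mod N = (x + (N - m) + m) mod N" by (simp add: f_def mod_simps)
    ultimately show "(f x + m) mod N = x" using m by simp
  qed
  have "f ` {..<N} \<subseteq> {..<N}" using m by (auto simp: f_def)
  then have img: "f ` {..<N} = {..<N}" using inj by (simp add: endo_inj_surj)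
  define D' where "D' = f ` D"
  have DN: "D \<subseteq> {..<N}" using assms by (simp add: cds_def)
  have "cds (cycle_rel N) {..<N} D'"
    unfolding D'_def using assms
  proof (rule cds_image)
    fix x y assume "(x, y) \<in> cycle_rel N"
    then show "f x = f y \<or> (f x, f y) \<in> cycle_rel N" using cycle_rel_rotate f_def by auto
  qed (use img DN in auto)
  moreover have "f m = 0" using m by (simp add: f_def)
  then have "0 \<notin> D'" using m inj DN
    unfolding D'_def inj_on_def by (metis imageE lessThan_iff subsetD)
  ultimately have D': "conn (cycle_rel N) D'" "D' \<subseteq> {1..<N}"
    and dom: "\<And>v. v < N \<Longrightarrow> v \<in> D' \<or> (\<exists>u \<in> D'. (u, v) \<in> cycle_rel N)"
    by (auto simp: cds_def Suc_le_eq intro: gr0I)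
  define a b where "a = Min D'" "b = Max D'"
  have ab: "D' = {a..b}" using conn_cycle_interval[OF D'] a_b_def by simp
  have "a \<le> b" using conn_nonempty[OF D'(1)] ab by auto
  then have "1 \<le> a" "b < N" using D'(2) ab by auto
  have dom': "\<exists>u. a \<le> u \<and> u \<le> b \<and> (u = v \<or> (u, v) \<in> cycle_rel N)" if "v < N" for v
    using dom[OF that] ab by auto
  have c: "card D' = Suc b - a" using ab by simp
  have "card D' = card D" unfolding D'_def by (rule card_image) (use inj DN inj_on_subset in blast)
  \<comment> \<open>As \<open>card D' = b + 1 - a\<close>, this is the claim without
    subtraction.\<close>
  moreover have "N + a \<le> b + 3"
  proof -
    \<comment> \<open>The neighbours of \<open>0\<close> are \<open>1\<close> and
      \<open>N - 1\<close>, so one end of the interval touches \<open>0\<close>; the domination of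
      the vertex on the other side of \<open>0\<close> keeps the other end close.\<close>
    obtain u where u: "a \<le> u" "u \<le> b" "u = 0 \<or> (u, 0) \<in> cycle_rel N"
      using dom'[of 0] m by blast
    then have "(u = N - 1 \<and> b = N - 1) \<or> a = 1"
      using \<open>1 \<le> a\<close> \<open>b < N\<close> by (auto simp: cycle_rel_iff split: if_splits)
    then show ?thesis
    proof
      assume b: "u = N - 1 \<and> b = N - 1"
      obtain w where w: "a \<le> w" "w = 1 \<or> (w, 1) \<in> cycle_rel N"
        using dom'[of 1] \<open>a \<le> b\<close> \<open>1 \<le> a\<close> \<open>b < N\<close> by fastforce
      have "a \<le> 2"
        using w \<open>1 \<le> a\<close> by (auto simp: cycle_rel_iff split: if_splits)
      then show ?thesis using b m by linarith
    next
      assume a: "a = 1"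
      obtain w where w: "a \<le> w" "w \<le> b" "w = N - 1 \<or> (w, N - 1) \<in> cycle_rel N"
        using dom'[of "N - 1"] m by fastforce
      have "N \<le> b + 2"
        using w a by (auto simp: cycle_rel_iff split: if_splits)
      then show ?thesis using a by linarith
    qed
  qed
  ultimately show ?thesis using c by linarith
qed (use assms in simp)


section \<open>Cut vertices and blocks\<close>

lemma reachable_imp_closed:
  assumes "(u, v) \<in> rtrancl_on X E" "u \<in> A"
    and "\<And>a b. a \<in> A \<Longrightarrow> b \<in> X \<Longrightarrow> (a, b) \<in> E \<Longrightarrow> b \<in> A"
  shows "v \<in> A"
  using assms(1,2) by (induction rule: rtrancl_on_induct) (use assms(3) in auto)

lemma conn_iff_rtrancl_on:
  "conn E X \<longleftrightarrow> X \<noteq> {} \<and> (\<forall>u \<in> X. \<forall>v \<in> X. (u, v) \<in> rtrancl_on X E)"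
proof
  assume c: "conn E X"
  have "X \<subseteq> {v. (u, v) \<in> rtrancl_on X E}" if "u \<in> X" for u
    using c by (rule connD) (use that in \<open>auto intro: rtrancl_on_into_rtrancl_on\<close>)
  then show "X \<noteq> {} \<and> (\<forall>u \<in> X. \<forall>v \<in> X. (u, v) \<in> rtrancl_on X E)"
    using conn_nonempty[OF c] by auto
next
  assume *: "X \<noteq> {} \<and> (\<forall>u \<in> X. \<forall>v \<in> X. (u, v) \<in> rtrancl_on X E)"
  show "conn E X"
  proof (rule connI)
    fix A assume A: "A \<noteq> {}" "A \<subseteq> X" "\<And>a b. a \<in> A \<Longrightarrow> b \<in> X \<Longrightarrow> (a, b) \<in> E \<Longrightarrow> b \<in> A"
    then obtain a where "a \<in> A" by auto
    then show "X \<subseteq> A" using * A reachable_imp_closed[of a _ X E A] by blast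
  qed (use * in auto)
qed

lemma symcl_of_sym:
  assumes "sym E"
  shows "E\<^sup>s = E"
  using assms by (auto simp: symcl_def dest: symD)

lemma connected_iff_conn:
  assumes "sym (arcs_ends H)"
  shows "connected H \<longleftrightarrow> conn (arcs_ends H) (verts H)"
  by (simp add: connected_conv conn_iff_rtrancl_on symcl_of_sym[OF assms])

lemma arcs_ends_induce_with_proj:
  "arcs_ends (with_proj G \<restriction> X) = parcs G \<inter> X \<times> X"
  by (auto simp: arcs_ends_def arc_to_ends_def induce_subgraph_def)

lemma conn_Int:
  "conn (E \<inter> X \<times> X) X \<longleftrightarrow> conn E X"
  by (rule iffI; erule conn_mono) auto

lemma sym_Int_Times: "sym E \<Longrightarrow> sym (E \<inter> X \<times> X)"
  by (auto simp: sym_def)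

lemma connected_induce_iff_conn:
  assumes "sym (parcs G)"
  shows "connected (with_proj G \<restriction> X) \<longleftrightarrow> conn (parcs G) X"
  using assms
  by (subst connected_iff_conn) (auto simp: arcs_ends_induce_with_proj sym_Int_Times conn_Int)

lemma connected_dominating_set_iff_cds:
  assumes "sym (parcs G)"
  shows "connected_dominating_set G D \<longleftrightarrow> cds (parcs G) (pverts G) D"
  using assms by (simp add: connected_dominating_set_def cds_def connected_induce_iff_conn)

text \<open>Cut vertices are defined by numbers of components. A connected graph has one, so after a
  deletion the count \<open>1\<close> and the count \<open>0\<close> of the empty graph are the ones
  to be recognized.\<close>

lemma conn_iff_one_scc:
  assumes "graph H"
  shows "conn (arcs_ends H) (verts H) \<longleftrightarrow> card (pre_digraph.sccs H) = 1"
    and "verts H = {} \<longleftrightarrow> card (pre_digraph.sccs H) = 0"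
proof -
  interpret graph H by fact
  have eq: "card sccs = card (scc_of ` verts H)"
    using card_sccs_verts sccs_verts_conv_scc_of by simp
  show "verts H = {} \<longleftrightarrow> card sccs = 0" unfolding eq card_eq_0_iff using finite_verts by blast
  have sc: "conn (arcs_ends H) (verts H) \<longleftrightarrow> strongly_connected H"
    unfolding conn_iff_rtrancl_on strongly_connected_def reachable_def ..
  show "conn (arcs_ends H) (verts H) \<longleftrightarrow> card sccs = 1"
  proof
    assume "conn (arcs_ends H) (verts H)"
    then have "sccs = {H}" by (rule strongly_connected_eq_iff[THEN iffD1, OF sc[THEN iffD1]])
    then show "card sccs = 1" by simp
  next
    assume "card sccs = 1"
    then obtain S where S: "scc_of ` verts H = {S}" unfolding eq by (auto simp: card_1_singleton_iff)
    have "v \<in> S" if "v \<in> verts H" for v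
    proof -
      have "scc_of v \<in> {S}" using that S by blast
      then show ?thesis using in_scc_of_self[OF that] by simp
    qed
    moreover have "S \<in> sccs_verts" unfolding sccs_verts_conv_scc_of S by simp
    then have "\<forall>u \<in> S. \<forall>v \<in> S. u \<rightarrow>\<^sup>*\<^bsub>H\<^esub> v" unfolding in_sccs_verts_conv_reachable by (elim conjE)
    moreover have "verts H \<noteq> {}" using S by (metis image_empty insert_not_empty)
    ultimately have "strongly_connected H" by (intro strongly_connectedI) simp_all
    then show "conn (arcs_ends H) (verts H)" by (rule sc[THEN iffD2])
  qed
qed

lemma pair_graphD:
  assumes "pair_graph G"
  shows "sym (parcs G)" "parcs G \<subseteq> pverts G \<times> pverts G" "finite (pverts G)" "(x, x) \<notin> parcs G"
proof -
  interpret pair_graph G by fact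
  show "sym (parcs G)" using pair_sym_arcs by (simp add: symmetric_def)
  show "parcs G \<subseteq> pverts G \<times> pverts G" using in_arcsD1 in_arcsD2 by auto
  show "finite (pverts G)" by (rule pair_finite_verts)
  show "(x, x) \<notin> parcs G" using pair_no_loops by force
qed

lemma pair_graphI:
  assumes "sym (parcs G)" "parcs G \<subseteq> pverts G \<times> pverts G" "finite (pverts G)"
    and "\<And>x. (x, x) \<notin> parcs G"
  shows "pair_graph G"
proof
  show "finite (parcs G)" using assms(2,3) finite_subset[OF assms(2)] by simp
  show "symmetric (with_proj G)" using assms(1) by (simp add: symmetric_def)
  show "finite (pverts G)" by fact
  fix e assume e: "e \<in> parcs G"
  then show "fst e \<in> pverts G" "snd e \<in> pverts G" using assms(2) by auto
  show "fst e \<noteq> snd e" using e assms(4)[of "fst e"] by (cases e) auto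
qed

lemma del_vert_with_proj:
  "pre_digraph.del_vert (with_proj G) v =
     with_proj \<lparr>pverts = pverts G - {v}, parcs = parcs G \<inter> (pverts G - {v}) \<times> (pverts G - {v})\<rparr>"
  if "parcs G \<subseteq> pverts G \<times> pverts G"
  using that by (auto simp: pre_digraph.del_vert_def with_proj_def)

text \<open>More than one component means neither none nor one; the nonemptiness condition excludes
  the only vertex of a one-vertex graph, whose deletion leaves none.\<close>

lemma cut_vertices_eq:
  assumes "pair_graph G" "conn (parcs G) (pverts G)"
  shows "cut_vertices (with_proj G) =
    {v \<in> pverts G. pverts G - {v} \<noteq> {} \<and> \<not> conn (parcs G) (pverts G - {v})}"
proof -
  note G = pair_graphD[OF assms(1)]
  have 1: "card (pre_digraph.sccs (with_proj G)) = 1"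
    using conn_iff_one_scc(1)[OF pair_graph.pair_graphD_graph[OF assms(1)]] assms(2)
    unfolding with_proj_simps by blast
  have *: "1 < card (pre_digraph.sccs (pre_digraph.del_vert (with_proj G) v)) \<longleftrightarrow>
      pverts G - {v} \<noteq> {} \<and> \<not> conn (parcs G) (pverts G - {v})" for v
  proof -
    define H where "H = \<lparr>pverts = pverts G - {v}, parcs = parcs G \<inter> (pverts G - {v}) \<times> (pverts G - {v})\<rparr>"
    have H: "pverts H = pverts G - {v}" "parcs H = parcs G \<inter> (pverts G - {v}) \<times> (pverts G - {v})"
      by (simp_all add: H_def)
    have "pair_graph H"
      by (rule pair_graphI) (simp_all add: H G sym_Int_Times)
    then have gr: "graph (with_proj H)" by (rule pair_graph.pair_graphD_graph)
    have "pre_digraph.del_vert (with_proj G) v = with_proj H"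
      unfolding H_def by (rule del_vert_with_proj) (rule G)
    moreover define c where "c = card (pre_digraph.sccs (with_proj H))"
    moreover have "conn (parcs G) (pverts G - {v}) \<longleftrightarrow> c = 1"
      using conn_iff_one_scc(1)[OF gr] unfolding c_def with_proj_simps H conn_Int .
    moreover have "pverts G - {v} = {} \<longleftrightarrow> c = 0"
      using conn_iff_one_scc(2)[OF gr] unfolding c_def with_proj_simps H .
    ultimately show ?thesis by (simp only: not_less) linarith
  qed
  show ?thesis unfolding cut_vertices_def 1 * by simp
qed

text \<open>Blocks in terms of vertex sets. Single vertices and the two ends of an edge qualify,
  which is why every vertex and every edge lies in a block.\<close>

definition nonsep :: "'a rel \<Rightarrow> 'a set \<Rightarrow> bool" where
  "nonsep E U \<longleftrightarrow> conn E U \<and> (\<forall>v \<in> U. U - {v} \<noteq> {} \<longrightarrow> conn E (U - {v}))"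

lemma nonsep_Int: "nonsep (E \<inter> X \<times> X) X \<longleftrightarrow> nonsep E X"
proof -
  have "conn (E \<inter> X \<times> X) (X - {v}) \<longleftrightarrow> conn E (X - {v})" for v
    by (rule iffI; erule conn_mono) auto
  then show ?thesis by (simp add: nonsep_def conn_Int)
qed

lemma nonsep_mono: "nonsep E U \<Longrightarrow> E \<subseteq> E' \<Longrightarrow> nonsep E' U"
  unfolding nonsep_def by (meson conn_mono le_infI1)

definition is_block :: "('a, 'b) pre_digraph \<Rightarrow> bool" where
  "is_block H \<longleftrightarrow> graph H \<and> connected H \<and> cut_vertices H = {}"

lemma is_block_with_proj:
  assumes "pair_graph H"
  shows "is_block (with_proj H) \<longleftrightarrow> nonsep (parcs H) (pverts H)"
proof (cases "conn (parcs H) (pverts H)")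
  case True
  then have "connected (with_proj H)"
    using assms by (subst connected_iff_conn) (auto simp: pair_graphD)
  then show ?thesis using True assms
    by (auto simp: is_block_def nonsep_def cut_vertices_eq pair_graph.pair_graphD_graph)
next
  case False
  then have "\<not> connected (with_proj H)"
    using assms by (subst connected_iff_conn) (auto simp: pair_graphD)
  then show ?thesis using False by (simp add: is_block_def nonsep_def)
qed

lemma subgraph_with_projD:
  assumes "subgraph H (with_proj G)" "graph H"
  obtains H' where "H = with_proj H'" "pair_graph H'" "pverts H' \<subseteq> pverts G" "parcs H' \<subseteq> parcs G"
proof -
  define H' where "H' = \<lparr>pverts = verts H, parcs = arcs H\<rparr>"
  have "tail H = fst" "head H = snd"
    using assms(1) by (auto simp: subgraph_def compatible_def)
  then have 1: "H = with_proj H'" by (simp add: H'_def with_proj_def)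
  then have "pair_graph H'" using assms(2) pair_graphI_graph by simp
  then show ?thesis using that 1 assms(1) by (auto simp: subgraph_def)
qed

lemma subgraph_with_proj_iff:
  assumes "pair_graph G" "pair_graph H"
  shows "subgraph (with_proj H) (with_proj G) \<longleftrightarrow> pverts H \<subseteq> pverts G \<and> parcs H \<subseteq> parcs G"
proof -
  have "wf_digraph (with_proj G)" "wf_digraph (with_proj H)"
    using assms by (auto simp: wf_digraph_wp_iff pair_graph_def pair_digraph_def pair_fin_digraph_def)
  then show ?thesis by (auto simp: subgraph_def)
qed

lemma with_proj_inject [simp]: "with_proj G = with_proj H \<longleftrightarrow> G = H"
  by (cases G; cases H) (auto simp: with_proj_def)

definition induce_pair :: "'a pair_pre_digraph \<Rightarrow> 'a set \<Rightarrow> 'a pair_pre_digraph" where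
  "induce_pair G X = \<lparr>pverts = X, parcs = parcs G \<inter> X \<times> X\<rparr>"

lemma pair_graph_induce:
  assumes "pair_graph G" "X \<subseteq> pverts G"
  shows "pair_graph (induce_pair G X)"
  using pair_graphD[OF assms(1)] assms(2) finite_subset[OF assms(2)]
  by (intro pair_graphI) (auto simp: induce_pair_def sym_Int_Times)

lemma blocks_eq: "blocks G = {B. pre_digraph.max_subgraph G is_block B}"
  by (simp add: blocks_def is_block_def[abs_def])

lemma blockD:
  assumes "pair_graph G" "B \<in> blocks (with_proj G)"
  shows "nonsep (parcs G) (verts B)" "verts B \<subseteq> pverts G"
proof -
  have *: "subgraph B (with_proj G)" "is_block B"
    using assms(2) by (auto simp: blocks_eq pre_digraph.max_subgraph_def)
  then have "graph B" by (simp add: is_block_def)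
  then obtain H where H: "B = with_proj H" "pair_graph H" "pverts H \<subseteq> pverts G" "parcs H \<subseteq> parcs G"
    using * by (elim subgraph_with_projD)
  then show "verts B \<subseteq> pverts G" by simp
  have "nonsep (parcs H) (pverts H)" using *(2) is_block_with_proj[OF H(2)] unfolding H(1) by blast
  then show "nonsep (parcs G) (verts B)" using H nonsep_mono by auto
qed

text \<open>Among the finitely many candidates containing \<open>U\<close>, one with the largest
  total of vertices and arcs is maximal: a proper extension would increase the total.\<close>

lemma ex_block:
  assumes "pair_graph G" "U \<subseteq> pverts G" "nonsep (parcs G) U"
  shows "\<exists>B \<in> blocks (with_proj G). U \<subseteq> verts B"
proof -
  define P where "P H \<longleftrightarrow> pair_graph H \<and> pverts H \<subseteq> pverts G \<and> parcs H \<subseteq> parcs G \<and>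
    nonsep (parcs H) (pverts H) \<and> U \<subseteq> pverts H" for H
  note G = pair_graphD[OF assms(1)]
  have fin: "finite (parcs G)" using G finite_subset by blast
  have "P (induce_pair G U)"
    using assms pair_graph_induce[OF assms(1,2)] by (auto simp: P_def induce_pair_def nonsep_Int)
  moreover have "\<forall>H. P H \<longrightarrow> card (pverts H) + card (parcs H) < Suc (card (pverts G) + card (parcs G))"
    using G fin by (auto simp: P_def less_Suc_eq_le intro!: add_mono card_mono)
  ultimately obtain H where H: "P H"
    and max: "\<And>H'. P H' \<Longrightarrow> card (pverts H') + card (parcs H') \<le> card (pverts H) + card (parcs H)"
    using ex_has_greatest_nat[of P "induce_pair G U" "\<lambda>H. card (pverts H) + card (parcs H)"
        "Suc (card (pverts G) + card (parcs G))"] by (auto simp: less_imp_le)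
  have pH: "pair_graph H" using H by (simp add: P_def)
  have "pre_digraph.max_subgraph (with_proj G) is_block (with_proj H)"
    unfolding pre_digraph.max_subgraph_def
  proof (intro conjI allI impI notI)
    show "subgraph (with_proj H) (with_proj G)"
      using H pH subgraph_with_proj_iff[OF assms(1)] by (simp add: P_def)
    show "is_block (with_proj H)" using H by (simp add: P_def is_block_with_proj)
    fix K assume K: "K \<noteq> with_proj H \<and> subgraph (with_proj H) K"
      and "subgraph K (with_proj G) \<and> is_block K"
    then have K': "subgraph K (with_proj G)" "is_block K" by auto
    then have "graph K" by (simp add: is_block_def)
    then obtain H' where H': "K = with_proj H'" "pair_graph H'" "pverts H' \<subseteq> pverts G" "parcs H' \<subseteq> parcs G"
      using K' by (elim subgraph_with_projD)
    have sub: "pverts H \<subseteq> pverts H'" "parcs H \<subseteq> parcs H'"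
      using K H' pH subgraph_with_proj_iff[OF H'(2) pH] by auto
    have "P H'" using H' K' H sub by (auto simp: P_def is_block_with_proj)
    then have "card (pverts H') + card (parcs H') \<le> card (pverts H) + card (parcs H)" by (rule max)
    moreover have f: "finite (pverts H')" "finite (parcs H')"
      using H' G(3) fin by (auto intro: finite_subset)
    ultimately have "card (pverts H') \<le> card (pverts H)" "card (parcs H') \<le> card (parcs H)"
      using card_mono[OF f(1) sub(1)] card_mono[OF f(2) sub(2)] by auto
    then have "pverts H = pverts H'" "parcs H = parcs H'"
      using card_seteq[OF f(1) sub(1)] card_seteq[OF f(2) sub(2)] by auto
    then have "H = H'" by (cases H; cases H') auto
    then show False using K H' by simp
  qed
  then show ?thesis using H
    by (intro bexI[of _ "with_proj H"]) (simp_all add: blocks_eq P_def)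
qed

text \<open>Adding edges keeps a vertex set nonseparable, so a maximal such subgraph is induced and
  blocks correspond to maximal vertex sets. The antichain condition makes every \<open>W j\<close>
  maximal and the indexing injective.\<close>

lemma blocks_eq_induced:
  assumes G: "pair_graph G"
    and W: "\<And>j. j \<in> J \<Longrightarrow> W j \<subseteq> pverts G" "\<And>j. j \<in> J \<Longrightarrow> nonsep (parcs G) (W j)"
    and max: "\<And>U. nonsep (parcs G) U \<Longrightarrow> U \<subseteq> pverts G \<Longrightarrow> \<exists>j \<in> J. U \<subseteq> W j"
    and anti: "\<And>i j. i \<in> J \<Longrightarrow> j \<in> J \<Longrightarrow> W i \<subseteq> W j \<Longrightarrow> i = j"
  shows "bij_betw (\<lambda>j. with_proj (induce_pair G (W j))) J (blocks (with_proj G))"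
  unfolding bij_betw_def
proof (intro conjI)
  let ?B = "\<lambda>j. with_proj (induce_pair G (W j))"
  show "inj_on ?B J"
    using anti by (intro inj_onI) (simp add: induce_pair_def)
  have isb: "is_block (?B j)" and sub: "subgraph (?B j) (with_proj G)"
    and pg: "pair_graph (induce_pair G (W j))" if "j \<in> J" for j
  proof -
    show pg: "pair_graph (induce_pair G (W j))" using G W that by (auto intro: pair_graph_induce)
    show "is_block (?B j)"
      using W that by (simp add: is_block_with_proj[OF pg]) (simp add: induce_pair_def nonsep_Int)
    show "subgraph (?B j) (with_proj G)"
      using W that by (simp add: subgraph_with_proj_iff[OF G pg]) (auto simp: induce_pair_def)
  qed
  show "?B ` J = blocks (with_proj G)"
  proof (intro equalityI subsetI)
    fix B assume "B \<in> ?B ` J"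
    then obtain j where j: "j \<in> J" "B = ?B j" by auto
    have "pre_digraph.max_subgraph (with_proj G) is_block (?B j)"
      unfolding pre_digraph.max_subgraph_def
    proof (intro conjI allI impI notI)
      fix K assume K: "K \<noteq> ?B j \<and> subgraph (?B j) K" and "subgraph K (with_proj G) \<and> is_block K"
      then have K': "subgraph K (with_proj G)" "is_block K" by auto
      then have "graph K" by (simp add: is_block_def)
      then obtain H where H: "K = with_proj H" "pair_graph H" "pverts H \<subseteq> pverts G" "parcs H \<subseteq> parcs G"
        using K' by (elim subgraph_with_projD)
      have le: "W j \<subseteq> pverts H" "parcs G \<inter> W j \<times> W j \<subseteq> parcs H"
        using K H j subgraph_with_proj_iff[OF H(2) pg] by (auto simp: induce_pair_def)
      have "nonsep (parcs H) (pverts H)" using K'(2) is_block_with_proj[OF H(2)] unfolding H(1) by blast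
      then have "nonsep (parcs G) (pverts H)"
        by (rule nonsep_mono) (rule H)
      then obtain i where i: "i \<in> J" "pverts H \<subseteq> W i" using max[OF _ H(3)] by auto
      then have "i = j" using anti[of j i] j le by auto
      then have V: "pverts H = W j" using i le by auto
      have "parcs H \<subseteq> parcs G \<inter> W j \<times> W j"
        using H V pair_graphD(2)[OF H(2)] by auto
      then have "H = induce_pair G (W j)"
        using V le by (cases H) (auto simp: induce_pair_def)
      then show False using H K by simp
    qed (use isb sub j in auto)
    then show "B \<in> blocks (with_proj G)" using j by (simp add: blocks_eq)
  next
    fix B assume B: "B \<in> blocks (with_proj G)"
    then have *: "subgraph B (with_proj G)" "is_block B"
      and mx: "\<And>K. K \<noteq> B \<Longrightarrow> subgraph B K \<Longrightarrow> \<not> (subgraph K (with_proj G) \<and> is_block K)"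
      unfolding blocks_eq pre_digraph.max_subgraph_def by blast+
    then have "graph B" by (simp add: is_block_def)
    then obtain H where H: "B = with_proj H" "pair_graph H" "pverts H \<subseteq> pverts G" "parcs H \<subseteq> parcs G"
      using * by (elim subgraph_with_projD)
    have "nonsep (parcs G) (pverts H)" using blockD[OF G B] H by simp
    then obtain j where j: "j \<in> J" "pverts H \<subseteq> W j" using max[OF _ H(3)] by auto
    have "subgraph B (?B j)"
      using H j pair_graphD(2)[OF H(2)]
      by (simp add: subgraph_with_proj_iff[OF pg[OF j(1)] H(2)]) (auto simp: induce_pair_def)
    then have "?B j = B" using mx[of "?B j"] isb sub j by auto
    then show "B \<in> ?B ` J" using j by auto
  qed
qed


section \<open>Chains of blocks\<close>

text \<open>Notation alone: the sets have to exist before \<open>block_chain\<close> can state its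
  assumptions with them. \<open>A m\<close> and \<open>B m\<close> are the two sides of
  \<open>c m\<close>, and \<open>C j\<close> is the interior of block \<open>j\<close>.\<close>

locale chain =
  fixes n :: nat and W :: "nat \<Rightarrow> 'a set" and c :: "nat \<Rightarrow> 'a"
begin

definition A :: "nat \<Rightarrow> 'a set" where "A m = (\<Union>j \<in> {1..m}. W j)"
definition B :: "nat \<Rightarrow> 'a set" where "B m = (\<Union>j \<in> {Suc m..Suc n}. W j)"
definition C :: "nat \<Rightarrow> 'a set" where "C j = W j - c ` {1..n}"
text \<open>Intersecting with \<open>{1..n}\<close> drops \<open>c 0\<close> and
  \<open>c (Suc n)\<close>, so that end blocks need no separate treatment.\<close>

definition Cut :: "nat \<Rightarrow> 'a set" where "Cut j = c ` ({j - 1, j} \<inter> {1..n})"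

end

text \<open>That the blocks form a path is coded by \<open>meet\<close>: the two sides of
  \<open>c m\<close> share nothing else. The locale serves both inclusions, with the blocks of a
  given graph and with the sets from which a graph in \<open>G1_class\<close> is glued.\<close>

locale block_chain = chain n W c for n :: nat and W :: "nat \<Rightarrow> 'a set" and c +
  fixes V :: "'a set" and E :: "'a rel"
  assumes fin: "finite V" and EV: "E \<subseteq> V \<times> V" and symE: "sym E" and irr: "(x, x) \<notin> E"
    and n1: "1 \<le> n"
    and V_eq: "V = A (Suc n)"
    and edge: "(x, y) \<in> E \<Longrightarrow> \<exists>j \<in> {1..Suc n}. x \<in> W j \<and> y \<in> W j"
    and ns: "j \<in> {1..Suc n} \<Longrightarrow> nonsep E (W j)"
    and meet: "m \<in> {1..n} \<Longrightarrow> A m \<inter> B m = {c m}"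
    and Ane: "m \<in> {1..n} \<Longrightarrow> A m \<noteq> {c m}"
    and Bne: "m \<in> {1..n} \<Longrightarrow> B m \<noteq> {c m}"
    and c_in: "m \<in> {1..n} \<Longrightarrow> c m \<in> W m" "m \<in> {1..n} \<Longrightarrow> c m \<in> W (Suc m)"
    and inj: "inj_on c {1..n}"
begin

lemma A_0: "A 0 = {}" by (simp add: A_def)
lemma B_0: "B 0 = V" by (simp add: B_def A_def V_eq)
lemma B_last: "B (Suc n) = {}" by (simp add: B_def)

lemma AB: "m \<le> Suc n \<Longrightarrow> A m \<union> B m = V"
proof -
  assume "m \<le> Suc n"
  then have "{1..m} \<union> {Suc m..Suc n} = {1..Suc n}" by auto
  then show ?thesis unfolding A_def B_def V_eq by (metis UN_Un)
qed

lemma W_sub_A: "j \<in> {1..m} \<Longrightarrow> W j \<subseteq> A m"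
  by (auto simp: A_def)

lemma W_sub_B: "j \<in> {Suc m..Suc n} \<Longrightarrow> W j \<subseteq> B m"
  unfolding B_def by (rule UN_upper)

lemma W_sub_V: "j \<in> {1..Suc n} \<Longrightarrow> W j \<subseteq> V"
  unfolding V_eq by (rule W_sub_A)

lemma A_mono: "i \<le> j \<Longrightarrow> A i \<subseteq> A j"
  unfolding A_def by (rule UN_mono) auto

lemma B_anti: "i \<le> j \<Longrightarrow> B j \<subseteq> B i"
  unfolding B_def by (rule UN_mono) auto

lemma meetD: "x \<in> A m \<Longrightarrow> x \<in> B m \<Longrightarrow> m \<in> {1..n} \<Longrightarrow> x = c m"
  using meet by blast

lemma c_neq: "i \<in> {1..n} \<Longrightarrow> j \<in> {1..n} \<Longrightarrow> i \<noteq> j \<Longrightarrow> c i \<noteq> c j"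
  using inj_onD[OF inj] by blast

lemma c_A: "m \<in> {1..n} \<Longrightarrow> m \<le> j \<Longrightarrow> c m \<in> A j"
  using c_in(1)[of m] W_sub_A[of m j] by auto

lemma c_B: "m \<in> {1..n} \<Longrightarrow> j \<le> m \<Longrightarrow> c m \<in> B j"
  using c_in(2)[of m] W_sub_B[of "Suc m" j] by auto

lemma c_V: "m \<in> {1..n} \<Longrightarrow> c m \<in> V"
  using c_in(1)[of m] W_sub_V[of m] by auto

lemma A_Int_B: 
  assumes "j \<in> {1..Suc n}"
  shows "A j \<inter> B (j - 1) = W j"
proof (intro equalityI subsetI)
  fix x assume x: "x \<in> A j \<inter> B (j - 1)"
  then obtain i i' where i: "i \<in> {1..j}" "x \<in> W i" "i' \<in> {Suc (j - 1)..Suc n}" "x \<in> W i'"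
    unfolding A_def B_def by blast
  show "x \<in> W j"
  proof (cases "i = j")
    case False
    then have "i \<in> {1..j - 1}" "j - 1 \<in> {1..n}" using i assms by auto
    then have "x = c (j - 1)" using W_sub_A[of i "j - 1"] i x meetD[of x "j - 1"] by auto
    then show ?thesis using c_in(2)[of "j - 1"] \<open>j - 1 \<in> {1..n}\<close> by auto
  qed (use i in simp)
next
  fix x assume "x \<in> W j"
  then show "x \<in> A j \<inter> B (j - 1)" using W_sub_A[of j j] W_sub_B[of j "j - 1"] assms by auto
qed

text \<open>Such a vertex would have to be \<open>c (j - 1)\<close> and \<open>c j\<close> at
  once.\<close>

lemma A_Int_B_skip:
  assumes "j \<in> {1..Suc n}" "x \<in> A (j - 1)" "x \<in> B j"
  shows False
proof -
  have "j \<noteq> 1" using assms(2) A_0 by (intro notI) simp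
  moreover have "j \<noteq> Suc n" using assms(3) B_last by (intro notI) simp
  ultimately have j: "j - 1 \<in> {1..n}" "j \<in> {1..n}" using assms(1) by auto
  have "x = c j" "x = c (j - 1)"
    using j assms(2,3) A_mono[of "j - 1" j] B_anti[of "j - 1" j] by (auto intro!: meetD)
  moreover have "j - 1 \<noteq> j" using assms(1) by auto
  ultimately show False using c_neq[OF j] by simp
qed

lemma sep:
  assumes "(x, y) \<in> E" "m \<in> {1..n}" "x \<in> A m" "y \<in> B m"
  shows "x = c m \<or> y = c m"
proof -
  obtain j where j: "j \<in> {1..Suc n}" "x \<in> W j" "y \<in> W j" using edge[OF assms(1)] by auto
  show ?thesis
  proof (cases "j \<le> m")
    case True
    then have "y \<in> A m" using j W_sub_A[of j m] by auto
    then show ?thesis using meetD assms by blast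
  next
    case False
    then have "x \<in> B m" using j W_sub_B[of j m] by auto
    then show ?thesis using meetD assms by blast
  qed
qed

lemma W_Int_cuts:
  assumes "j \<in> {1..Suc n}"
  shows "W j \<inter> c ` {1..n} = Cut j"
proof (intro equalityI subsetI)
  fix x assume "x \<in> W j \<inter> c ` {1..n}"
  then obtain m where m: "m \<in> {1..n}" "x = c m" "c m \<in> W j" by auto
  have "m = j \<or> m = j - 1"
  proof (rule ccontr)
    assume *: "\<not> (m = j \<or> m = j - 1)"
    show False
    proof (cases "m < j")
      case True
      then have "c m \<in> A (j - 1)" "c m \<in> B (j - 1)" "j - 1 \<in> {1..n}"
        using m * assms c_A[of m "j - 1"] W_sub_B[of j "j - 1"] by auto
      then have "c m = c (j - 1)" by (rule meetD)
      then show False using c_neq m * \<open>j - 1 \<in> {1..n}\<close> by metis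
    next
      case False
      then have "c m \<in> A j" "c m \<in> B j" "j \<in> {1..n}"
        using m assms W_sub_A[of j j] c_B[of m j] by auto
      then have "c m = c j" by (rule meetD)
      then show False using c_neq m * \<open>j \<in> {1..n}\<close> by metis
    qed
  qed
  then show "x \<in> Cut j" using m by (auto simp: Cut_def)
next
  fix x assume "x \<in> Cut j"
  then obtain m where m: "m \<in> {1..n}" "x = c m" "m = j \<or> m = j - 1" by (auto simp: Cut_def)
  then show "x \<in> W j \<inter> c ` {1..n}" using c_in[of m] assms by auto
qed

lemma W_split: "j \<in> {1..Suc n} \<Longrightarrow> W j = C j \<union> Cut j"
  using W_Int_cuts[of j] by (auto simp: C_def)

lemma C_Cut: "C j \<inter> Cut j' = {}"
  by (auto simp: C_def Cut_def)

lemma W_Int_W: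
  assumes "i \<in> {1..Suc n}" "j \<in> {1..Suc n}" "i < j" "x \<in> W i" "x \<in> W j"
  shows "x = c i"
proof -
  have "i \<in> {1..n}" "x \<in> A i" "x \<in> B i" using assms W_sub_A[of i i] W_sub_B[of j i] by auto
  then show ?thesis using meetD by blast
qed

lemma C_Int_W:
  assumes "i \<in> {1..Suc n}" "j \<in> {1..Suc n}" "i \<noteq> j"
  shows "C i \<inter> W j = {}"
proof -
  have False if "x \<in> C i" "x \<in> W j" for x
  proof -
    have x: "x \<in> W i" "x \<notin> c ` {1..n}" using that by (auto simp: C_def)
    show False
    proof (cases "i < j")
      case True
      then show False using W_Int_W[of i j x] assms x that by auto
    next
      case False
      then show False using W_Int_W[of j i x] assms x that by auto
    qed
  qed
  then show ?thesis by auto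
qed

lemma conn_W: "j \<in> {1..Suc n} \<Longrightarrow> conn E (W j)"
  using ns by (simp add: nonsep_def)

lemma conn_W_minus: "j \<in> {1..Suc n} \<Longrightarrow> W j - {v} \<noteq> {} \<Longrightarrow> conn E (W j - {v})"
  using ns[of j] conn_W[of j] by (cases "v \<in> W j") (auto simp: nonsep_def)

lemma conn_V: "conn E V"
  unfolding V_eq A_def
proof (rule conn_chain)
  fix j assume "j \<in> {1..<Suc n}"
  then show "\<exists>x \<in> W j. \<exists>y \<in> W (Suc j). x = y \<or> (x, y) \<in> E" using c_in[of j] by auto
next
  show "(\<Union>j \<in> {1..Suc n}. W j) \<noteq> {}" using c_in(1)[of 1] n1 by force
qed (use conn_W symE in auto)

text \<open>After deleting \<open>c m\<close>, the side \<open>A m\<close> is closed under edges.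
  Deleting any other vertex leaves each block connected and all links \<open>c j\<close> in
  place.\<close>

lemma disconnected_iff:
  assumes "v \<in> V"
  shows "V - {v} \<noteq> {} \<and> \<not> conn E (V - {v}) \<longleftrightarrow> v \<in> c ` {1..n}"
proof
  assume "v \<in> c ` {1..n}"
  then obtain m where m: "m \<in> {1..n}" "v = c m" by auto
  have cm: "c m \<in> A m" "c m \<in> B m" using m c_A c_B by auto
  then obtain a b where ab: "a \<in> A m" "a \<noteq> c m" "b \<in> B m" "b \<noteq> c m" using Ane Bne m by blast
  have V: "V = A m \<union> B m" using AB[of m] m by simp
  have "\<not> conn E (V - {v})"
  proof
    assume "conn E (V - {v})"
    then have "V - {v} \<subseteq> A m"
    proof (rule connD)
      fix x y assume "x \<in> A m" "x \<in> V - {v}" "y \<in> V - {v}" "(x, y) \<in> E"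
      then show "y \<in> A m" using sep[of x y m] m V by auto
    qed (use ab V m in auto)
    then show False using ab V m meetD[of b m] by auto
  qed
  then show "V - {v} \<noteq> {} \<and> \<not> conn E (V - {v})" using ab V m by auto
next
  assume *: "V - {v} \<noteq> {} \<and> \<not> conn E (V - {v})"
  show "v \<in> c ` {1..n}"
  proof (rule ccontr)
    assume v: "v \<notin> c ` {1..n}"
    have eq: "V - {v} = (\<Union>j \<in> {1..Suc n}. W j - {v})" by (auto simp: V_eq A_def)
    have "conn E (\<Union>j \<in> {1..Suc n}. W j - {v})"
    proof (rule conn_chain)
      fix j assume "j \<in> {1..<Suc n}"
      then show "\<exists>x \<in> W j - {v}. \<exists>y \<in> W (Suc j) - {v}. x = y \<or> (x, y) \<in> E"
        using c_in[of j] v by (intro bexI[of _ "c j"]) auto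
    next
      show "(\<Union>j \<in> {1..Suc n}. W j - {v}) \<noteq> {}" using * eq by simp
    qed (use conn_W_minus symE in auto)
    then show False using * eq by simp
  qed
qed

text \<open>A set with vertices strictly on both sides of \<open>c m\<close> would fall apart
  without \<open>c m\<close>, so it lies on one side for each \<open>m\<close>; the least
  \<open>j\<close> with \<open>U\<close> inside \<open>A j\<close> identifies the block.\<close>

lemma nonsep_in_block:
  assumes "nonsep E U" "U \<subseteq> V"
  shows "\<exists>j \<in> {1..Suc n}. U \<subseteq> W j"
proof -
  have side: "U \<subseteq> A m \<or> U \<subseteq> B m" if m: "m \<in> {1..n}" for m
  proof (rule ccontr)
    assume "\<not> (U \<subseteq> A m \<or> U \<subseteq> B m)"
    then obtain a b where ab: "a \<in> U" "a \<notin> B m" "b \<in> U" "b \<notin> A m" by auto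
    have V: "V = A m \<union> B m" using AB[of m] m by simp
    then have ab': "a \<in> A m" "b \<in> B m" using ab assms(2) by auto
    have cm: "c m \<in> A m" "c m \<in> B m" using m c_A c_B by auto
    have "U - {c m} \<noteq> {}" using ab cm by auto
    then have "conn E (U - {c m})" using assms(1) by (cases "c m \<in> U") (auto simp: nonsep_def)
    then have "U - {c m} \<subseteq> A m"
    proof (rule connD)
      fix x y assume "x \<in> A m" "x \<in> U - {c m}" "y \<in> U - {c m}" "(x, y) \<in> E"
      then show "y \<in> A m" using sep[of x y m] m V assms(2) by auto
    qed (use ab ab' cm in auto)
    then show False using ab cm by auto
  qed
  define j where "j = (LEAST j. U \<subseteq> A j)"
  have "U \<subseteq> A (Suc n)" using assms(2) V_eq by simp
  then have j: "U \<subseteq> A j" "j \<le> Suc n" 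
    unfolding j_def by (rule LeastI, rule Least_le)
  have "U \<noteq> {}" using assms(1) conn_nonempty by (auto simp: nonsep_def)
  then have j1: "j \<in> {1..Suc n}" using j A_0 by (cases j) auto
  have "\<not> U \<subseteq> A (j - 1)" using not_less_Least[of "j - 1" "\<lambda>j. U \<subseteq> A j"] j1 by (simp add: j_def)
  moreover have "j - 1 \<in> {1..n} \<or> j = 1" using j1 by auto
  ultimately have "U \<subseteq> B (j - 1)" using side[of "j - 1"] B_0 assms(2) by auto
  then have "U \<subseteq> W j" using j A_Int_B[OF j1] by auto
  then show ?thesis using j1 by auto
qed

lemma W_not_singleton:
  assumes "j \<in> {1..Suc n}"
  shows "W j \<noteq> {x}"
proof -
  consider "j = 1" | "j = Suc n" | "j \<in> {2..n}" using assms by fastforce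
  then show ?thesis
  proof cases
    case 1
    then show ?thesis using Ane[of 1] c_in(1)[of 1] n1 by (auto simp: A_def)
  next
    case 2
    then show ?thesis using Bne[of n] c_in(2)[of n] n1 by (auto simp: B_def)
  next
    case 3
    then have *: "j - 1 \<in> {1..n}" "j \<in> {1..n}" "j \<noteq> j - 1" by auto
    show ?thesis using c_in(2)[OF *(1)] c_in(1)[OF *(2)] c_neq[OF *(2,1,3)] 3 by auto
  qed
qed

lemma W_antichain:
  assumes "i \<in> {1..Suc n}" "j \<in> {1..Suc n}" "W i \<subseteq> W j"
  shows "i = j"
proof (rule ccontr)
  assume "i \<noteq> j"
  then obtain z where "W i \<subseteq> {z}"
    using W_Int_W[of i j] W_Int_W[of j i] assms by (metis linorder_neqE_nat singletonI subsetD subsetI)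
  moreover have "W i \<noteq> {}" using conn_W[OF assms(1)] by (rule conn_nonempty)
  ultimately show False using W_not_singleton[OF assms(1)] by blast
qed

text \<open>With additional edges \<open>F\<close> that keep \<open>m\<close>, the vertex \<open>c m\<close> still separates \<open>A m\<close> from \<open>B m\<close>.\<close>

definition keeps :: "'a rel \<Rightarrow> nat \<Rightarrow> bool" where
  "keeps F m \<longleftrightarrow> F \<subseteq> A m \<times> A m \<union> B m \<times> B m"

text \<open>The trace of a connected dominating set on one block. It must contain the cut vertices
  of the block, since the traces are glued together there.\<close>

definition loc :: "'a rel \<Rightarrow> nat \<Rightarrow> 'a set \<Rightarrow> bool" where
  "loc F j X \<longleftrightarrow> cds (E \<union> F) (W j) X \<and> Cut j \<subseteq> X"

lemma keeps_W:
  assumes "i \<in> {1..Suc n}" "F \<subseteq> W i \<times> W i"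
  shows "keeps F m"
proof (cases "i \<le> m")
  case True
  then have "W i \<subseteq> A m" using assms by (intro W_sub_A) auto
  then show ?thesis using assms by (auto simp: keeps_def)
next
  case False
  then have "W i \<subseteq> B m" using assms by (intro W_sub_B) auto
  then show ?thesis using assms by (auto simp: keeps_def)
qed

lemma cut_in_cds:
  assumes "cds (E \<union> F) V D" "m \<in> {1..n}" "keeps F m"
  shows "c m \<in> D"
proof (rule cds_contains_separator[OF assms(1)])
  show "V = A m \<union> B m" using AB[of m] assms(2) by simp
  show "A m \<inter> B m = {c m}" "A m \<noteq> {c m}" "B m \<noteq> {c m}" using assms meet Ane Bne by auto
  have *: "x = c m \<or> y = c m" if "(x, y) \<in> F" "x \<in> A m \<and> y \<in> B m \<or> y \<in> A m \<and> x \<in> B m" for x y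
  proof -
    have "x \<in> A m \<and> y \<in> A m \<or> x \<in> B m \<and> y \<in> B m" using assms(3) that by (auto simp: keeps_def)
    then show ?thesis using that meetD assms(2) by blast
  qed
  fix x y
  assume "(x, y) \<in> E \<union> F" "x \<in> A m" "y \<in> B m"
  then show "x = c m \<or> y = c m" using * sep assms(2) by blast
next
  fix x y
  assume xy: "(x, y) \<in> E \<union> F" "y \<in> A m" "x \<in> B m"
  have "x \<in> A m \<and> y \<in> A m \<or> x \<in> B m \<and> y \<in> B m" if "(x, y) \<in> F"
    using assms(3) that by (auto simp: keeps_def)
  moreover have "(y, x) \<in> E" if "(x, y) \<in> E" using symE that by (rule symD)
  ultimately show "x = c m \<or> y = c m" using sep[of y x m] xy meetD assms(2) by blast
qed

text \<open>Collapsing everything left of block \<open>j\<close> to \<open>c (j - 1)\<close> and everything right of it to \<open>c j\<close>.\<close>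

lemma loc_of_cds:
  assumes D: "cds (E \<union> F) V D" and j: "j \<in> {1..Suc n}"
    and F: "keeps F (j - 1)" "keeps F j"
  shows "loc (F \<inter> W j \<times> W j) j (D \<inter> W j)"
proof -
  define r where "r x = (if x \<in> A (j - 1) then c (j - 1) else if x \<in> B j then c j else x)" for x
  have j1: "j - 1 \<in> {1..n}" if "x \<in> A (j - 1)" for x
    using that A_0 j by (cases "j = 1") auto
  have j2: "j \<in> {1..n}" if "x \<in> B j" for x
    using that B_last j by (cases "j = Suc n") auto
  have cutD: "Cut j \<subseteq> D" using cut_in_cds[OF D] F by (auto simp: Cut_def)
  have r_A: "r x = c (j - 1)" if "x \<in> A (j - 1)" for x using that by (simp add: r_def)
  have r_B: "r x = c j" if "x \<in> B j" for x
    using that A_Int_B_skip[OF j, of x] by (auto simp: r_def)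
  have r_id: "r x = x" if "x \<in> W j" for x
  proof -
    have "x \<in> A j" "x \<in> B (j - 1)" using that A_Int_B[OF j] by auto
    then show ?thesis using meetD[of x] j1[of x] j2[of x] by (auto simp: r_def)
  qed
  have V3: "x \<in> A (j - 1) \<or> x \<in> B j \<or> x \<in> W j" if "x \<in> V" for x
  proof -
    have "j \<le> Suc n" "j - 1 \<le> Suc n" using j by auto
    then have "x \<in> A j \<or> x \<in> B j" "x \<in> A (j - 1) \<or> x \<in> B (j - 1)"
      using AB that by blast+
    then show ?thesis using A_Int_B[OF j] by blast
  qed
  have rW: "r x \<in> W j" if "x \<in> V" for x
    using V3[OF that]
  proof (elim disjE)
    assume "x \<in> A (j - 1)"
    then show ?thesis using r_A c_in(2)[OF j1] j by auto
  next
    assume "x \<in> B j"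
    then show ?thesis using r_B c_in(1)[OF j2] by auto
  qed (use r_id in auto)
  have DV: "D \<subseteq> V" using D by (simp add: cds_def)
  have rD: "r x \<in> D" if "x \<in> D" for x
  proof -
    have "x \<in> V" using DV that by auto
    from V3[OF this] show ?thesis
    proof (elim disjE)
      assume "x \<in> A (j - 1)"
      then show ?thesis using r_A j1 cutD by (auto simp: Cut_def)
    next
      assume "x \<in> B j"
      then show ?thesis using r_B j2 cutD by (auto simp: Cut_def)
    qed (use r_id that in auto)
  qed
  \<comment> \<open>\<open>r\<close> moves vertices only to cut vertices that belong to
    \<open>D\<close>, so the image adds nothing to the trace.\<close>
  have eqD: "r ` D = D \<inter> W j" using rD rW DV r_id by force
  have E: "r x = r y \<or> (r x, r y) \<in> E \<union> (F \<inter> W j \<times> W j)" if xy: "(x, y) \<in> E \<union> F" for x y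
  proof -
    have "x \<in> A (j - 1) \<and> y \<in> A (j - 1) \<or> x \<in> B j \<and> y \<in> B j \<or> x \<in> W j \<and> y \<in> W j"
    proof (cases "(x, y) \<in> E")
      case True
      then obtain i where i: "i \<in> {1..Suc n}" "x \<in> W i" "y \<in> W i" using edge by blast
      consider "i \<in> {1..j - 1}" | "i = j" | "i \<in> {Suc j..Suc n}" using i by force
      then show ?thesis using i W_sub_A[of i "j - 1"] W_sub_B[of i j] by cases auto
    next
      case False
      then have "(x, y) \<in> F" using xy by auto
      then show ?thesis using F A_Int_B[OF j] by (auto simp: keeps_def)
    qed
    then show ?thesis using r_A r_B r_id xy by auto
  qed
  have "cds (E \<union> (F \<inter> W j \<times> W j)) (W j) (r ` D)"
  proof (rule cds_image[OF D])
    show "W j \<subseteq> r ` V" using r_id W_sub_V[OF j] by force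
    show "r ` D \<subseteq> W j" using eqD by auto
  qed (use E in auto)
  moreover have "Cut j \<subseteq> W j" using W_Int_cuts[OF j] by auto
  ultimately show ?thesis using cutD eqD by (auto simp: loc_def)
qed

text \<open>Neighbouring local sets share \<open>c j\<close>, so their union is connected; every
  vertex is dominated within its own block.\<close>

lemma cds_of_loc:
  assumes "\<And>j. j \<in> {1..Suc n} \<Longrightarrow> loc F j (X j)" "sym F"
  shows "cds (E \<union> F) V (\<Union>j \<in> {1..Suc n}. X j)"
  unfolding cds_def
proof (intro conjI ballI)
  have X: "X j \<subseteq> W j" "conn (E \<union> F) (X j)" "Cut j \<subseteq> X j"
    "\<And>v. v \<in> W j \<Longrightarrow> v \<in> X j \<or> (\<exists>u \<in> X j. (u, v) \<in> E \<union> F)" if "j \<in> {1..Suc n}" for j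
    using assms(1)[OF that] by (auto simp: loc_def cds_def)
  show "(\<Union>j \<in> {1..Suc n}. X j) \<subseteq> V" using X(1) W_sub_V by blast
  show "conn (E \<union> F) (\<Union>j \<in> {1..Suc n}. X j)"
  proof (rule conn_chain)
    fix j assume j: "j \<in> {1..<Suc n}"
    then have "c j \<in> X j" "c j \<in> X (Suc j)"
      using X(3)[of j] X(3)[of "Suc j"] by (auto simp: Cut_def)
    then show "\<exists>x \<in> X j. \<exists>y \<in> X (Suc j). x = y \<or> (x, y) \<in> E \<union> F" by auto
  next
    show "(\<Union>j \<in> {1..Suc n}. X j) \<noteq> {}" using X(2)[of 1] conn_nonempty by fastforce
    show "sym (E \<union> F)" using symE assms(2) by (auto simp: sym_def)
  qed (use X in auto)
  fix v assume "v \<in> V"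
  then obtain j where "j \<in> {1..Suc n}" "v \<in> W j" unfolding V_eq A_def by blast
  then show "v \<in> (\<Union>j \<in> {1..Suc n}. X j) \<or> (\<exists>u \<in> (\<Union>j \<in> {1..Suc n}. X j). (u, v) \<in> E \<union> F)"
    using X(4)[of j v] by blast
qed

lemma loc_mono:
  assumes "loc F j X" "F \<subseteq> F'"
  shows "loc F' j X"
proof -
  have "conn (E \<union> F') X"
    using assms by (intro conn_mono[of "E \<union> F" X "E \<union> F'"]) (auto simp: loc_def cds_def)
  then show ?thesis using assms unfolding loc_def cds_def by fast
qed

text \<open>Only block \<open>i\<close> is rebuilt: elsewhere the trace of \<open>D\<close> stays
  valid without the edges of \<open>F\<close>. The cut vertices of block \<open>i\<close> are in
  \<open>D\<close> already, so only the interior \<open>C i\<close> enters the comparison of sizes.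
  The bound is additive to avoid subtraction of naturals.\<close>

lemma exchange:
  assumes D: "cds (E \<union> F) V D" and i: "i \<in> {1..Suc n}" and X: "loc F' i X"
    and F: "F \<subseteq> W i \<times> W i" "\<And>x. (x, x) \<notin> F" and F': "sym F'"
  obtains D' where "cds (E \<union> F') V D'" "card D' + card (D \<inter> C i) \<le> card D + card (X \<inter> C i)"
proof -
  define Y where "Y j = (if j = i then X else D \<inter> W j)" for j
  have Y: "loc F' j (Y j)" if j: "j \<in> {1..Suc n}" for j
  proof (cases "j = i")
    case False
    have "loc (F \<inter> W j \<times> W j) j (D \<inter> W j)"
      by (rule loc_of_cds[OF D j]) (rule keeps_W[OF i F(1)])+
    moreover have "x = y" if x: "x \<in> W i" "x \<in> W j" and y: "y \<in> W i" "y \<in> W j" for x y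
    proof (cases "i < j")
      case True
      then show ?thesis using W_Int_W[OF i j True x] W_Int_W[OF i j True y] by simp
    next
      case f: False
      then have "j < i" using False by simp
      then show ?thesis using W_Int_W[OF j i _ x(2,1)] W_Int_W[OF j i _ y(2,1)] by simp
    qed
    \<comment> \<open>Two blocks share at most one vertex and \<open>F\<close> has no loops, so no
      edge of \<open>F\<close> lies inside block \<open>j\<close>.\<close>
    then have "F \<inter> W j \<times> W j = {}" using F by fast
    ultimately have "loc {} j (D \<inter> W j)" by simp
    then show ?thesis using False by (auto simp: Y_def intro: loc_mono)
  qed (use X in \<open>simp add: Y_def\<close>)
  define D' where "D' = (\<Union>j \<in> {1..Suc n}. Y j)"
  have "cds (E \<union> F') V D'" unfolding D'_def by (intro cds_of_loc Y F')
  moreover have "card D' + card (D \<inter> C i) \<le> card D + card (X \<inter> C i)"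
  proof -
    have DV: "D \<subseteq> V" using D by (simp add: cds_def)
    have fD: "finite D" by (rule finite_subset[OF DV fin])
    have XW: "X \<subseteq> W i" using X by (auto simp: loc_def cds_def)
    then have fX: "finite X" using W_sub_V[OF i] by (intro finite_subset[OF _ fin]) simp
    have cutD: "Cut i \<subseteq> D" 
      using cut_in_cds[OF D _ keeps_W[OF i F(1)]] by (auto simp: Cut_def)
    have "Y j \<subseteq> (D - C i) \<union> (X \<inter> C i)" if j: "j \<in> {1..Suc n}" for j
    proof (cases "j = i")
      case True
      have "x \<in> D - C i \<or> x \<in> X \<inter> C i" if "x \<in> X" for x
      proof -
        have "x \<in> C i \<union> Cut i" using that XW W_split[OF i] by (metis subsetD)
        then show ?thesis using that cutD by blast
      qed
      then show ?thesis using True by (auto simp: Y_def)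
    next
      case False
      then show ?thesis using C_Int_W[OF i j] by (auto simp: Y_def)
    qed
    then have "D' \<subseteq> (D - C i) \<union> (X \<inter> C i)" unfolding D'_def by (rule UN_least)
    then have "card D' \<le> card ((D - C i) \<union> (X \<inter> C i))" using fD fX by (intro card_mono) auto
    also have "\<dots> \<le> card (D - C i) + card (X \<inter> C i)" by (rule card_Un_le)
    finally have "card D' \<le> card (D - C i) + card (X \<inter> C i)" .
    moreover have "card (D - C i) + card (D \<inter> C i) = card D"
      using card_Int_Diff[OF fD, of "C i"] by simp
    ultimately show ?thesis by linarith
  qed
  ultimately show ?thesis by (rule that)
qed

end


section \<open>Critical graphs with a chain of blocks\<close>

definition link :: "'a \<Rightarrow> 'a \<Rightarrow> 'a rel" where
  "link u v = {(u, v), (v, u)}"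

lemma sym_link: "sym (link u v)"
  by (auto simp: link_def sym_def)

context block_chain begin

lemma edge_C:
  assumes "(x, y) \<in> E" "x \<in> C i" "i \<in> {1..Suc n}"
  shows "y \<in> W i"
proof -
  obtain j where j: "j \<in> {1..Suc n}" "x \<in> W j" "y \<in> W j" using edge[OF assms(1)] by auto
  have "j = i" using C_Int_W[of i j] assms j by auto
  then show ?thesis using j by simp
qed

lemma ex_neighbour:
  assumes "j \<in> {1..Suc n}" "x \<in> W j"
  shows "\<exists>u \<in> W j. (x, u) \<in> E"
proof (rule ccontr)
  assume "\<not> (\<exists>u \<in> W j. (x, u) \<in> E)"
  then have "W j \<subseteq> {x}" using assms by (intro connD[OF conn_W[OF assms(1)], of x]) auto
  then show False using W_not_singleton[OF assms(1), of x] assms(2) by auto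
qed

lemma Cut_first: "Cut 1 = {c 1}"
  using n1 by (auto simp: Cut_def)

lemma Cut_mid: "2 \<le> i \<Longrightarrow> i \<le> n \<Longrightarrow> Cut i = {c (i - 1), c i}"
proof -
  assume "2 \<le> i" "i \<le> n"
  then have "{i - 1, i} \<inter> {1..n} = {i - 1, i}" by auto
  then show "Cut i = {c (i - 1), c i}" by (simp add: Cut_def)
qed

lemma Cut_last: "Cut (Suc n) = {c n}"
  using n1 by (auto simp: Cut_def)

lemma C_sub_W: "C j \<subseteq> W j" by (auto simp: C_def)

lemma c_notin_C: "m \<in> {1..n} \<Longrightarrow> c m \<notin> C j" by (auto simp: C_def)

end

locale critical_chain = block_chain n W c V E for n :: nat and W :: "nat \<Rightarrow> 'a set" and c V E +
  fixes D :: "'a set" and l :: nat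
  assumes D: "cds E V D"
    and Dmin: "\<And>D'. cds E V D' \<Longrightarrow> card D \<le> card D'"
    and crit: "\<And>u v. u \<in> V \<Longrightarrow> v \<in> V \<Longrightarrow> u \<noteq> v \<Longrightarrow> (u, v) \<notin> E \<Longrightarrow>
      \<exists>D'. cds (E \<union> link u v) V D' \<and> card D' < card D"
    and card_D: "card D = n + 3"
    and l: "l \<in> {1..n}"
    and card_l: "card (D \<inter> C l) = 1"
    and card_other: "\<And>i. i \<in> {1..n} \<Longrightarrow> i \<noteq> l \<Longrightarrow> card (D \<inter> C i) = 0"
    and card_last: "card (D \<inter> C (Suc n)) = 2"
begin

lemma D_local:
  assumes "i \<in> {1..Suc n}"
  shows "loc {} i (D \<inter> W i)"
  using loc_of_cds[of "{}" D i] D assms by (simp add: keeps_def)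

text \<open>If \<open>X\<close> had fewer interior vertices, exchanging it for the trace of
  \<open>D\<close> would give a set smaller than the minimum.\<close>

lemma min_local:
  assumes "i \<in> {1..Suc n}" "loc {} i X"
  shows "card (D \<inter> C i) \<le> card (X \<inter> C i)"
proof -
  have D0: "cds (E \<union> {}) V D" using D by simp
  obtain D' where "cds (E \<union> {}) V D'" "card D' + card (D \<inter> C i) \<le> card D + card (X \<inter> C i)"
    by (rule exchange[OF D0 assms]) (auto simp: sym_def)
  then show ?thesis using Dmin[of D'] by simp
qed

text \<open>The smaller set obtained with the edge \<open>uv\<close> is changed back to
  \<open>D\<close> on block \<open>i\<close>, which makes it valid without that edge. Its size is
  then at least that of \<open>D\<close>, so the saving must occur in the interior of block
  \<open>i\<close>.\<close>

lemma crit_local: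
  assumes i: "i \<in> {1..Suc n}" and uv: "u \<in> W i" "v \<in> W i" "u \<noteq> v" "(u, v) \<notin> E"
  shows "\<exists>X. loc (link u v) i X \<and> card (X \<inter> C i) < card (D \<inter> C i)"
proof -
  have "u \<in> V" "v \<in> V" using uv W_sub_V[OF i] by auto
  then obtain D' where D': "cds (E \<union> link u v) V D'" "card D' < card D" using crit uv by blast
  have F: "link u v \<subseteq> W i \<times> W i" using uv by (auto simp: link_def)
  obtain D'' where D'': "cds (E \<union> {}) V D''"
    "card D'' + card (D' \<inter> C i) \<le> card D' + card (D \<inter> W i \<inter> C i)"
    by (rule exchange[OF D'(1) i D_local[OF i] F]) (use uv in \<open>auto simp: link_def sym_def\<close>)
  have "D \<inter> W i \<inter> C i = D \<inter> C i" using C_sub_W by blast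
  moreover have "card D \<le> card D''" using D'' Dmin by simp
  ultimately have *: "card (D' \<inter> C i) < card (D \<inter> C i)" using D''(2) D'(2) by simp
  have "loc (link u v \<inter> W i \<times> W i) i (D' \<inter> W i)"
    by (rule loc_of_cds[OF D'(1) i]) (rule keeps_W[OF i F])+
  moreover have "link u v \<inter> W i \<times> W i = link u v" using F by auto
  moreover have "D' \<inter> W i \<inter> C i = D' \<inter> C i" using C_sub_W by blast
  ultimately show ?thesis using * by (intro exI[of _ "D' \<inter> W i"]) simp
qed

text \<open>A missing edge would have to save an interior vertex where \<open>D\<close> has
  none.\<close>

lemma complete_block:
  assumes "i \<in> {1..n}" "i \<noteq> l" "u \<in> W i" "v \<in> W i" "u \<noteq> v"
  shows "(u, v) \<in> E"
  using crit_local[of i u v] assms card_other[of i] by auto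

text \<open>
  If \<open>w\<close> were an interior vertex of a complete block, joining it to a neighbour \<open>u\<close> of \<open>c i\<close> in
  the next block would be useless, because \<open>c i\<close> could replace \<open>w\<close>.
\<close>

lemma no_shortcut:
  assumes i: "i \<in> {1..n}" "i \<noteq> l" and w: "w \<in> C i"
    and dom: "\<And>u D'. u \<in> W (Suc i) \<Longrightarrow> u \<noteq> c i \<Longrightarrow> cds (E \<union> link w u) V D' \<Longrightarrow> w \<notin> D' \<Longrightarrow>
      \<exists>x \<in> D'. (x, w) \<in> E"
  shows False
proof -
  have i': "i \<in> {1..Suc n}" "Suc i \<in> {1..Suc n}" using i by auto
  obtain u where u: "u \<in> W (Suc i)" "(c i, u) \<in> E"
    using ex_neighbour[OF i'(2) c_in(2)[OF i(1)]] by auto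
  have uc: "u \<noteq> c i" using u irr by auto
  have wW: "w \<in> W i" using w C_sub_W by auto
  have wc: "w \<noteq> c i" using w c_notin_C i by auto
  have wA: "w \<in> A i" and uB: "u \<in> B i" using wW u W_sub_A[of i i] W_sub_B[of "Suc i" i] i by auto
  have nE: "(w, u) \<notin> E" using sep[of w u i] wA uB wc uc i by auto
  have wu: "w \<noteq> u" using meetD[of w i] wA uB wc i by auto
  have V: "w \<in> V" "u \<in> V" "c i \<in> V" using wW u W_sub_V[OF i'(1)] W_sub_V[OF i'(2)] c_V[OF i(1)] by auto
  obtain D' where D': "cds (E \<union> link w u) V D'" "card D' < card D" using crit[OF V(1,2) wu nE] by auto
  \<comment> \<open>Folding \<open>w\<close> onto \<open>c i\<close> respects all edges: block
    \<open>i\<close> is complete, and the new neighbour \<open>u\<close> of \<open>w\<close> is a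
    neighbour of \<open>c i\<close>.\<close>
  define f where "f x = (if x = w then c i else x)" for x
  have ci: "c i \<in> W i" using c_in i by auto
  have hom: "f x = f y \<or> (f x, f y) \<in> E" if xy: "(x, y) \<in> E \<union> link w u" for x y
  proof -
    have w_nb: "y = c i \<or> (c i, y) \<in> E" if "(w, y) \<in> E \<union> link w u" for y
    proof (cases "y = u")
      case False
      then have "y \<in> W i" using that wu edge_C[of w y i] w i' by (auto simp: link_def)
      then show ?thesis using complete_block[OF i ci, of y] by auto
    qed (use u in simp)
    have sym': "(y, x) \<in> E \<union> link w u" using xy symE by (auto simp: link_def dest: symD)
    consider "x = w" "y = w" | "x = w" "y \<noteq> w" | "x \<noteq> w" "y = w" | "x \<noteq> w" "y \<noteq> w" by blast
    then show ?thesis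
    proof cases
      case 2
      then show ?thesis using w_nb[of y] xy by (auto simp: f_def)
    next
      case 3
      then have "x = c i \<or> (c i, x) \<in> E" using w_nb[of x] sym' by auto
      then show ?thesis using 3 symD[OF symE] by (auto simp: f_def)
    next
      case 4
      then show ?thesis using xy by (auto simp: f_def link_def)
    qed (simp add: f_def)
  qed
  have DV: "D' \<subseteq> V" using D' by (simp add: cds_def)
  \<comment> \<open>The fold never reaches \<open>w\<close>, so \<open>w\<close> is absent from the
    target. Its domination is checked separately, with \<open>dom\<close> for the case that
    \<open>w\<close> is not in \<open>D'\<close>.\<close>
  have "cds E (V - {w}) (f ` D')"
  proof (rule cds_image[OF D'(1)])
    show "V - {w} \<subseteq> f ` V" by (auto simp: f_def)
    show "f ` D' \<subseteq> V - {w}" using DV V wc by (auto simp: f_def)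
  qed (use hom in auto)
  moreover have "\<exists>x \<in> f ` D'. (x, w) \<in> E"
  proof (cases "w \<in> D'")
    case True
    have "f w = c i" by (simp add: f_def)
    then have "c i \<in> f ` D'" using True by (metis imageI)
    moreover have "(c i, w) \<in> E" using complete_block[OF i ci wW] wc by simp
    ultimately show ?thesis by blast
  next
    case False
    then obtain x where "x \<in> D'" "(x, w) \<in> E" using dom[OF u(1) uc D'(1)] by blast
    moreover have "f x = x" using False \<open>x \<in> D'\<close> by (auto simp: f_def)
    ultimately show ?thesis by (metis imageI)
  qed
  ultimately have "cds E V (f ` D')" unfolding cds_def by blast
  then have "card D \<le> card (f ` D')" by (rule Dmin)
  also have "\<dots> \<le> card D'" by (intro card_image_le finite_subset[OF DV fin])
  finally show False using D'(2) by simp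
qed

text \<open>Both ends of the new edge lie to the right of \<open>c (i - 1)\<close>, which therefore
  stays in every connected dominating set and dominates \<open>w\<close>.\<close>

lemma interior_mid:
  assumes "i \<in> {2..n}" "i \<noteq> l"
  shows "C i = {}"
proof (rule ccontr)
  assume "C i \<noteq> {}"
  then obtain w where w: "w \<in> C i" by auto
  have i: "i \<in> {1..n}" "i - 1 \<in> {1..n}" using assms by auto
  have wW: "w \<in> W i" using w C_sub_W by auto
  show False
  proof (rule no_shortcut[OF i(1) assms(2) w])
    fix u D' assume u: "u \<in> W (Suc i)" and D': "cds (E \<union> link w u) V D'"
    have "w \<in> B (i - 1)" "u \<in> B (i - 1)"
      using u wW W_sub_B[of i "i - 1"] W_sub_B[of "Suc i" "i - 1"] assms by auto
    then have "keeps (link w u) (i - 1)" by (auto simp: keeps_def link_def)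
    then have "c (i - 1) \<in> D'" using cut_in_cds[OF D'] i by blast
    moreover have "c (i - 1) \<in> W i" using c_in(2)[OF i(2)] assms by auto
    then have "(c (i - 1), w) \<in> E"
      using complete_block[OF i(1) assms(2) _ wW] c_notin_C[OF i(2)] w by auto
    ultimately show "\<exists>x \<in> D'. (x, w) \<in> E" by blast
  qed
qed

text \<open>Block \<open>1\<close> has no earlier cut vertex to dominate \<open>w\<close>; a second
  interior vertex \<open>w'\<close> takes over. It is in the set or dominated from inside the
  complete block, and either way \<open>w\<close> has a neighbour in the set.\<close>

lemma interior_first:
  assumes "l \<noteq> 1"
  shows "\<exists>x. C 1 = {x}"
proof -
  have one: "1 \<in> {1..n}" "1 \<in> {1..Suc n}" using n1 by auto
  have W1: "W 1 = C 1 \<union> {c 1}" using W_split[OF one(2)] Cut_first by simp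
  have "C 1 \<noteq> {}" using W1 W_not_singleton[OF one(2), of "c 1"] by auto
  then obtain w where w: "w \<in> C 1" by auto
  have "w' = w" if w': "w' \<in> C 1" for w'
  proof (rule ccontr)
    assume ne: "w' \<noteq> w"
    have W: "w \<in> W 1" "w' \<in> W 1" using w w' C_sub_W by auto
    show False
    proof (rule no_shortcut[OF one(1) assms[symmetric] w])
      fix u D' assume u: "u \<in> W (Suc 1)" "u \<noteq> c 1" and D': "cds (E \<union> link w u) V D'" "w \<notin> D'"
      have uB: "u \<in> B 1" and w'A: "w' \<in> A 1"
        using u W W_sub_B[of "Suc 1" 1] W_sub_A[of 1 1] n1 by auto
      have w'u: "w' \<noteq> u" using meetD[of u 1] uB w'A u one by auto
      have "w' \<in> V" using W W_sub_V[OF one(2)] by auto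
      then consider "w' \<in> D'" | x where "x \<in> D'" "(x, w') \<in> E \<union> link w u"
        using D' unfolding cds_def by blast
      then show "\<exists>x \<in> D'. (x, w) \<in> E"
      proof cases
        case 1
        then show ?thesis using complete_block[OF one(1) assms[symmetric] W(2,1) ne] by blast
      next
        case 2
        then have "(w', x) \<in> E" using ne w'u symD[OF symE] by (auto simp: link_def)
        then have "x \<in> W 1" using edge_C[of w' x 1] w' one by auto
        moreover have "x \<noteq> w" using 2 D' by auto
        ultimately show ?thesis using complete_block[OF one(1) assms[symmetric] _ W(1)] 2 by blast
      qed
    qed
  qed
  then show ?thesis using w by blast
qed

text \<open>The share of block \<open>l\<close> is one interior vertex, and a new edge has to bring
  it down to none.\<close>

lemma crit_l:
  assumes "u \<in> W l" "v \<in> W l" "u \<noteq> v" "(u, v) \<notin> E"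
  shows "loc (link u v) l (Cut l)"
proof -
  have l': "l \<in> {1..Suc n}" using l by auto
  obtain X where X: "loc (link u v) l X" "card (X \<inter> C l) < 1"
    using crit_local[OF l' assms] card_l by auto
  have XW: "X \<subseteq> W l" "Cut l \<subseteq> X" using X by (auto simp: loc_def cds_def)
  have "finite X" using XW W_sub_V[OF l'] by (intro finite_subset[OF _ fin]) simp
  then have "X \<inter> C l = {}" using X by simp
  then have "X = Cut l" using XW W_split[OF l'] by auto
  then show ?thesis using X by simp
qed

lemma not_loc_l: "\<not> loc {} l (Cut l)"
proof
  assume "loc {} l (Cut l)"
  then have "card (D \<inter> C l) \<le> card (Cut l \<inter> C l)" using l by (intro min_local) auto
  moreover have "Cut l \<inter> C l = {}" using C_Cut by blast
  ultimately show False using card_l by simp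
qed

text \<open>With at most one vertex in \<open>Q\<close>, the block or the block without that vertex
  would be the non-adjacent pair \<open>p\<close>, \<open>q\<close>, yet connected.\<close>

lemma card_interior_ge:
  assumes j: "j \<in> {1..Suc n}" and Q: "W j = Q \<union> {p, q}" "p \<notin> Q" "q \<notin> Q" "p \<noteq> q" "(p, q) \<notin> E"
  shows "2 \<le> card Q"
proof (rule ccontr)
  assume "\<not> 2 \<le> card Q"
  moreover have "finite Q" using Q W_sub_V[OF j] by (intro finite_subset[OF _ fin]) auto
  ultimately consider "Q = {}" | x where "Q = {x}"
    by (metis One_nat_def card_0_eq card_1_singletonE less_2_cases not_le)
  then have "conn E {p, q}"
  proof cases
    case 1
    then show ?thesis using conn_W[OF j] Q by simp
  next
    case 2
    then have "W j - {x} = {p, q}" using Q by auto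
    then show ?thesis using conn_W_minus[OF j, of x] by auto
  qed
  then show False using conn_pairD Q by metis
qed

end


section \<open>The path \<open>c0, c 1, ..., c n\<close> and the non-adjacent cut vertices of block
  \<open>l\<close>\<close>

context critical_chain begin

text \<open>The labeling starts at \<open>c 1\<close>; an interior vertex \<open>c0\<close> of the
  first block is put at index \<open>0\<close> as the start of the path in
  \<open>G1_class\<close>.\<close>

lemma c0_inj:
  assumes "c0 \<in> C 1"
  shows "inj_on (c(0 := c0)) {0..n}"
proof (rule inj_onI)
  fix x y assume xy: "x \<in> {0..n}" "y \<in> {0..n}" "(c(0 := c0)) x = (c(0 := c0)) y"
  have *: "c j \<noteq> c0" if "j \<in> {1..n}" for j using c_notin_C[OF that, of 1] assms by auto
  show "x = y"
  proof (cases "x = 0 \<or> y = 0")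
    case True
    then show ?thesis using xy *[of x] *[of y] by (auto split: if_splits)
  next
    case False
    then show ?thesis using xy c_neq[of x y] by auto
  qed
qed

text \<open>Complete blocks without spare interior vertices are single edges. For
  \<open>l = 1\<close> the first block is the exceptional one, so \<open>c0\<close> is then just one
  of its interior vertices.\<close>

lemma path_block:
  assumes "c0 \<in> C 1" "l \<noteq> 1 \<Longrightarrow> C 1 = {c0}" and i: "i \<in> {1..n}" "i \<noteq> l"
  shows "W i = {(c(0 := c0)) (i - 1), (c(0 := c0)) i}"
    and "((c(0 := c0)) (i - 1), (c(0 := c0)) i) \<in> E"
proof -
  show W: "W i = {(c(0 := c0)) (i - 1), (c(0 := c0)) i}"
  proof (cases "i = 1")
    case True
    then show ?thesis using W_split[of 1] Cut_first assms by auto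
  next
    case False
    then have "2 \<le> i" "i \<le> n" using i by auto
    then show ?thesis using W_split[of i] Cut_mid[of i] interior_mid[of i] i by auto
  qed
  have "(c(0 := c0)) (i - 1) \<noteq> (c(0 := c0)) i"
  proof
    assume "(c(0 := c0)) (i - 1) = (c(0 := c0)) i"
    moreover have "i - 1 \<in> {0..n}" "i \<in> {0..n}" using i by auto
    ultimately have "i - 1 = i" using inj_onD[OF c0_inj[OF assms(1)]] by blast
    then show False using i by auto
  qed
  then show "((c(0 := c0)) (i - 1), (c(0 := c0)) i) \<in> E"
    using W by (intro complete_block[OF i]) auto
qed

text \<open>
  If \<open>c (l - 1)\<close> and \<open>c l\<close> were adjacent, block \<open>l\<close> would contain a vertex \<open>y\<close> adjacent to
  neither. Joining \<open>y\<close> to the end \<open>c0\<close> of the path closes a cycle through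
  \<open>c0, c 1, \<dots>, c (l - 1), C l - {y}, y\<close> and does not decrease the connected domination number.
\<close>

lemma not_adjacent_l:
  assumes l2: "2 \<le> l"
  shows "(c (l - 1), c l) \<notin> E"
proof
  assume adj: "(c (l - 1), c l) \<in> E"
  have ln: "l \<in> {1..n}" "l \<in> {1..Suc n}" "l \<le> n" "l - 1 \<in> {1..n}" using l l2 by auto
  have Cut: "Cut l = {c (l - 1), c l}" using Cut_mid l2 ln by auto
  have cW: "c (l - 1) \<in> W l" "c l \<in> W l" using c_in ln l2 c_in(2)[OF ln(4)] by auto
  have "conn E (Cut l)" unfolding Cut by (rule conn_pair[OF adj symE])
  \<comment> \<open>As the two cut vertices are adjacent, they can fail to be a local set only by
    not dominating some \<open>y\<close>.\<close>
  then have "\<exists>y \<in> W l. y \<notin> Cut l \<and> (\<forall>u \<in> Cut l. (u, y) \<notin> E)"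
    using not_loc_l cW Cut by (auto simp: loc_def cds_def)
  then obtain y where y: "y \<in> W l" "y \<notin> Cut l" "\<And>u. u \<in> Cut l \<Longrightarrow> (u, y) \<notin> E" by blast
  have yC: "y \<in> C l" using y W_split[OF ln(2)] by auto
  define X where "X = C l - {y}"
  obtain x0 where x0: "x0 \<in> W l" "(y, x0) \<in> E" using ex_neighbour[OF ln(2) y(1)] by auto
  have "x0 \<in> X" using x0 y(3) W_split[OF ln(2)] symD[OF symE x0(2)] irr by (auto simp: X_def)
  obtain c0 where C1: "C 1 = {c0}" using interior_first l2 by auto
  define cc where "cc = c(0 := c0)"
  have c0: "c0 \<in> C 1" using C1 by simp
  have inj_cc: "inj_on cc {0..n}" unfolding cc_def by (rule c0_inj[OF c0])
  have Wi: "W i = {cc (i - 1), cc i}" if "i \<in> {1..n}" "i \<noteq> l" for i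
    using path_block[OF c0 C1 that] by (simp add: cc_def)
  have "1 \<in> {1..l - 1}" using l2 by auto
  then have c0A: "c0 \<in> A (l - 1)" using c0 C_sub_W W_sub_A[of 1 "l - 1"] by blast
  have yB: "y \<in> B (l - 1)" and yA: "y \<in> A l" using y A_Int_B[OF ln(2)] by auto
  have c0_no: "c0 \<noteq> c j" if "j \<in> {1..n}" for j using c_notin_C[OF that, of 1] c0 by auto
  have y_no: "y \<noteq> c j" if "j \<in> {1..n}" for j using c_notin_C[OF that, of l] yC by auto
  have nE: "(y, c0) \<notin> E"
  proof
    assume "(y, c0) \<in> E"
    then have "(c0, y) \<in> E" by (rule symD[OF symE])
    then show False using sep[of c0 y "l - 1"] c0A yB ln c0_no y_no by auto
  qed
  have ne: "y \<noteq> c0" using meetD[of y "l - 1"] c0A yB ln y_no by auto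
  have c0V: "c0 \<in> V" using c0 C_sub_W W_sub_V[of 1] by auto
  have yV: "y \<in> V" using y W_sub_V[OF ln(2)] by auto
  define F where "F = link y c0"
  obtain D' where D': "cds (E \<union> F) V D'" "card D' < n + 3"
    using crit[OF yV c0V ne nE] card_D by (auto simp: F_def)
  have DV: "D' \<subseteq> V" using D' by (simp add: cds_def)
  have fD: "finite D'" by (rule finite_subset[OF DV fin])
  have c0A': "c0 \<in> A m" and yA': "y \<in> A m" if "l \<le> m" for m
  proof -
    have "l - 1 \<le> m" using that by simp
    then show "c0 \<in> A m" "y \<in> A m" using c0A yA A_mono[of "l - 1" m] A_mono[OF that] by blast+
  qed
  \<comment> \<open>The new edge lies inside \<open>A m\<close> whenever \<open>l \<le> m\<close>,
    so the cut vertices from \<open>c l\<close> on keep separating.\<close>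
  have keepsF: "keeps F m" if "l \<le> m" for m
    using c0A'[OF that] yA'[OF that] by (auto simp: keeps_def F_def link_def)
  \<comment> \<open>Counted are \<open>n - l + 1\<close> cut vertices and two interior vertices of
    the last block. With \<open>card D' < n + 3\<close>, at most \<open>l - 1\<close> vertices
    remain outside \<open>B l\<close>, while the cycle of length \<open>l + 2\<close> requires
    \<open>l\<close>.\<close>
  have right: "n - l + 3 \<le> card (D' \<inter> B l)"
  proof -
    have cD: "c m \<in> D'" if "m \<in> {l..n}" for m
      using cut_in_cds[OF D'(1) _ keepsF] that ln by auto
    have "loc (F \<inter> W (Suc n) \<times> W (Suc n)) (Suc n) (D' \<inter> W (Suc n))"
      using loc_of_cds[OF D'(1), of "Suc n"] keepsF[of n] keepsF[of "Suc n"] ln by simp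
    moreover have "c0 \<notin> W (Suc n)" using C_Int_W[of 1 "Suc n"] c0 n1 by auto
    then have "F \<inter> W (Suc n) \<times> W (Suc n) = {}" by (auto simp: F_def link_def)
    ultimately have "loc {} (Suc n) (D' \<inter> W (Suc n))" by simp
    then have "2 \<le> card (D' \<inter> W (Suc n) \<inter> C (Suc n))"
      using min_local[of "Suc n"] card_last by simp
    moreover have "card (c ` {l..n}) = Suc n - l"
      using inj_on_subset[OF inj, of "{l..n}"] ln by (simp add: card_image)
    moreover have "c ` {l..n} \<inter> (D' \<inter> W (Suc n) \<inter> C (Suc n)) = {}"
      using c_notin_C[of _ "Suc n"] ln by auto
    ultimately have "Suc n - l + 2 \<le> card (c ` {l..n} \<union> (D' \<inter> W (Suc n) \<inter> C (Suc n)))"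
      using fD by (subst card_Un_disjoint) auto
    also have "\<dots> \<le> card (D' \<inter> B l)"
    proof (rule card_mono)
      show "c ` {l..n} \<union> (D' \<inter> W (Suc n) \<inter> C (Suc n)) \<subseteq> D' \<inter> B l"
        using cD c_B[of _ l] W_sub_B[of "Suc n" l] ln by auto
    qed (use fD in simp)
    finally show ?thesis using ln by simp
  qed
  \<comment> \<open>\<open>c l\<close> is adjacent to \<open>c (l - 1)\<close> and possibly to
    vertices of \<open>X\<close>, so the side \<open>B l\<close> may be folded onto class
    \<open>l - 1\<close> or class \<open>l\<close>. The class is chosen to contain a vertex of
    \<open>D'\<close> outside \<open>B l\<close>, so that the vertices in \<open>B l\<close>
    contribute no class of their own to the count.\<close>
  define a where "a = (if c (l - 1) \<in> D' then l - 1 else l)"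
  define h where "h x = (if x \<in> B l then a else if x = y then l + 1 else if x \<in> C l then l
    else inv_into {0..n} cc x)" for x
  have hB: "h x = a" if "x \<in> B l" for x using that by (simp add: h_def)
  have CB: "x \<notin> B l" if "x \<in> C l" for x
  proof
    assume "x \<in> B l"
    moreover have "x \<in> A l" using that C_sub_W W_sub_A[of l l] ln by auto
    ultimately show False using meetD ln that c_notin_C by blast
  qed
  have hy: "h y = l + 1" using CB[OF yC] by (simp add: h_def)
  have hX: "h x = l" if "x \<in> X" for x using CB[of x] that by (simp add: h_def X_def)
  have ccA: "cc j \<in> A (l - 1)" if "j < l" for j
    using c0A c_A[of j "l - 1"] that ln by (cases "j = 0") (auto simp: cc_def)
  have ccC: "cc j \<notin> C l" if "j < l" for j
    using c_notin_C[of j l] C_Int_W[of 1 l] c0 C_sub_W that ln l2 by (cases "j = 0") (auto simp: cc_def)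
  have hcc: "h (cc j) = j" if "j < l" for j
  proof -
    have "cc j \<notin> B l" using A_Int_B_skip[OF ln(2) ccA[OF that]] by auto
    moreover have "inv_into {0..n} cc (cc j) = j" using inj_cc that ln by (intro inv_into_f_f) auto
    ultimately show ?thesis using ccC[OF that] yC by (auto simp: h_def)
  qed
  have hcl: "h (c (l - 1)) = l - 1" using hcc[of "l - 1"] l2 by (auto simp: cc_def)
  have hl: "h (c l) = a" using hB c_B[of l l] ln by auto
  let ?R = "cycle_rel (l + 2)"
  have R: "(i, j) \<in> ?R" "(j, i) \<in> ?R" if "j = Suc i" "i < l + 1" for i j
    using that by (auto simp: cycle_rel_iff)
  have R0: "(0, l + 1) \<in> ?R" "(l + 1, 0) \<in> ?R" by (auto simp: cycle_rel_iff)
  have a: "a = l - 1 \<or> a = l" by (simp add: a_def)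
  have Wl: "z = c (l - 1) \<or> z = c l \<or> z = y \<or> z \<in> X" if "z \<in> W l" for z
    using that W_split[OF ln(2)] Cut by (auto simp: X_def)
  have hom: "h x = h z \<or> (h x, h z) \<in> ?R" if xz: "(x, z) \<in> E \<union> F" for x z
  proof (cases "(x, z) \<in> E")
    case True
    obtain i where i: "i \<in> {1..Suc n}" "x \<in> W i" "z \<in> W i" using edge[OF True] by auto
    consider "i < l" | "i = l" | "i > l" by linarith
    then show ?thesis
    proof cases
      case 1
      then have "W i = {cc (i - 1), cc i}" using i ln by (intro Wi) auto
      moreover have "h (cc (i - 1)) = i - 1" "h (cc i) = i" using 1 hcc by auto
      moreover have "(i - 1, i) \<in> ?R" "(i, i - 1) \<in> ?R" using i 1 R[of i "i - 1"] by auto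
      ultimately show ?thesis using i by auto
    next
      case 2
      have hv: "h z' = l - 1 \<or> h z' = l" if "z' \<in> W l" "z' \<noteq> y" for z'
        using Wl[OF that(1)] that(2) hX hl hcl a by auto
      have yz: "h z' = l" if "(y, z') \<in> E" "z' \<in> W l" for z'
      proof -
        have "z' \<notin> Cut l" using y(3)[of z'] symD[OF symE that(1)] by auto
        then show ?thesis using Wl[OF that(2)] Cut irr[of y] that hX by auto
      qed
      have "(l - 1, l) \<in> ?R" "(l, l - 1) \<in> ?R" "(l, l + 1) \<in> ?R" "(l + 1, l) \<in> ?R"
        using R[of l "l - 1"] R[of "l + 1" l] l2 by auto
      moreover have "(z, x) \<in> E" by (rule symD[OF symE True])
      ultimately show ?thesis using hv[of x] hv[of z] yz[of x] yz[of z] hy True i 2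
        by (cases "x = y"; cases "z = y") auto
    next
      case 3
      then have "x \<in> B l" "z \<in> B l" using i W_sub_B[of i l] by auto
      then show ?thesis using hB by simp
    qed
  next
    case False
    then have "(x, z) \<in> F" using xz by simp
    moreover have "h c0 = 0" using hcc[of 0] l2 by (simp add: cc_def)
    ultimately show ?thesis using hy R0 by (auto simp: F_def link_def)
  qed
  have h_lt: "h x < l + 2" if xV: "x \<in> V" for x
  proof -
    obtain i where i: "i \<in> {1..Suc n}" "x \<in> W i" using xV unfolding V_eq A_def by blast
    consider "i < l" | "i = l" | "i > l" by linarith
    then show ?thesis
    proof cases
      case 1
      then have "W i = {cc (i - 1), cc i}" using i ln by (intro Wi) auto
      then show ?thesis using i hcc[of i] hcc[of "i - 1"] 1 by auto
    next
      case 2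
      then show ?thesis using Wl[of x] i hX hl hcl hy a by auto
    next
      case 3
      then have "x \<in> B l" using i W_sub_B[of i l] by auto
      then show ?thesis using hB a by auto
    qed
  qed
  have "cds ?R {..<l + 2} (h ` D')"
  proof (rule cds_image[OF D'(1)])
    show "{..<l + 2} \<subseteq> h ` V"
    proof
      fix j assume "j \<in> {..<l + 2}"
      then consider "j < l" | "j = l" | "j = l + 1" by force
      then show "j \<in> h ` V"
      proof cases
        case 1
        then have "cc j \<in> V" using ccA[of j] AB[of "l - 1"] ln by auto
        then show ?thesis using hcc[OF 1] by force
      next
        case 2
        have "x0 \<in> V" using x0 W_sub_V[OF ln(2)] by auto
        then show ?thesis using hX[OF \<open>x0 \<in> X\<close>] 2 by force
      next
        case 3
        then show ?thesis using hy yV by force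
      qed
    qed
    show "h ` D' \<subseteq> {..<l + 2}" using h_lt DV by auto
  qed (use hom in auto)
  then have "l \<le> card (h ` D')" using card_cds_cycle[of "l + 2" "h ` D'"] by simp
  have "\<exists>x \<in> D' - B l. h x = a"
  proof (cases "c (l - 1) \<in> D'")
    case True
    moreover have "c (l - 1) \<notin> B l"
      using A_Int_B_skip[OF ln(2), of "c (l - 1)"] c_A[of "l - 1" "l - 1"] ln by auto
    ultimately show ?thesis using hcl by (intro bexI[of _ "c (l - 1)"]) (auto simp: a_def)
  next
    case False
    \<comment> \<open>Without a vertex of \<open>X\<close> in \<open>D'\<close>, nothing in
      \<open>D'\<close> leads from \<open>c l\<close> out of \<open>B l\<close>, since
      \<open>c (l - 1)\<close> is missing too; but dominating \<open>y\<close> requires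
      \<open>y\<close> or \<open>c0\<close> in \<open>D'\<close>.\<close>
    have "\<exists>x \<in> D'. x \<in> X"
    proof (rule ccontr)
      assume noX: "\<not> (\<exists>x \<in> D'. x \<in> X)"
      have "y \<in> D' \<or> (\<exists>u \<in> D'. (u, y) \<in> E \<union> F)" using D' yV by (auto simp: cds_def)
      moreover have "(u, y) \<notin> E" if "u \<in> D'" for u
      proof
        assume "(u, y) \<in> E"
        then have *: "(y, u) \<in> E" by (rule symD[OF symE])
        then have "u \<in> W l" using edge_C[of y u l] yC ln by auto
        then show False using Wl[of u] noX that y(3)[of u] \<open>(u, y) \<in> E\<close> Cut irr by auto
      qed
      ultimately have left: "y \<in> D' \<or> c0 \<in> D'" by (auto simp: F_def link_def)
      have cl: "c l \<in> D'" using cut_in_cds[OF D'(1) ln(1) keepsF[of l]] by simp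
      have "conn (E \<union> F) D'" using D' by (simp add: cds_def)
      then have "D' \<subseteq> B l"
      proof (rule connD[of _ _ "c l"])
        show "c l \<in> B l" using c_B[of l l] ln by auto
        fix u v assume uv: "u \<in> B l" "u \<in> D'" "v \<in> D'" "(u, v) \<in> E \<union> F"
        have "u \<noteq> y" "u \<noteq> c0"
          using uv(1) CB yC A_Int_B_skip[OF ln(2) c0A] by auto
        then have e: "(u, v) \<in> E" using uv by (auto simp: F_def link_def)
        show "v \<in> B l"
        proof (rule ccontr)
          assume nB: "v \<notin> B l"
          then have vA: "v \<in> A l" using uv DV AB[of l] ln by auto
          have "(v, u) \<in> E" by (rule symD[OF symE e])
          then have "v = c l \<or> u = c l" using sep[of v u l] vA uv ln by auto
          then have u: "u = c l" using nB c_B[of l l] ln by auto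
          obtain i where i: "i \<in> {1..Suc n}" "u \<in> W i" "v \<in> W i" using edge[OF e] by auto
          have "v \<in> W l"
          proof (cases "i = l")
            case il: False
            have "i \<le> l"
            proof (rule ccontr)
              assume "\<not> i \<le> l"
              then have "W i \<subseteq> B l" using i by (intro W_sub_B) auto
              then show False using nB i by auto
            qed
            then have "c l = c i" using W_Int_W[of i l "c l"] i il ln u cW by auto
            then show ?thesis using c_neq[of l i] i il ln \<open>i \<le> l\<close> by auto
          qed (use i in simp)
          then show False
            using Wl[of v] False noX uv(3) e u y(3)[of "c l"] Cut nB c_B[of l l] ln by auto
        qed
      qed (use cl in auto)
      then show False using left CB[OF yC] A_Int_B_skip[OF ln(2) c0A] by auto
    qed
    then obtain x where "x \<in> D'" "x \<in> X" by auto
    then show ?thesis using hX[of x] CB[of x] False by (intro bexI[of _ x]) (auto simp: a_def X_def)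
  qed
  then obtain x where x: "x \<in> D' - B l" "h x = a" by auto
  have "h ` D' \<subseteq> h ` (D' - B l)"
  proof
    fix j assume "j \<in> h ` D'"
    then obtain z where z: "z \<in> D'" "j = h z" by auto
    show "j \<in> h ` (D' - B l)" using z x hB[of z] by (cases "z \<in> B l") auto
  qed
  then have "card (h ` D') \<le> card (D' - B l)"
    using fD by (meson card_image_le card_mono finite_Diff finite_imageI le_trans)
  moreover have "card D' = card (D' \<inter> B l) + card (D' - B l)" by (rule card_Int_Diff[OF fD])
  ultimately show False using \<open>l \<le> card (h ` D')\<close> right D'(2) ln by simp
qed

end


section \<open>The exact shape of block \<open>l\<close> and of the last block\<close>

context critical_chain begin

text \<open>For \<open>l = 1\<close> the cut vertex \<open>c 1\<close> alone is connected, so it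
  misses some \<open>y\<close>, and every new edge in the block must join these two; this
  \<open>y\<close> is taken as \<open>c0\<close>, in the role of \<open>c (l - 1)\<close>. For
  larger \<open>l\<close> the two cut vertices are not adjacent, and only their own edge connects
  them.\<close>

lemma path_structure:
  obtains c0 Q where "c0 \<in> C 1" "l \<noteq> 1 \<Longrightarrow> C 1 = {c0}"
    "W l = Q \<union> {(c(0 := c0)) (l - 1), c l}" "(c(0 := c0)) (l - 1) \<notin> Q" "c l \<notin> Q"
    "((c(0 := c0)) (l - 1), c l) \<notin> E"
    "\<And>u v. u \<in> W l \<Longrightarrow> v \<in> W l \<Longrightarrow> u \<noteq> v \<Longrightarrow> (u, v) \<notin> E \<Longrightarrow> {u, v} = {(c(0 := c0)) (l - 1), c l}"
proof (cases "l = 1")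
  case True
  have Cut: "Cut l = {c l}" using Cut_first True by simp
  have l': "l \<in> {1..Suc n}" using l by auto
  have cl: "c l \<in> W l" using c_in l by auto
  have "\<exists>y \<in> W l. y \<notin> Cut l \<and> (c l, y) \<notin> E"
    using not_loc_l cl Cut by (auto simp: loc_def cds_def)
  then obtain y where y: "y \<in> W l" "y \<noteq> c l" "(c l, y) \<notin> E" using Cut by auto
  have yC: "y \<in> C 1" using y W_split[OF l'] Cut True by auto
  have nonadj: "{u, v} = {y, c l}" if uv: "u \<in> W l" "v \<in> W l" "u \<noteq> v" "(u, v) \<notin> E" for u v
  proof -
    have "loc (link u v) l (Cut l)" by (rule crit_l[OF uv])
    then have "(c l, y) \<in> E \<union> link u v"
      using y Cut by (auto simp: loc_def cds_def)
    then have "(c l, y) \<in> link u v" using y(3) by auto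
    then show ?thesis by (auto simp: link_def)
  qed
  show thesis
  proof (rule that[of y "W l - {y, c l}"])
    show "W l = W l - {y, c l} \<union> {(c(0 := y)) (l - 1), c l}" using y cl True by auto
    show "((c(0 := y)) (l - 1), c l) \<notin> E" using y True symD[OF symE] by auto
  qed (use yC True nonadj in auto)
next
  case False
  then have l2: "2 \<le> l" "l \<le> n" using l by auto
  have l': "l \<in> {1..Suc n}" "l - 1 \<in> {1..n}" using l2 by auto
  obtain c0 where C1: "C 1 = {c0}" using interior_first False by auto
  have Cut: "Cut l = {c (l - 1), c l}" using Cut_mid l2 by auto
  have ne: "c (l - 1) \<noteq> c l" using c_neq[OF l'(2) l] l2 by auto
  have nE: "(c (l - 1), c l) \<notin> E" using not_adjacent_l l2 by auto
  have cc: "(c(0 := c0)) (l - 1) = c (l - 1)" using l2 by auto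
  show thesis
  proof (rule that[of c0 "C l", unfolded cc])
    show "W l = C l \<union> {c (l - 1), c l}" using W_split[OF l'(1)] Cut by simp
    show "c (l - 1) \<notin> C l" "c l \<notin> C l" using c_notin_C l'(2) l by auto
    fix u v assume uv: "u \<in> W l" "v \<in> W l" "u \<noteq> v" "(u, v) \<notin> E"
    have "loc (link u v) l (Cut l)" by (rule crit_l[OF uv])
    then have "conn (E \<union> link u v) {c (l - 1), c l}" using Cut by (simp add: loc_def cds_def)
    then have "(c (l - 1), c l) \<in> link u v" using conn_pairD[OF _ ne] nE by blast
    then show "{u, v} = {c (l - 1), c l}" by (auto simp: link_def)
  qed (use C1 nE in auto)
qed

text \<open>\<open>S\<close> will be the set of leaves in \<open>B22\<close>, and \<open>R\<close>
  the star centres together with the isolated vertices.\<close>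

definition S where "S = {s \<in> C (Suc n). (c n, s) \<in> E}"
definition R where "R = {s \<in> C (Suc n). (c n, s) \<notin> E}"

lemma W_last: "W (Suc n) = insert (c n) (S \<union> R)"
  using W_split[of "Suc n"] Cut_last by (auto simp: S_def R_def)

lemma cn: "c n \<notin> S" "c n \<notin> R" "c n \<in> V" "S \<inter> R = {}"
  using c_notin_C[of n] c_V[of n] n1 by (auto simp: S_def R_def)

text \<open>The share of the last block drops to at most one; \<open>z = c n\<close> covers the case
  of no interior vertex.\<close>

lemma crit_last:
  assumes uv: "u \<in> W (Suc n)" "v \<in> W (Suc n)" "u \<noteq> v" "(u, v) \<notin> E"
  shows "\<exists>z \<in> W (Suc n). cds (E \<union> link u v) (W (Suc n)) {c n, z}"
proof -
  obtain X where X: "loc (link u v) (Suc n) X" "card (X \<inter> C (Suc n)) < 2"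
    using crit_local[of "Suc n", OF _ uv] card_last by auto
  have XW: "X \<subseteq> W (Suc n)" "c n \<in> X" using X Cut_last by (auto simp: loc_def cds_def)
  have "finite X" using XW W_sub_V[of "Suc n"] by (intro finite_subset[OF _ fin]) simp
  moreover have Xeq: "X = insert (c n) (X \<inter> C (Suc n))" 
    using XW W_split[of "Suc n"] Cut_last by auto
  ultimately consider "X \<inter> C (Suc n) = {}" | z where "X \<inter> C (Suc n) = {z}"
    using X(2) by (metis One_nat_def card_0_eq card_1_singletonE finite_Int less_2_cases)
  then obtain z where "X = {c n, z}" "z \<in> W (Suc n)"
  proof cases
    case 1
    then show ?thesis using that[of "c n"] XW Xeq by auto
  next
    case 2
    then show ?thesis using that[of z] XW Xeq by auto
  qed
  then show ?thesis using X(1) by (auto simp: loc_def)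
qed

lemma min_last:
  assumes "z \<in> W (Suc n)" shows "\<not> cds E (W (Suc n)) {c n, z}"
proof
  assume "cds E (W (Suc n)) {c n, z}"
  then have "loc {} (Suc n) {c n, z}" using Cut_last by (simp add: loc_def)
  then have "2 \<le> card ({c n, z} \<inter> C (Suc n))" using min_local[of "Suc n"] card_last by simp
  moreover have "{c n, z} \<inter> C (Suc n) \<subseteq> {z}" using c_notin_C[of n] n1 by auto
  then have "card ({c n, z} \<inter> C (Suc n)) \<le> card {z}" by (intro card_mono) auto
  ultimately show False by simp
qed

text \<open>
  In a block pair \<open>{c n, z}\<close> that becomes dominating through the new edge \<open>uv\<close>, the vertex \<open>z\<close> is
  an end of \<open>uv\<close> and the other end is the vertex that becomes dominated.
\<close>

lemma crit_last_cases:
  assumes uv: "u \<in> W (Suc n)" "v \<in> W (Suc n)" "u \<noteq> v" "(u, v) \<notin> E" and ne: "u \<noteq> c n" "v \<noteq> c n"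
  shows "\<exists>z y. z \<in> S \<and> y \<in> R \<and> link u v = link z y \<and>
    (\<forall>w \<in> R. w \<noteq> y \<longrightarrow> (z, w) \<in> E)"
proof -
  obtain z where z: "z \<in> W (Suc n)" and cz: "cds (E \<union> link u v) (W (Suc n)) {c n, z}"
    using crit_last[OF uv] by auto
  have conn: "conn E {c n, z}"
  proof (cases "z = c n")
    case False
    then have "(c n, z) \<in> E \<union> link u v" using cz by (intro conn_pairD) (auto simp: cds_def)
    then have "(c n, z) \<in> E" using ne by (auto simp: link_def)
    then show ?thesis using symE by (rule conn_pair)
  qed simp
  have "\<exists>y \<in> W (Suc n). y \<notin> {c n, z} \<and> (c n, y) \<notin> E \<and> (z, y) \<notin> E"
    using min_last[OF z] conn z W_last by (auto simp: cds_def)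
  then obtain y where y: "y \<in> W (Suc n)" "y \<noteq> c n" "y \<noteq> z" "(c n, y) \<notin> E" "(z, y) \<notin> E" by auto
  have "\<exists>x \<in> {c n, z}. (x, y) \<in> E \<union> link u v" using cz y by (auto simp: cds_def)
  then have "(z, y) \<in> link u v" using y ne by (auto simp: link_def)
  then have l: "link u v = link z y" and zn: "z \<noteq> c n" using ne by (auto simp: link_def)
  have "(c n, z) \<in> E" using conn zn by (intro conn_pairD) auto
  then have "z \<in> S" using z zn W_split[of "Suc n"] Cut_last by (auto simp: S_def)
  moreover have "y \<in> R" using y W_split[of "Suc n"] Cut_last by (auto simp: R_def)
  moreover have "(z, w) \<in> E" if w: "w \<in> R" "w \<noteq> y" for w
  proof -
    have wW: "w \<in> W (Suc n)" "w \<noteq> c n" "(c n, w) \<notin> E" using w W_last cn by (auto simp: R_def)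
    have "w \<noteq> z" using w \<open>z \<in> S\<close> cn by auto
    then have "\<exists>x \<in> {c n, z}. (x, w) \<in> E \<union> link z y" using cz wW l by (auto simp: cds_def)
    then show ?thesis using wW w y zn \<open>w \<noteq> z\<close> by (auto simp: link_def)
  qed
  ultimately show ?thesis using l by blast
qed

text \<open>A missing edge that avoids the head always has one end in \<open>S\<close> and the other
  in \<open>R\<close>.\<close>

lemma S_complete: "u \<in> S \<Longrightarrow> v \<in> S \<Longrightarrow> u \<noteq> v \<Longrightarrow> (u, v) \<in> E"
  using crit_last_cases[of u v] W_last cn by (fastforce simp: link_def doubleton_eq_iff)

lemma R_complete: "u \<in> R \<Longrightarrow> v \<in> R \<Longrightarrow> u \<noteq> v \<Longrightarrow> (u, v) \<in> E"
  using crit_last_cases[of u v] W_last cn by (fastforce simp: link_def doubleton_eq_iff)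

text \<open>One exists because \<open>{c n, s}\<close> is connected but does not dominate. For a
  missing edge \<open>sa\<close>, the dominating pair must use \<open>s\<close>, which is then
  adjacent to the rest of \<open>R\<close>. In the complement on \<open>S \<union> R\<close> every
  vertex of \<open>S\<close> thus has degree one, which is where the stars come from.\<close>

lemma ex1_non_neighbour:
  assumes s: "s \<in> S"
  shows "\<exists>!a. a \<in> R \<and> (s, a) \<notin> E"
proof -
  have sW: "s \<in> W (Suc n)" "s \<noteq> c n" "(c n, s) \<in> E" using s W_last cn by (auto simp: S_def)
  have "conn E {c n, s}" using sW symE by (intro conn_pair)
  then have "\<exists>a \<in> W (Suc n). a \<notin> {c n, s} \<and> (c n, a) \<notin> E \<and> (s, a) \<notin> E"
    using min_last[OF sW(1)] sW W_last by (auto simp: cds_def)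
  then obtain a where a: "a \<in> R" "(s, a) \<notin> E" using W_last S_def by auto
  have aW: "a \<in> W (Suc n)" "a \<noteq> c n" "s \<noteq> a" using a s W_last cn by auto
  obtain z y where zy: "z \<in> S" "y \<in> R" "link s a = link z y" "\<forall>w \<in> R. w \<noteq> y \<longrightarrow> (z, w) \<in> E"
    using crit_last_cases[OF sW(1) aW(1) aW(3) a(2) sW(2) aW(2)] by blast
  have "z = s" "y = a" using zy(1-3) s a cn(4) by (auto simp: link_def doubleton_eq_iff)
  then show ?thesis using zy(4) a by (intro ex1I[of _ a]) auto
qed

lemma S_nonempty: "S \<noteq> {}"
proof -
  obtain u where "u \<in> W (Suc n)" "(c n, u) \<in> E"
    using ex_neighbour[of "Suc n" "c n"] c_in(2)[of n] n1 by auto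
  then have "u \<in> S" using W_last irr[of "c n"] by (auto simp: R_def)
  then show ?thesis by auto
qed

text \<open>
  If all vertices of \<open>S\<close> missed the same vertex \<open>a\<close>, the graph would be a path whose vertices
  are blown up to complete graphs; joining its ends \<open>c0\<close> and \<open>a\<close> then gives a blown-up cycle.
\<close>

lemma non_neighbours_differ:
  assumes a: "a \<in> R" "\<And>s. s \<in> S \<Longrightarrow> (s, a) \<notin> E"
  shows False
proof -
  obtain c0 Q where c0: "c0 \<in> C 1" "l \<noteq> 1 \<Longrightarrow> C 1 = {c0}"
    and Wl: "W l = Q \<union> {(c(0 := c0)) (l - 1), c l}" "(c(0 := c0)) (l - 1) \<notin> Q" "c l \<notin> Q"
      "((c(0 := c0)) (l - 1), c l) \<notin> E"
    using path_structure by metis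
  define cc where "cc = c(0 := c0)"
  have ln: "1 \<le> l" "l \<le> n" "l \<in> {1..Suc n}" using l by auto
  have ccl: "cc l = c l" "cc n = c n" using ln n1 by (auto simp: cc_def)
  have Wl': "W l = Q \<union> {cc (l - 1), cc l}" "(cc (l - 1), cc l) \<notin> E" "cc (l - 1) \<notin> Q" "cc l \<notin> Q"
    using Wl ccl by (simp_all add: cc_def)
  have Wi: "W i = {cc (i - 1), cc i}" if "i \<in> {1..n}" "i \<noteq> l" for i
    using path_block[OF c0 that] by (simp add: cc_def)
  have inj_cc: "inj_on cc {0..n}" unfolding cc_def by (rule c0_inj[OF c0(1)])
  have ccV: "cc j \<in> V" if "j \<le> n" for j
    using c_V[of j] c0(1) C_sub_W W_sub_V[of 1] that by (cases "j = 0") (auto simp: cc_def)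
  have cc_last: "cc j \<notin> C (Suc n)" if "j \<le> n" for j
    using c_notin_C[of j "Suc n"] C_Int_W[of 1 "Suc n"] C_sub_W c0(1) n1 that
    by (cases "j = 0") (auto simp: cc_def)
  have ccQ: "cc j \<notin> Q" if "j \<le> n" for j
  proof
    assume jQ: "cc j \<in> Q"
    then have jW: "cc j \<in> W l" using Wl' by auto
    show False
    proof (cases "j = 0")
      case True
      then have "cc j \<in> C 1" using c0 by (simp add: cc_def)
      then have "l = 1" using C_Int_W[of 1 l] jW ln by force
      then show False using True Wl' jQ by auto
    next
      case False
      then have "cc j \<in> W l \<inter> c ` {1..n}" using jW that by (auto simp: cc_def)
      then have "cc j \<in> Cut l" unfolding W_Int_cuts[OF ln(3)] .
      then have "cc j = c l \<or> cc j = c (l - 1) \<and> l - 1 \<in> {1..n}" by (auto simp: Cut_def)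
      then have "cc j = cc l \<or> cc j = cc (l - 1)" using ccl by (auto simp: cc_def)
      then show False using jQ Wl' by auto
    qed
  qed
  have QC: "x \<notin> C (Suc n)" if "x \<in> Q" for x
    using C_Int_W[of "Suc n" l] ln Wl' that by auto
  have aC: "a \<in> C (Suc n)" "a \<notin> S" using a by (auto simp: R_def S_def)
  have aW: "a \<in> W (Suc n)" using aC C_sub_W by auto
  \<comment> \<open>\<open>a\<close> is adjacent neither to the head nor to \<open>S\<close>, so its
    neighbour lies in \<open>R\<close>; this makes the class between \<open>S\<close> and
    \<open>a\<close> nonempty.\<close>
  obtain r where r: "r \<in> W (Suc n)" "(a, r) \<in> E" using ex_neighbour[OF _ aW] by auto
  have ra: "(r, a) \<in> E" by (rule symD[OF symE r(2)])
  have rR: "r \<in> R" "r \<noteq> a" using ra r W_last a irr by (auto simp: R_def)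
  obtain s where s: "s \<in> S" using S_nonempty by auto
  have c0W: "c0 \<in> W 1" "c0 \<in> V" using c0 C_sub_W ccV[of 0] by (auto simp: cc_def)
  have aV: "a \<in> V" using aW W_sub_V[of "Suc n"] by auto
  have ne: "c0 \<noteq> a" using cc_last[of 0] aC by (auto simp: cc_def)
  have nE: "(c0, a) \<notin> E"
  proof
    assume "(c0, a) \<in> E"
    then have "a \<in> W 1" using edge_C[of c0 a 1] c0 by auto
    then show False using C_Int_W[of "Suc n" 1] aC n1 by auto
  qed
  obtain D' where D': "cds (E \<union> link c0 a) V D'" "card D' < n + 3"
    using crit[OF c0W(2) aV ne nE] card_D by auto
  have DV: "D' \<subseteq> V" using D' by (simp add: cds_def)
  have fD: "finite D'" by (rule finite_subset[OF DV fin])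
  define idx where "idx = inv_into {0..n} cc"
  \<comment> \<open>The classes along the cycle: \<open>cc 0\<close> to \<open>cc (l - 1)\<close> at
    \<open>0\<close> to \<open>l - 1\<close>, \<open>Q\<close> at \<open>l\<close>,
    \<open>cc l\<close> to \<open>cc n\<close> at \<open>l + 1\<close> to \<open>n + 1\<close>,
    followed by \<open>S\<close>, \<open>R - {a}\<close> and \<open>a\<close>. These are
    \<open>n + 5\<close> classes, of which at least \<open>n + 3\<close> must be met.\<close>
  define h where "h x = (if x \<in> S then n + 2 else if x = a then n + 4 else if x \<in> C (Suc n) then n + 3
    else if x \<in> Q then l else if idx x < l then idx x else idx x + 1)" for x
  have hS: "h x = n + 2" if "x \<in> S" for x using that by (simp add: h_def)
  have ha: "h a = n + 4" using aC by (simp add: h_def)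
  have hR: "h x = n + 3" if "x \<in> R" "x \<noteq> a" for x
    using that cn(4) by (auto simp: h_def R_def S_def)
  have hQ: "h x = l" if "x \<in> Q" for x
    using that QC[OF that] aC by (auto simp: h_def S_def)
  have hcc: "h (cc j) = (if j < l then j else j + 1)" if "j \<le> n" for j
  proof -
    have "idx (cc j) = j" unfolding idx_def using inj_cc that by (intro inv_into_f_f) auto
    then show ?thesis using cc_last[OF that] ccQ[OF that] aC by (auto simp: h_def S_def)
  qed
  let ?R = "cycle_rel (n + 5)"
  have Rel: "(i, Suc i) \<in> ?R" "(Suc i, i) \<in> ?R" if "i < n + 4" for i
    using that by (auto simp: cycle_rel_iff)
  have hom: "h x = h z \<or> (h x, h z) \<in> ?R" if xz: "(x, z) \<in> E \<union> link c0 a" for x z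
  proof (cases "(x, z) \<in> E")
    case True
    obtain i where i: "i \<in> {1..Suc n}" "x \<in> W i" "z \<in> W i" using edge[OF True] by auto
    consider "i \<le> n" "i \<noteq> l" | "i = l" | "i = Suc n" using i by force
    then show ?thesis
    proof cases
      case 1
      have "W i = {cc (i - 1), cc i}" using 1 i by (intro Wi) auto
      moreover have "h (cc i) = Suc (h (cc (i - 1)))" "h (cc (i - 1)) < n + 4"
        using hcc[of i] hcc[of "i - 1"] 1 i by auto
      ultimately show ?thesis using i Rel[of "h (cc (i - 1))"] by auto
    next
      case 2
      have hv: "h (cc (l - 1)) = l - 1" "h (cc l) = Suc l" using hcc[of "l - 1"] hcc[of l] ln by auto
      have Rl: "(l - 1, l) \<in> ?R" "(l, l - 1) \<in> ?R" "(l, Suc l) \<in> ?R" "(Suc l, l) \<in> ?R"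
        using Rel[of "l - 1"] Rel[of l] ln by auto
      have "(cc l, cc (l - 1)) \<notin> E" using Wl'(2) symD[OF symE] by blast
      then show ?thesis using i 2 Wl'(1,2) True hv Rl hQ by auto
    next
      case 3
      have hn: "h (c n) = n + 1" using hcc[of n] ccl ln by simp
      have Rn: "(n + 1, n + 2) \<in> ?R" "(n + 2, n + 1) \<in> ?R" "(n + 2, n + 3) \<in> ?R" "(n + 3, n + 2) \<in> ?R"
        "(n + 3, n + 4) \<in> ?R" "(n + 4, n + 3) \<in> ?R"
        using Rel[of "n + 1"] Rel[of "n + 2"] Rel[of "n + 3"] by (auto simp: numeral_eq_Suc)
      have cases: "y = c n \<or> y \<in> S \<or> y \<in> R \<and> y \<noteq> a \<or> y = a" if "y \<in> W (Suc n)" for y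
        using that W_last by auto
      have cR: "(c n, y) \<notin> E" "(y, c n) \<notin> E" if "y \<in> R" for y
        using that symD[OF symE, of y "c n"] by (auto simp: R_def)
      have aS: "(y, a) \<notin> E" "(a, y) \<notin> E" if "y \<in> S" for y
        using a(2)[OF that] symD[OF symE, of a y] by auto
      have "x \<in> W (Suc n)" "z \<in> W (Suc n)" using i 3 by auto
      from cases[OF this(1)] cases[OF this(2)] show ?thesis
      proof (elim disjE conjE)
      qed (use True hn hS ha hR Rn cR aS a(1) in auto)
    qed
  next
    case False
    then have "(x, z) \<in> link c0 a" using xz by simp
    moreover have "h c0 = 0" using hcc[of 0] ln by (simp add: cc_def)
    moreover have "(0, n + 4) \<in> ?R" "(n + 4, 0) \<in> ?R" by (auto simp: cycle_rel_iff)
    ultimately show ?thesis using ha by (auto simp: link_def)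
  qed
  have h_lt: "h x < n + 5" if xV: "x \<in> V" for x
  proof -
    obtain i where i: "i \<in> {1..Suc n}" "x \<in> W i" using xV unfolding V_eq A_def by blast
    consider "i \<le> n" "i \<noteq> l" | "i = l" | "i = Suc n" using i by force
    then show ?thesis
    proof cases
      case 1
      have "W i = {cc (i - 1), cc i}" using 1 i by (intro Wi) auto
      then show ?thesis using i hcc[of i] hcc[of "i - 1"] 1 by auto
    next
      case 2
      then show ?thesis using Wl' i hQ[of x] hcc[of l] hcc[of "l - 1"] ln by auto
    next
      case 3
      then show ?thesis using W_last i hS[of x] hR[of x] ha hcc[of n] ccl ln by (cases "x = a") auto
    qed
  qed
  have "cds ?R {..<n + 5} (h ` D')"
  proof (rule cds_image[OF D'(1)])
    show "{..<n + 5} \<subseteq> h ` V"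
    proof
      fix j assume "j \<in> {..<n + 5}"
      then consider "j < l" | "j = l" | "l < j" "j \<le> n + 1" | "j = n + 2" | "j = n + 3" | "j = n + 4"
        by force
      then show "j \<in> h ` V"
      proof cases
        case 1
        then show ?thesis using hcc[of j] ccV[of j] ln by (intro image_eqI[of _ _ "cc j"]) auto
      next
        case 2
        obtain u where u: "u \<in> W l" "(c l, u) \<in> E" using ex_neighbour[OF ln(3)] c_in[OF l] by auto
        then have "u \<in> Q" using Wl' ccl irr symD[OF symE u(2)] by auto
        then show ?thesis using hQ 2 u W_sub_V[OF ln(3)] by (intro image_eqI[of _ _ u]) auto
      next
        case 3
        then show ?thesis using hcc[of "j - 1"] ccV[of "j - 1"] by (intro image_eqI[of _ _ "cc (j - 1)"]) auto
      next
        case 4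
        have "s \<in> V" using s W_last W_sub_V[of "Suc n"] by auto
        then show ?thesis using hS[OF s] 4 by (intro image_eqI[of _ _ s]) auto
      next
        case 5
        have "r \<in> V" using r W_sub_V[of "Suc n"] by auto
        then show ?thesis using hR[OF rR] 5 by (intro image_eqI[of _ _ r]) auto
      next
        case 6
        then show ?thesis using ha aV by (intro image_eqI[of _ _ a]) auto
      qed
    qed
    show "h ` D' \<subseteq> {..<n + 5}" using h_lt DV by auto
  qed (use hom in auto)
  then have "n + 3 \<le> card (h ` D')" using card_cds_cycle[of "n + 5" "h ` D'"] by simp
  then show False using card_image_le[OF fD, of h] D'(2) by simp
qed

end


section \<open>Every graph in H is in G1\<close>

lemma add_edge_simps [simp]:
  "pverts (add_edge G u v) = pverts G" "parcs (add_edge G u v) = parcs G \<union> link u v"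
  by (simp_all add: add_edge_def link_def)

lemma finite_connected_dominating_sets:
  "finite (pverts G) \<Longrightarrow> finite {D. connected_dominating_set G D}"
  by (rule finite_subset[of _ "Pow (pverts G)"]) (auto simp: connected_dominating_set_def)

lemma gamma_c_le:
  assumes "finite (pverts G)" "connected_dominating_set G D"
  shows "gamma_c G \<le> card D"
  unfolding gamma_c_def using assms finite_connected_dominating_sets[OF assms(1)]
  by (intro Min_le) auto

text \<open>\<open>Min\<close> of an empty set would say nothing, so some connected dominating set
  has to be supplied.\<close>

lemma gamma_c_witness:
  assumes "finite (pverts G)" "connected_dominating_set G D"
  obtains D' where "connected_dominating_set G D'" "card D' = gamma_c G"
proof -
  have "gamma_c G \<in> card ` {D. connected_dominating_set G D}"
    unfolding gamma_c_def using assms finite_connected_dominating_sets[OF assms(1)]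
    by (intro Min_in) auto
  then show thesis using that by auto
qed

text \<open>The labeling only places each \<open>c m\<close> in two blocks. Without
  \<open>c m\<close> each side stays connected through the other \<open>c j\<close>; a second common
  vertex, or a side consisting of \<open>c m\<close> alone, would keep the rest connected and
  \<open>c m\<close> would be no cut vertex.\<close>

lemma chain_separation:
  fixes n :: nat
  assumes symE: "sym E" and V: "V = (\<Union>j \<in> {1..Suc n}. W j)"
    and ns: "\<And>j. j \<in> {1..Suc n} \<Longrightarrow> nonsep E (W j)"
    and c_in: "\<And>i. i \<in> {1..n} \<Longrightarrow> c i \<in> W i \<inter> W (Suc i)" and inj: "inj_on c {1..n}"
    and m: "m \<in> {1..n}" and cut: "V - {c m} \<noteq> {}" "\<not> conn E (V - {c m})"
  shows "chain.A W m \<inter> chain.B n W m = {c m}" "chain.A W m \<noteq> {c m}" "chain.B n W m \<noteq> {c m}"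
proof -
  define A where "A = (\<Union>j \<in> {1..m}. W j)"
  define B where "B = (\<Union>j \<in> {Suc m..Suc n}. W j)"
  have conn: "conn E (W j - {x})" if "j \<in> {1..Suc n}" "W j - {x} \<noteq> {}" for j x
    using ns[OF that(1)] that(2) by (cases "x \<in> W j") (auto simp: nonsep_def)
  have c_neq: "c j \<noteq> c m" if "j \<in> {1..n}" "j \<noteq> m" for j
    using inj_onD[OF inj _ that(1) m] that(2) by blast
  have "{1..m} \<union> {Suc m..Suc n} = {1..Suc n}" using m by auto
  then have AB: "A \<union> B = V" unfolding A_def B_def V by (metis UN_Un)
  have A': "A - {c m} = (\<Union>j \<in> {1..m}. W j - {c m})" by (auto simp: A_def)
  have B': "B - {c m} = (\<Union>j \<in> {Suc m..Suc n}. W j - {c m})" by (auto simp: B_def)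
  have A: "conn E (A - {c m})" if ne: "A - {c m} \<noteq> {}"
    unfolding A'
  proof (rule conn_chain)
    fix j assume "j \<in> {1..<m}"
    then show "\<exists>x \<in> W j - {c m}. \<exists>y \<in> W (Suc j) - {c m}. x = y \<or> (x, y) \<in> E"
      using c_in[of j] c_neq[of j] m by (intro bexI[of _ "c j"]) auto
  next
    show "(\<Union>j \<in> {1..m}. W j - {c m}) \<noteq> {}" using ne unfolding A' .
  qed (use m conn symE in auto)
  have B: "conn E (B - {c m})" if ne: "B - {c m} \<noteq> {}"
    unfolding B'
  proof (rule conn_chain)
    fix j assume "j \<in> {Suc m..<Suc n}"
    then show "\<exists>x \<in> W j - {c m}. \<exists>y \<in> W (Suc j) - {c m}. x = y \<or> (x, y) \<in> E"
      using c_in[of j] c_neq[of j] m by (intro bexI[of _ "c j"]) auto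
  next
    show "(\<Union>j \<in> {Suc m..Suc n}. W j - {c m}) \<noteq> {}" using ne unfolding B' .
  qed (use m conn symE in auto)
  have cV: "V - {c m} = (A - {c m}) \<union> (B - {c m})" using AB by auto
  have cm: "c m \<in> A" "c m \<in> B" using c_in[OF m] m by (auto simp: A_def B_def)
  have ne: "A - {c m} \<noteq> {}" "B - {c m} \<noteq> {}"
    using A B cut unfolding cV by (metis Un_empty_left Un_empty_right)+
  have "False" if "x \<in> A" "x \<in> B" "x \<noteq> c m" for x
    using conn_Un[OF A[OF ne(1)] B[OF ne(2)], of x x] that symE cut cV by auto
  then have "A \<inter> B = {c m}" using cm by auto
  moreover have "A \<noteq> {c m}" "B \<noteq> {c m}" using ne by auto
  ultimately show "chain.A W m \<inter> chain.B n W m = {c m}" "chain.A W m \<noteq> {c m}" "chain.B n W m \<noteq> {c m}"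
    unfolding chain.A_def chain.B_def A_def B_def by simp_all
qed

text \<open>The centres are the values of \<open>f\<close>, the leaves at a centre form its fibre,
  and the rest of \<open>R\<close> is isolated. Two different values of \<open>f\<close> give the
  two stars that \<open>B22\<close> asks for.\<close>

lemma B22I:
  assumes fin: "finite S" "finite R" and disj: "S \<inter> R = {}" "c \<notin> S" "c \<notin> R"
    and E: "sym E" "\<And>x. (x, x) \<notin> E"
    and S: "\<And>u v. u \<in> S \<Longrightarrow> v \<in> S \<Longrightarrow> u \<noteq> v \<Longrightarrow> (u, v) \<in> E"
    and R: "\<And>u v. u \<in> R \<Longrightarrow> v \<in> R \<Longrightarrow> u \<noteq> v \<Longrightarrow> (u, v) \<in> E"
    and f: "\<And>s. s \<in> S \<Longrightarrow> f s \<in> R"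
    and fE: "\<And>s a. s \<in> S \<Longrightarrow> a \<in> R \<Longrightarrow> (s, a) \<in> E \<longleftrightarrow> a \<noteq> f s"
    and c: "\<And>s. s \<in> S \<Longrightarrow> (c, s) \<in> E" "\<And>a. a \<in> R \<Longrightarrow> (c, a) \<notin> E"
    and two: "s1 \<in> S" "s2 \<in> S" "f s1 \<noteq> f s2"
  shows "B22 \<lparr>pverts = insert c (S \<union> R), parcs = E \<inter> insert c (S \<union> R) \<times> insert c (S \<union> R)\<rparr> c"
proof -
  define P where "P = f ` S"
  define l where "l = card P"
  have finP: "finite P" using fin by (simp add: P_def)
  obtain x where x: "bij_betw x {1..l} P"
    using ex_bij_betw_nat_finite_1[OF finP] by (auto simp: l_def)
  then have xP: "x ` {1..l} = P" and xinj: "inj_on x {1..l}" by (auto simp: bij_betw_def)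
  define L where "L i = {s \<in> S. f s = x i}" for i
  define m where "m i = card (L i)" for i
  define U where "U = (\<Union>i \<in> {1..l}. {x i} \<times> L i \<union> L i \<times> {x i})"
  define T where "T = \<lparr>pverts = S \<union> R, parcs = U\<rparr>"
  have PR: "P \<subseteq> R" using f by (auto simp: P_def)
  have ex_i: "\<exists>i \<in> {1..l}. x i = f s" if "s \<in> S" for s
  proof -
    have "f s \<in> x ` {1..l}" unfolding xP using that by (simp add: P_def)
    then show ?thesis by force
  qed
  have UL: "(\<Union>i \<in> {1..l}. L i) = S" using ex_i by (force simp: L_def)
  have xR: "x i \<in> R" if "i \<in> {1..l}" for i using PR xP that by blast
  have Ux: "(\<Union>i \<in> {1..l}. insert (x i) (L i)) = P \<union> S"
    unfolding xP[symmetric] UL[symmetric] by auto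
  \<comment> \<open>The arcs of \<open>T\<close> are the graph of \<open>f\<close> in both
    directions, which makes the complement easy to compare with \<open>E\<close>.\<close>
  have U: "(u, v) \<in> U \<longleftrightarrow> u \<in> S \<and> v = f u \<or> v \<in> S \<and> u = f v" for u v
    using ex_i by (auto simp: U_def L_def) metis+
  have "card {f s1, f s2} \<le> card P" using two finP by (intro card_mono) (auto simp: P_def)
  then have l2: "2 \<le> l" using two by (simp add: l_def)
  have m1: "1 \<le> m i" if "i \<in> {1..l}" for i
  proof -
    have "x i \<in> f ` S" using that xP P_def by blast
    then have "L i \<noteq> {}" by (auto simp: L_def)
    moreover have "finite (L i)" using fin by (simp add: L_def)
    ultimately show ?thesis by (simp add: m_def Suc_le_eq card_gt_0_iff)
  qed
  have "stars_and_isolated l m (card (R - P)) T S"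
    unfolding stars_and_isolated_def
  proof (intro exI conjI)
    show "\<forall>i \<in> {1..l}. finite (L i) \<and> card (L i) = m i \<and> x i \<notin> L i"
      using fin xR disj(1) by (auto simp: m_def L_def)
    show "disjoint_family_on (\<lambda>i. insert (x i) (L i)) {1..l}"
      unfolding disjoint_family_on_def
    proof (intro ballI impI)
      fix i j assume ij: "i \<in> {1..l}" "j \<in> {1..l}" "i \<noteq> j"
      have "x i \<noteq> x j" using inj_onD[OF xinj _ ij(1,2)] ij(3) by blast
      then show "insert (x i) (L i) \<inter> insert (x j) (L j) = {}"
        using xR[OF ij(1)] xR[OF ij(2)] disj(1) by (auto simp: L_def)
    qed
    show "finite (R - P)" "card (R - P) = card (R - P)" using fin by auto
    show "(\<Union>i \<in> {1..l}. insert (x i) (L i)) \<inter> (R - P) = {}" unfolding Ux using disj(1) by auto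
    show "pverts T = (\<Union>i \<in> {1..l}. insert (x i) (L i)) \<union> (R - P)"
      unfolding Ux using PR by (auto simp: T_def)
    show "parcs T = (\<Union>i \<in> {1..l}. {x i} \<times> L i \<union> L i \<times> {x i})" by (simp add: T_def U_def)
    show "S = (\<Union>i \<in> {1..l}. L i)" by (rule UL[symmetric])
  qed
  moreover have "\<lparr>pverts = insert c (S \<union> R), parcs = E \<inter> insert c (S \<union> R) \<times> insert c (S \<union> R)\<rparr>
      = add_vertex (complement T) c S"
  proof -
    have sy: "(u, v) \<in> E \<longleftrightarrow> (v, u) \<in> E" for u v using E(1) by (auto dest: symD)
    have TE: "(u, v) \<in> E \<longleftrightarrow> u \<noteq> v \<and> (u, v) \<notin> U" if "u \<in> S \<union> R" "v \<in> S \<union> R" for u v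
      using that
    proof (elim UnE)
      assume uv: "u \<in> S" "v \<in> S"
      then have "(u, v) \<notin> U" using f disj(1) unfolding U by auto
      then show ?thesis using S[OF uv] E(2) by auto
    next
      assume uv: "u \<in> R" "v \<in> R"
      then have "(u, v) \<notin> U" using disj(1) unfolding U by auto
      then show ?thesis using R[OF uv] E(2) by auto
    next
      assume uv: "u \<in> S" "v \<in> R"
      then have "u \<noteq> v" "(u, v) \<in> U \<longleftrightarrow> v = f u" using disj(1) unfolding U by auto
      then show ?thesis using fE[OF uv] by auto
    next
      assume uv: "u \<in> R" "v \<in> S"
      then have "u \<noteq> v" "(u, v) \<in> U \<longleftrightarrow> u = f v" using disj(1) unfolding U by auto
      then show ?thesis using fE[OF uv(2,1)] sy[of u v] by auto
    qed
    have "E \<inter> insert c (S \<union> R) \<times> insert c (S \<union> R)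
        = {(u, v) \<in> (S \<union> R) \<times> (S \<union> R). u \<noteq> v \<and> (u, v) \<notin> U} \<union> {c} \<times> S \<union> S \<times> {c}"
    proof (intro equalityI subrelI)
      fix u v assume uv: "(u, v) \<in> E \<inter> insert c (S \<union> R) \<times> insert c (S \<union> R)"
      consider "u = c" | "v = c" "u \<noteq> c" | "u \<in> S \<union> R" "v \<in> S \<union> R" using uv by auto
      then show "(u, v) \<in> {(u, v) \<in> (S \<union> R) \<times> (S \<union> R). u \<noteq> v \<and> (u, v) \<notin> U} \<union> {c} \<times> S \<union> S \<times> {c}"
      proof cases
        case 1
        then show ?thesis using uv c(2) E(2) by auto
      next
        case 2
        then show ?thesis using uv c(2) sy[of u v] by auto
      next
        case 3
        then show ?thesis using TE[OF 3] uv by auto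
      qed
    next
      fix u v assume "(u, v) \<in> {(u, v) \<in> (S \<union> R) \<times> (S \<union> R). u \<noteq> v \<and> (u, v) \<notin> U} \<union> {c} \<times> S \<union> S \<times> {c}"
      then consider "u \<in> S \<union> R" "v \<in> S \<union> R" "u \<noteq> v" "(u, v) \<notin> U" | "u = c" "v \<in> S" | "u \<in> S" "v = c" by auto
      then show "(u, v) \<in> E \<inter> insert c (S \<union> R) \<times> insert c (S \<union> R)"
      proof cases
        case 1
        then show ?thesis using TE[OF 1(1,2)] by auto
      next
        case 2
        then show ?thesis using c(1) by auto
      next
        case 3
        then show ?thesis using c(1) sy[of u v] by auto
      qed
    qed
    then show ?thesis by (simp add: add_vertex_def complement_def T_def)
  qed
  moreover have "c \<notin> pverts T" using disj by (simp add: T_def)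
  ultimately show ?thesis unfolding B22_def using l2 m1 by blast
qed


text \<open>The update at \<open>k - 2\<close> sets the share of the last block, so \<open>b\<close>
  itself describes only the path, as in \<open>G1_class\<close>.\<close>

lemma H_class_subset_G1_class:
  fixes G :: "'a pair_pre_digraph"
  assumes k: "k \<ge> 4"
    and bl: "l \<in> {1..k-3}" "b l = 1" and b_other: "\<And>i. i \<in> {1..k-3} \<Longrightarrow> i \<noteq> l \<Longrightarrow> b i = (0::nat)"
    and G: "G \<in> H_class k (b(k-2 := 2))"
  shows "G \<in> G1_class k b"
proof -
  define n where "n = k - 3"
  have kn: "k - 3 = n" "k - 2 = Suc n" "k = n + 3" "1 \<le> n" using k by (auto simp: n_def)
  obtain Bl c D where lab: "block_labeling k G Bl c" and gD: "gamma_c_set G D"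
    and bD: "\<And>i. i \<in> {1..k-2} \<Longrightarrow>
      card ((verts (Bl i) - cut_vertices (with_proj G)) \<inter> D) = (b(k-2 := 2)) i"
    and Z: "G \<in> Z_class k (k-3)"
    using G by (auto simp: H_class_def)
  have pg: "pair_graph G" and conG: "connected (with_proj G)" and gk: "gamma_c G = k"
    and crit: "\<And>u v. u \<in> pverts G \<Longrightarrow> v \<in> pverts G \<Longrightarrow> u \<noteq> v \<Longrightarrow> (u, v) \<notin> parcs G \<Longrightarrow>
      gamma_c (add_edge G u v) < k"
    using Z by (auto simp: Z_class_def gamma_c_critical_def)
  note pgD = pair_graphD[OF pg]
  define V where "V = pverts G"
  define E where "E = parcs G"
  define W where "W j = verts (Bl j)" for j
  have symE: "sym E" and EV: "E \<subseteq> V \<times> V" and fin: "finite V" and irr: "\<And>x. (x, x) \<notin> E"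
    using pgD by (auto simp: V_def E_def)
  have conn_V: "conn E V" using conG symE connected_iff_conn[of "with_proj G"] by (simp add: V_def E_def)
  have cut: "cut_vertices (with_proj G) = {v \<in> V. V - {v} \<noteq> {} \<and> \<not> conn E (V - {v})}"
    using cut_vertices_eq[OF pg] conn_V by (simp add: V_def E_def)
  have bijB: "Bl ` {1..Suc n} = blocks (with_proj G)"
    and bijc: "c ` {1..n} = cut_vertices (with_proj G)" "inj_on c {1..n}"
    using lab by (auto simp: block_labeling_def bij_betw_def kn)
  have ns: "nonsep E (W j)" and WV: "W j \<subseteq> V" if j: "j \<in> {1..Suc n}" for j
  proof -
    have "Bl j \<in> blocks (with_proj G)" using bijB j by blast
    then show "nonsep E (W j)" "W j \<subseteq> V" using blockD[OF pg] by (simp_all add: W_def V_def E_def)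
  qed
  \<comment> \<open>The maximality of blocks enters here; applied to single vertices and to edges,
    it shows that the labelled blocks cover the graph.\<close>
  have ex_W: "\<exists>j \<in> {1..Suc n}. U \<subseteq> W j" if U: "U \<subseteq> V" "nonsep E U" for U
  proof -
    obtain K where "K \<in> blocks (with_proj G)" "U \<subseteq> verts K"
      using ex_block[OF pg, of U] U by (auto simp: V_def E_def)
    then obtain j where "j \<in> {1..Suc n}" "K = Bl j" using bijB by blast
    then show ?thesis using \<open>U \<subseteq> verts K\<close> by (auto simp: W_def)
  qed
  have VW: "V = (\<Union>j \<in> {1..Suc n}. W j)"
  proof (intro equalityI subsetI)
    fix v assume "v \<in> V"
    moreover have "nonsep E {v}" by (simp add: nonsep_def)
    ultimately show "v \<in> (\<Union>j \<in> {1..Suc n}. W j)" using ex_W[of "{v}"] by auto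
  qed (use WV in blast)
  have edge: "\<exists>j \<in> {1..Suc n}. x \<in> W j \<and> y \<in> W j" if xy: "(x, y) \<in> E" for x y
  proof -
    have "conn E {x, y}" by (rule conn_pair[OF xy symE])
    moreover have "{x, y} - {x} \<noteq> {} \<Longrightarrow> {x, y} - {x} = {y}" "{x, y} - {y} \<noteq> {} \<Longrightarrow> {x, y} - {y} = {x}"
      by auto
    ultimately have "nonsep E {x, y}" unfolding nonsep_def
      by (metis conn_singleton insertE singletonD)
    moreover have "{x, y} \<subseteq> V" using xy EV by auto
    ultimately show ?thesis using ex_W[of "{x, y}"] by auto
  qed
  have c_in: "c i \<in> W i" "c i \<in> W (Suc i)" if i: "i \<in> {1..n}" for i
  proof -
    have lab': "c 1 \<in> W 1" "c n \<in> W (Suc n)" "\<And>i. i \<in> {2..n} \<Longrightarrow> c (i - 1) \<in> W i \<and> c i \<in> W i"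
      using lab by (auto simp: block_labeling_def kn W_def)
    show "c i \<in> W i" using lab'(1) lab'(3)[of i] i by (cases "i = 1") auto
    show "c i \<in> W (Suc i)" using lab'(2) lab'(3)[of "Suc i"] i by (cases "i = n") auto
  qed
  have sepa: "chain.A W m \<inter> chain.B n W m = {c m} \<and> chain.A W m \<noteq> {c m} \<and> chain.B n W m \<noteq> {c m}"
    if m: "m \<in> {1..n}" for m
  proof -
    have "c m \<in> cut_vertices (with_proj G)" using m bijc by blast
    then have "V - {c m} \<noteq> {}" "\<not> conn E (V - {c m})" unfolding cut by auto
    then show ?thesis using chain_separation[OF symE VW ns _ bijc(2) m] c_in by auto
  qed
  have cds_iff: "connected_dominating_set G D' \<longleftrightarrow> cds E V D'" for D'
    using connected_dominating_set_iff_cds[OF pgD(1)] by (simp add: V_def E_def)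
  have cD: "cds E V D" "card D = n + 3" using gD gk cds_iff kn by (auto simp: gamma_c_set_def)
  have C_eq: "chain.C n W c j = verts (Bl j) - cut_vertices (with_proj G)" for j
    unfolding chain.C_def W_def bijc(1) ..
  have cardC: "card (D \<inter> chain.C n W c j) = (b(k-2 := 2)) j" if "j \<in> {1..Suc n}" for j
    unfolding C_eq using bD[of j] that by (simp add: Int_commute kn)
  interpret critical_chain n W c V E D l
  proof
    show "V = chain.A W (Suc n)" unfolding chain.A_def by (rule VW)
    show "chain.A W m \<inter> chain.B n W m = {c m}" "chain.A W m \<noteq> {c m}" "chain.B n W m \<noteq> {c m}"
      if "m \<in> {1..n}" for m using sepa[OF that] by auto
    show "card D \<le> card D'" if "cds E V D'" for D'
      using gamma_c_le[OF pgD(3), of D'] that cds_iff cD gk kn by simp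
    show "\<exists>D'. cds (E \<union> link u v) V D' \<and> card D' < card D"
      if uv: "u \<in> V" "v \<in> V" "u \<noteq> v" "(u, v) \<notin> E" for u v
    proof -
      have s: "sym (parcs (add_edge G u v))" using symE sym_link[of u v] by (auto simp: E_def sym_def)
      have iff: "connected_dominating_set (add_edge G u v) D' \<longleftrightarrow> cds (E \<union> link u v) V D'" for D'
        using connected_dominating_set_iff_cds[OF s] by (simp add: V_def E_def)
      have "conn (E \<union> link u v) V" by (rule conn_mono[OF conn_V]) auto
      then have "cds (E \<union> link u v) V V" by (simp add: cds_def)
      then obtain D' where "connected_dominating_set (add_edge G u v) D'" "card D' = gamma_c (add_edge G u v)"
        using gamma_c_witness[of "add_edge G u v" V] iff pgD(3) by auto
      moreover have "gamma_c (add_edge G u v) < k" using crit uv by (simp add: V_def E_def)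
      ultimately show ?thesis using iff cD kn by auto
    qed
    show "card (D \<inter> chain.C n W c l) = 1" using cardC[of l] bl kn by auto
    show "card (D \<inter> chain.C n W c i) = 0" if "i \<in> {1..n}" "i \<noteq> l" for i
      using cardC[of i] b_other[of i] that kn by auto
    show "card (D \<inter> chain.C n W c (Suc n)) = 2" using cardC[of "Suc n"] kn by simp
  qed (use fin EV symE irr kn edge ns c_in bijc(2) cD bl in auto)
  obtain c0 Q where c0: "c0 \<in> C 1" "l \<noteq> 1 \<Longrightarrow> C 1 = {c0}"
    and Wl0: "W l = Q \<union> {(c(0 := c0)) (l - 1), c l}" "(c(0 := c0)) (l - 1) \<notin> Q" "c l \<notin> Q"
      "((c(0 := c0)) (l - 1), c l) \<notin> E"
    and nonadj0: "\<And>u v. u \<in> W l \<Longrightarrow> v \<in> W l \<Longrightarrow> u \<noteq> v \<Longrightarrow> (u, v) \<notin> E \<Longrightarrow>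
      {u, v} = {(c(0 := c0)) (l - 1), c l}"
    by (rule path_structure) blast
  define cc where "cc = c(0 := c0)"
  have ln: "1 \<le> l" "l \<le> n" "l \<in> {1..Suc n}" "l \<in> {1..n}" using bl kn by auto
  have ccl: "c l = cc l" "c n = cc n" using ln kn by (auto simp: cc_def)
  note Wl = Wl0[folded cc_def, unfolded ccl] and nonadj = nonadj0[folded cc_def, unfolded ccl]
  have Wi: "W i = {cc (i - 1), cc i}" "(cc (i - 1), cc i) \<in> E" if "i \<in> {1..n}" "i \<noteq> l" for i
    using path_block[OF c0 that] by (simp_all add: cc_def)
  have inj_cc: "inj_on cc {0..n}" unfolding cc_def by (rule c0_inj[OF c0(1)])
  have cc_cut: "cc j = c j" if "j \<in> {1..n}" for j using that by (simp add: cc_def)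
  have cc_W: "cc j \<in> W l \<Longrightarrow> j \<le> n \<Longrightarrow> j = l - 1 \<or> j = l" for j
  proof -
    assume j: "cc j \<in> W l" "j \<le> n"
    show "j = l - 1 \<or> j = l"
    proof (cases "j = 0")
      case True
      then have "cc j \<in> C 1" using c0 by (simp add: cc_def)
      then have "l = 1" using C_Int_W[of 1 l] j(1) ln by force
      then show ?thesis using True by simp
    next
      case False
      then have j1: "j \<in> {1..n}" using j by auto
      then have "cc j \<in> W l \<inter> c ` {1..n}" using j cc_cut by auto
      then have "cc j \<in> Cut l" unfolding W_Int_cuts[OF ln(3)] .
      then obtain i where "i \<in> {1..n}" "i = l - 1 \<or> i = l" "c j = c i"
        using cc_cut[OF j1] by (auto simp: Cut_def)
      then show ?thesis using inj_onD[OF bijc(2) _ j1] by blast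
    qed
  qed
  have ccQ: "Q \<inter> cc ` {0..n} = {}"
  proof -
    have False if "j \<le> n" "cc j \<in> Q" for j
    proof -
      have "j = l - 1 \<or> j = l" using cc_W[of j] that Wl(1) by auto
      then show False using that Wl(2,3) by auto
    qed
    then show ?thesis by auto
  qed
  have cc_ne: "cc (l - 1) \<noteq> cc l"
  proof
    assume "cc (l - 1) = cc l"
    moreover have "l - 1 \<in> {0..n}" "l \<in> {0..n}" using ln by auto
    ultimately have "l - 1 = l" using inj_onD[OF inj_cc] by blast
    then show False using ln by auto
  qed
  have card_Q: "2 \<le> card Q" by (rule card_interior_ge[OF ln(3) Wl(1,2,3) cc_ne Wl(4)])
  have QV: "Q \<subseteq> V" using Wl WV[OF ln(3)] by auto
  have finQ: "finite Q" by (rule finite_subset[OF QV fin])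
  \<comment> \<open>Block \<open>l\<close> without \<open>cc (l - 1)\<close> and
    \<open>cc l\<close>: every non-edge of the block is between these two, so what remains is
    complete.\<close>
  define Q' where "Q' = \<lparr>pverts = Q, parcs = {(u, v). (u, v) \<in> Q \<times> Q \<and> u \<noteq> v}\<rparr>"
  have "pair_graph Q'" by (rule pair_graphI) (auto simp: Q'_def sym_def finQ)
  then have Q': "complete_digraph (card Q) (with_proj Q')"
    by (simp add: complete_digraph_def pair_graph.pair_graphD_graph) (simp add: Q'_def)
  define K where "K = \<lparr>pverts = W (Suc n), parcs = E \<inter> W (Suc n) \<times> W (Suc n)\<rparr>"
  have K: "B22 K (cc n)"
  proof -
    define f where "f s = (THE a. a \<in> R \<and> (s, a) \<notin> E)" for s
    have f: "f s \<in> R \<and> (s, f s) \<notin> E" if "s \<in> S" for s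
      unfolding f_def by (rule theI'[OF ex1_non_neighbour[OF that]])
    have fE: "(s, a) \<in> E \<longleftrightarrow> a \<noteq> f s" if "s \<in> S" "a \<in> R" for s a
      using ex1_non_neighbour[OF that(1)] f[OF that(1)] that(2) by blast
    obtain s1 where s1: "s1 \<in> S" using S_nonempty by auto
    \<comment> \<open>If all of \<open>S\<close> missed \<open>f s1\<close>, joining the two ends of
      the graph would contradict criticality.\<close>
    obtain s2 where s2: "s2 \<in> S" "f s1 \<noteq> f s2"
      using non_neighbours_differ[of "f s1"] f[OF s1] fE by blast
    have "S \<union> R \<subseteq> V" using W_last WV[of "Suc n"] by auto
    then have fSR: "finite S" "finite R" by (auto intro!: finite_subset[OF _ fin])
    have cS: "(c n, s) \<in> E" if "s \<in> S" for s using that by (simp add: S_def)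
    have cR: "(c n, a) \<notin> E" if "a \<in> R" for a using that by (simp add: R_def)
    have "B22 \<lparr>pverts = insert (c n) (S \<union> R), parcs = E \<inter> insert (c n) (S \<union> R) \<times> insert (c n) (S \<union> R)\<rparr> (c n)"
      by (rule B22I[of S R "c n" E f s1 s2])
        (fact fSR cn symE irr S_complete R_complete fE cS cR s1 s2 f[THEN conjunct1])+
    then show ?thesis unfolding K_def W_last ccl .
  qed
  define P where "P = {(cc (i - 1), cc i) | i. i \<in> {1..n} - {l}}"
  define J where "J = Q \<times> {cc (l - 1), cc l}"
  have ccW: "cc ` {0..n} \<inter> W (Suc n) = {cc n}"
  proof -
    have eq: "cc j = cc n" if j: "j \<le> n" "cc j \<in> W (Suc n)" for j
    proof (cases "j = 0")
      case True
      then have "cc j \<in> C 1" using c0 by (simp add: cc_def)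
      then show ?thesis using C_Int_W[of 1 "Suc n"] j kn by auto
    next
      case False
      then have j1: "j \<in> {1..n}" using j by auto
      then have "cc j \<in> W (Suc n) \<inter> c ` {1..n}" using j cc_cut by auto
      then have "cc j \<in> Cut (Suc n)" using W_Int_cuts[of "Suc n"] by auto
      then have "c j = c n" using Cut_last cc_cut[OF j1] by auto
      then show ?thesis using cc_cut[OF j1] ccl by simp
    qed
    have "cc n \<in> W (Suc n)" using c_in(2)[of n] ccl kn by auto
    then show ?thesis using eq kn by (intro equalityI subsetI) auto
  qed
  have QW: "Q \<inter> W (Suc n) = {}"
  proof -
    have False if x: "x \<in> Q" "x \<in> W (Suc n)" for x
    proof -
      have "x = c l" using W_Int_W[of l "Suc n" x] x Wl ln by auto
      then show False using Wl ccl x by auto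
    qed
    then show ?thesis by auto
  qed
  have Veq: "V = cc ` {0..n} \<union> Q \<union> W (Suc n)"
  proof (intro equalityI subsetI)
    fix x assume "x \<in> V"
    then obtain j where j: "j \<in> {1..Suc n}" "x \<in> W j" unfolding VW by blast
    consider "j = Suc n" | "j = l" | "j \<in> {1..n}" "j \<noteq> l" using j by force
    then show "x \<in> cc ` {0..n} \<union> Q \<union> W (Suc n)"
    proof cases
      case 2
      moreover have "l - 1 \<in> {0..n}" "l \<in> {0..n}" using ln by auto
      ultimately show ?thesis using j Wl(1) by blast
    next
      case 3
      moreover have "j - 1 \<in> {0..n}" "j \<in> {0..n}" using 3 by auto
      ultimately show ?thesis using j Wi(1)[OF 3] by blast
    qed (use j in simp)
  next
    fix x assume x: "x \<in> cc ` {0..n} \<union> Q \<union> W (Suc n)"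
    have "cc j \<in> V" if "j \<le> n" for j
      using c_V[of j] c0(1) C_sub_W W_sub_V[of 1] that by (cases "j = 0") (auto simp: cc_def)
    then show "x \<in> V" using x QV WV[of "Suc n"] by auto
  qed
  have Eeq: "E = P \<union> P\<inverse> \<union> parcs Q' \<union> J \<union> J\<inverse> \<union> parcs K"
  proof (intro equalityI subrelI)
    fix x y assume xy: "(x, y) \<in> E"
    then obtain j where j: "j \<in> {1..Suc n}" "x \<in> W j" "y \<in> W j" using edge by blast
    have ne: "x \<noteq> y" using xy irr by auto
    have yx: "(y, x) \<in> E" by (rule symD[OF symE xy])
    consider "j = Suc n" | "j = l" | "j \<in> {1..n}" "j \<noteq> l" using j by force
    then show "(x, y) \<in> P \<union> P\<inverse> \<union> parcs Q' \<union> J \<union> J\<inverse> \<union> parcs K"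
    proof cases
      case 1
      then show ?thesis using xy j by (simp add: K_def)
    next
      case 2
      then have "x \<in> Q \<or> x = cc (l - 1) \<or> x = cc l" "y \<in> Q \<or> y = cc (l - 1) \<or> y = cc l"
        using j Wl(1) by auto
      then show ?thesis using Wl(4) xy yx ne by (auto simp: Q'_def J_def)
    next
      case 3
      then have "(cc (j - 1), cc j) \<in> P" by (auto simp: P_def)
      moreover have "x = cc (j - 1) \<and> y = cc j \<or> x = cc j \<and> y = cc (j - 1)"
        using j Wi(1)[OF 3] ne by auto
      ultimately show ?thesis by auto
    qed
  next
    fix x y assume xy: "(x, y) \<in> P \<union> P\<inverse> \<union> parcs Q' \<union> J \<union> J\<inverse> \<union> parcs K"
    have P: "(u, v) \<in> E" if "(u, v) \<in> P" for u v using that Wi(2) by (auto simp: P_def)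
    have WQ: "(u, v) \<in> E" if "u \<in> Q" "v \<in> W l" "u \<noteq> v" for u v
    proof (rule ccontr)
      assume "(u, v) \<notin> E"
      then have "{u, v} = {cc (l - 1), cc l}" using nonadj[of u v] that Wl(1) by auto
      then have "u \<in> {cc (l - 1), cc l}" by blast
      then show False using that Wl(2,3) by auto
    qed
    have J: "(u, v) \<in> E" if "(u, v) \<in> J" for u v
      using that WQ[of u v] Wl(1,2,3) by (auto simp: J_def)
    have "(u, v) \<in> E" if "(u, v) \<in> parcs Q'" for u v
      using that WQ[of u v] Wl(1) by (auto simp: Q'_def)
    moreover have "(u, v) \<in> E" if "(u, v) \<in> parcs K" for u v using that by (auto simp: K_def)
    ultimately show "(x, y) \<in> E" using xy P J symD[OF symE] by blast
  qed
  show ?thesis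
    unfolding G1_class_def kn(1)
  proof (intro CollectI exI conjI)
    show "l \<in> {1..n}" by (rule ln)
    show "b l = 1" by (rule bl)
    show "\<forall>i \<in> {1..n} - {l}. b i = 0" using b_other kn by auto
    show "inj_on cc {0..n}" by (rule inj_cc)
    show "2 \<le> card Q" by (rule card_Q)
    show "complete_digraph (card Q) (with_proj Q')" by (rule Q')
    show "pverts Q' \<inter> cc ` {0..n} = {}" using ccQ by (simp add: Q'_def)
    show "B22 K (cc n)" by (rule K)
    show "pverts K \<inter> (cc ` {0..n} \<union> pverts Q') = {cc n}" using ccW QW by (auto simp: K_def Q'_def)
    show "P = {(cc (i - 1), cc i) | i. i \<in> {1..n} - {l}}" by (rule P_def)
    show "J = pverts Q' \<times> {cc (l - 1), cc l}" by (simp add: J_def Q'_def)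
    show "pverts G = cc ` {0..n} \<union> pverts Q' \<union> pverts K"
      using Veq by (simp add: V_def K_def Q'_def)
    show "parcs G = P \<union> P\<inverse> \<union> parcs Q' \<union> J \<union> J\<inverse> \<union> parcs K" using Eeq by (simp add: E_def)
  qed
qed


section \<open>Blown-up paths: every graph in G1 is in H\<close>

lemma conn_hub:
  assumes "h \<in> X" "\<And>y. y \<in> X \<Longrightarrow> y \<noteq> h \<Longrightarrow> (h, y) \<in> E" "sym E"
  shows "conn E X"
proof (rule connI)
  fix A assume A: "A \<noteq> {}" "A \<subseteq> X" "\<And>a b. a \<in> A \<Longrightarrow> b \<in> X \<Longrightarrow> (a, b) \<in> E \<Longrightarrow> b \<in> A"
  then obtain a where a: "a \<in> A" by auto
  have "h \<in> A"
  proof (cases "a = h")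
    case False
    then have "(a, h) \<in> E" using assms(2)[of a] A(2) a symD[OF assms(3)] by blast
    then show ?thesis using A(3)[of a h] a assms(1) by simp
  qed (use a in simp)
  then show "X \<subseteq> A" using A(3)[of h] assms(2) by blast
qed (use assms(1) in auto)

text \<open>
  In the block of class \<open>B22\<close>, \<open>S\<close> is the set of star leaves, \<open>R\<close> the set of all other vertices
  except the head \<open>c n\<close>, and \<open>f\<close> maps a leaf to the centre of its star.
\<close>

locale blown_path =
  fixes n l :: nat and c :: "nat \<Rightarrow> 'a" and Q S R :: "'a set" and f :: "'a \<Rightarrow> 'a" and E :: "'a rel"
  assumes l1: "1 \<le> l" and ln: "l \<le> n"
    and inj: "inj_on c {0..n}"
    and fin: "finite Q" "finite S" "finite R" and card_Q: "2 \<le> card Q"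
    and disj: "Q \<inter> c ` {0..n} = {}" "S \<inter> R = {}" "(S \<union> R) \<inter> c ` {0..n} = {}" "(S \<union> R) \<inter> Q = {}"
    and symE: "sym E" and irr: "(x, x) \<notin> E"
    and path: "i \<in> {1..n} \<Longrightarrow> i \<noteq> l \<Longrightarrow> (c (i - 1), c i) \<in> E"
    and QQ: "x \<in> Q \<Longrightarrow> y \<in> Q \<Longrightarrow> x \<noteq> y \<Longrightarrow> (x, y) \<in> E"
    and Qc: "x \<in> Q \<Longrightarrow> (x, c (l - 1)) \<in> E" "x \<in> Q \<Longrightarrow> (x, c l) \<in> E"
    and SS: "x \<in> S \<Longrightarrow> y \<in> S \<Longrightarrow> x \<noteq> y \<Longrightarrow> (x, y) \<in> E"
    and RR: "x \<in> R \<Longrightarrow> y \<in> R \<Longrightarrow> x \<noteq> y \<Longrightarrow> (x, y) \<in> E"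
    and f: "x \<in> S \<Longrightarrow> f x \<in> R"
    and SR: "x \<in> S \<Longrightarrow> y \<in> R \<Longrightarrow> (x, y) \<in> E \<longleftrightarrow> y \<noteq> f x"
    and cS: "x \<in> S \<Longrightarrow> (c n, x) \<in> E" and cR: "x \<in> R \<Longrightarrow> (c n, x) \<notin> E"
    and two: "\<exists>x \<in> S. \<exists>y \<in> S. f x \<noteq> f y"
    and gap: "(c (l - 1), c l) \<notin> E"
    and edges: "(x, y) \<in> E \<Longrightarrow> (\<exists>i \<in> {1..n} - {l}. {x, y} = {c (i - 1), c i}) \<or>
      {x, y} \<subseteq> Q \<union> {c (l - 1), c l} \<or> {x, y} \<subseteq> insert (c n) (S \<union> R)"
begin

text \<open>The intended blocks. \<open>c 0\<close> is not a cut vertex and belongs to the interior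
  of the first block.\<close>

definition W :: "nat \<Rightarrow> 'a set" where
  "W j = (if j = Suc n then insert (c n) (S \<union> R) else if j = l then Q \<union> {c (l - 1), c l}
    else {c (j - 1), c j})"

definition V where "V = (\<Union>j \<in> {1..Suc n}. W j)"

lemma W_last: "W (Suc n) = insert (c n) (S \<union> R)" by (simp add: W_def)
lemma W_l: "W l = Q \<union> {c (l - 1), c l}" using ln by (simp add: W_def)
lemma W_path: "j \<in> {1..n} \<Longrightarrow> j \<noteq> l \<Longrightarrow> W j = {c (j - 1), c j}" by (simp add: W_def)

lemma E_sym: "(x, y) \<in> E \<Longrightarrow> (y, x) \<in> E" by (rule symD[OF symE])

lemma c_inj: "i \<le> n \<Longrightarrow> j \<le> n \<Longrightarrow> c i = c j \<Longrightarrow> i = j"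
  using inj_onD[OF inj] by auto

lemma Q_c: "j \<le> n \<Longrightarrow> c j \<notin> Q" using disj(1) by auto
lemma SR_c: "j \<le> n \<Longrightarrow> c j \<notin> S \<union> R" using disj(3) by auto

lemma c_in_W: "j \<le> n \<Longrightarrow> j \<noteq> 0 \<Longrightarrow> c j \<in> W j" "j \<le> n \<Longrightarrow> c j \<in> W (Suc j)"
  using ln by (auto simp: W_def)

lemma c_W_index:
  assumes "j \<in> {1..Suc n}" "a \<le> n" "c a \<in> W j"
  shows "a = j - 1 \<or> a = j"
proof -
  consider "j = Suc n" | "j = l" | "j \<in> {1..n}" "j \<noteq> l" using assms(1) by force
  then show ?thesis
  proof cases
    case 1
    then have "c a = c n" using assms W_last SR_c by auto
    then show ?thesis using c_inj[of a n] assms 1 by auto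
  next
    case 2
    then have "c a = c (l - 1) \<or> c a = c l" using assms W_l Q_c by auto
    then show ?thesis using c_inj[of a "l - 1"] c_inj[of a l] assms 2 ln by auto
  next
    case 3
    then have "c a = c (j - 1) \<or> c a = c j" using assms W_path by auto
    then show ?thesis using c_inj[of a "j - 1"] c_inj[of a j] assms 3 by auto
  qed
qed

lemma W_cases:
  assumes "j \<in> {1..Suc n}" "x \<in> W j"
  obtains "x \<in> S \<union> R" "j = Suc n" | "x \<in> Q" "j = l" | a where "x = c a" "a \<le> n" "a = j - 1 \<or> a = j"
proof -
  consider "j = Suc n" | "j = l" | "j \<in> {1..n}" "j \<noteq> l" using assms(1) by force
  then show thesis
  proof cases
    case 1
    then show ?thesis using assms W_last that(1) that(3)[of n] by auto
  next
    case 2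
    then show ?thesis using assms W_l that(2) that(3)[of "l - 1"] that(3)[of l] ln by auto
  next
    case 3
    then show ?thesis using assms W_path that(3)[of "j - 1"] that(3)[of j] by auto
  qed
qed

lemma W_meet:
  assumes ij: "i \<in> {1..Suc n}" "j \<in> {1..Suc n}" "i < j" and x: "x \<in> W i" "x \<in> W j"
  shows "j = Suc i \<and> x = c i"
  using ij(1) x(1)
proof (cases rule: W_cases)
  case 1
  then show ?thesis using ij by simp
next
  case 2
  from ij(2) x(2) show ?thesis
    by (cases rule: W_cases) (use 2 ij disj(4) Q_c in auto)
next
  case (3 a)
  then have "a = j - 1 \<or> a = j" using c_W_index[OF ij(2), of a] x by simp
  then show ?thesis using 3 ij by auto
qed

lemma edge_W:
  assumes "(x, y) \<in> E"
  shows "\<exists>j \<in> {1..Suc n}. x \<in> W j \<and> y \<in> W j"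
  using edges[OF assms]
proof (elim disjE)
  assume "\<exists>i \<in> {1..n} - {l}. {x, y} = {c (i - 1), c i}"
  then obtain i where "i \<in> {1..n}" "i \<noteq> l" "{x, y} = {c (i - 1), c i}" by blast
  then have "{x, y} \<subseteq> W i" "i \<in> {1..Suc n}" using W_path by auto
  then show ?thesis by blast
next
  assume "{x, y} \<subseteq> Q \<union> {c (l - 1), c l}"
  then have "{x, y} \<subseteq> W l" "l \<in> {1..Suc n}" using W_l l1 ln by auto
  then show ?thesis by blast
next
  assume "{x, y} \<subseteq> insert (c n) (S \<union> R)"
  then show ?thesis using W_last by (intro bexI[of _ "Suc n"]) auto
qed

text \<open>The edges from \<open>s1\<close> to \<open>f s2\<close> and from \<open>s2\<close> to
  \<open>f s1\<close> are disjoint, so a single vertex meets at most one of them.\<close>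

lemma cross_edge: "\<exists>s \<in> S. \<exists>a \<in> R. s \<noteq> v \<and> a \<noteq> v \<and> (s, a) \<in> E"
proof -
  obtain s1 s2 where s: "s1 \<in> S" "s2 \<in> S" "f s1 \<noteq> f s2" using two by blast
  have a: "(s1, f s2) \<in> E" "(s2, f s1) \<in> E" "f s1 \<in> R" "f s2 \<in> R" using s SR f by auto
  show ?thesis
  proof (cases "v = s1 \<or> v = f s2")
    case True
    then have "s2 \<noteq> v" "f s1 \<noteq> v" using s a disj(2) by auto
    then show ?thesis using s a by blast
  next
    case False
    then show ?thesis using s a by (intro bexI[of _ s1] bexI[of _ "f s2"]) auto
  qed
qed

text \<open>\<open>Z\<close> is empty or a singleton, so connectedness before and after a deletion
  is one statement: the head with \<open>S\<close>, and \<open>R\<close>, are each connected without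
  \<open>Z\<close>, and a cross edge avoiding \<open>Z\<close> joins them.\<close>

lemma conn_last:
  assumes "Z \<subseteq> {v}"
  shows "conn E (insert (c n) (S \<union> R) - Z)"
proof -
  obtain s a where s: "s \<in> S - Z" "a \<in> R - Z" "(s, a) \<in> E" using cross_edge[of v] assms by blast
  have "conn E (insert (c n) S - Z)"
  proof (cases "c n \<in> Z")
    case True
    then show ?thesis using s SS symE by (intro conn_hub[of s]) auto
  next
    case False
    then show ?thesis using cS symE by (intro conn_hub[of "c n"]) auto
  qed
  moreover have "conn E (R - Z)" using s RR symE by (intro conn_hub[of a]) auto
  ultimately have "conn E ((insert (c n) S - Z) \<union> (R - Z))"
    using s symE by (intro conn_Un[of E _ _ s a]) auto
  moreover have "(insert (c n) S - Z) \<union> (R - Z) = insert (c n) (S \<union> R) - Z" by auto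
  ultimately show ?thesis by simp
qed

lemma nonsep_W:
  assumes "j \<in> {1..Suc n}"
  shows "nonsep E (W j)"
proof -
  consider "j = Suc n" | "j = l" | "j \<in> {1..n}" "j \<noteq> l" using assms(1) by force
  then show ?thesis
  proof cases
    case 1
    have "conn E (W (Suc n) - {v})" for v using conn_last[of "{v}" v] by (simp add: W_last)
    moreover have "conn E (W (Suc n))" using conn_last[of "{}"] by (simp add: W_last)
    ultimately show ?thesis using 1 by (simp add: nonsep_def)
  next
    case 2
    \<comment> \<open>Every vertex of \<open>Q\<close> is adjacent to all others of
      \<open>W l\<close>; as \<open>Q\<close> has at least two, one of them survives any
      deletion.\<close>
    have hub: "conn E (W l - Z)" if "q \<in> Q" "q \<notin> Z" for q Z
      using that QQ Qc symE unfolding W_l by (intro conn_hub[of q]) auto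
    have other: "\<exists>q \<in> Q. q \<noteq> v" for v
    proof (rule ccontr)
      assume "\<not> (\<exists>q \<in> Q. q \<noteq> v)"
      then have "Q \<subseteq> {v}" by auto
      then have "card Q \<le> card {v}" by (intro card_mono) auto
      then show False using card_Q by simp
    qed
    have "conn E (W l - {v})" for v using other[of v] hub[of _ "{v}"] by auto
    moreover obtain q where "q \<in> Q" using other by blast
    then have "conn E (W l)" using hub[of q "{}"] by simp
    ultimately show ?thesis using 2 by (simp add: nonsep_def)
  next
    case 3
    let ?a = "c (j - 1)" and ?b = "c j"
    have "conn E {?a, ?b}" using path[OF 3] symE by (rule conn_pair)
    moreover have "{?a, ?b} - {?a} \<noteq> {} \<Longrightarrow> {?a, ?b} - {?a} = {?b}"
      "{?a, ?b} - {?b} \<noteq> {} \<Longrightarrow> {?a, ?b} - {?b} = {?a}" by auto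
    ultimately show ?thesis unfolding W_path[OF 3] nonsep_def
      by (metis conn_singleton insertE singletonD)
  qed
qed

lemma V_cases:
  assumes "x \<in> V"
  obtains "x \<in> S \<union> R" | "x \<in> Q" | a where "x = c a" "a \<le> n"
proof -
  obtain j where "j \<in> {1..Suc n}" "x \<in> W j" using assms by (auto simp: V_def)
  then show thesis by (cases rule: W_cases) (use that in auto)
qed

lemma in_V: "x \<in> S \<union> R \<Longrightarrow> x \<in> V" "x \<in> Q \<Longrightarrow> x \<in> V" "a \<le> n \<Longrightarrow> c a \<in> V"
proof -
  have "W (Suc n) \<subseteq> V" unfolding V_def by (rule UN_upper) simp
  moreover have "W l \<subseteq> V" unfolding V_def by (rule UN_upper) (use l1 ln in simp)
  ultimately show "x \<in> S \<union> R \<Longrightarrow> x \<in> V" "x \<in> Q \<Longrightarrow> x \<in> V" by (auto simp: W_last W_l)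
  show "a \<le> n \<Longrightarrow> c a \<in> V" using c_in_W(2)[of a] by (auto simp: V_def)
qed

text \<open>The vertex \<open>c 0\<close> shows that the left side of \<open>c m\<close> is more
  than \<open>c m\<close>, and a leaf \<open>s\<close> does this for the right side. Cut vertices,
  blocks and the restriction to single blocks are then available from the chain.\<close>

sublocale block_chain n W c V E
proof
  have WV: "W j \<subseteq> V" if "j \<in> {1..Suc n}" for j using that by (auto simp: V_def)
  have "V \<subseteq> S \<union> R \<union> Q \<union> c ` {0..n}"
  proof
    fix x assume "x \<in> V"
    then show "x \<in> S \<union> R \<union> Q \<union> c ` {0..n}" by (cases rule: V_cases) auto
  qed
  then show "finite V" by (rule finite_subset) (use fin in simp)
  show "E \<subseteq> V \<times> V"
  proof (rule subrelI)
    fix x y assume "(x, y) \<in> E"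
    from edge_W[OF this] show "(x, y) \<in> V \<times> V" using WV by blast
  qed
  show "1 \<le> n" using l1 ln by simp
  show "V = chain.A W (Suc n)" by (simp add: V_def chain.A_def)
  show "inj_on c {1..n}" by (rule inj_on_subset[OF inj]) auto
  fix m assume m: "m \<in> {1..n}"
  show "chain.A W m \<inter> chain.B n W m = {c m}"
  proof (intro equalityI subsetI)
    fix x assume "x \<in> chain.A W m \<inter> chain.B n W m"
    then obtain i j where ij: "i \<in> {1..m}" "x \<in> W i" "j \<in> {Suc m..Suc n}" "x \<in> W j"
      unfolding chain.A_def chain.B_def by blast
    then have "j = Suc i \<and> x = c i" using m by (intro W_meet) auto
    then show "x \<in> {c m}" using ij by auto
  next
    fix x assume "x \<in> {c m}"
    then show "x \<in> chain.A W m \<inter> chain.B n W m"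
      unfolding chain.A_def chain.B_def using c_in_W[of m] m by auto
  qed
  have "c 0 \<in> chain.A W m" unfolding chain.A_def using c_in_W(2)[of 0] m by auto
  then show "chain.A W m \<noteq> {c m}" using c_inj[of 0 m] m by auto
  obtain s where "s \<in> S" using two by auto
  then have "s \<in> chain.B n W m" "s \<noteq> c m"
    unfolding chain.B_def using W_last m SR_c[of m] by (force, auto)
  then show "chain.B n W m \<noteq> {c m}" by auto
qed (use symE irr edge_W nonsep_W c_in_W in auto)

text \<open>The \<open>n\<close> cut vertices are forced. Without a vertex of \<open>Q\<close>, the
  trace on block \<open>l\<close> would be the non-adjacent pair \<open>c (l - 1)\<close>,
  \<open>c l\<close>, or \<open>c l\<close> alone, which does not dominate \<open>c (l - 1)\<close>.
  The last block requires two further vertices.\<close>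

lemma card_cds_ge:
  assumes D: "cds E V D"
  shows "n + 3 \<le> card D"
proof -
  have D0: "cds (E \<union> {}) V D" using D by simp
  have cD: "c m \<in> D" if "m \<in> {1..n}" for m
    by (rule cut_in_cds[OF D0 that]) (simp add: keeps_def)
  have loc: "cds E (W j) (D \<inter> W j)" if "j \<in> {1..Suc n}" for j
    using loc_of_cds[OF D0 that] by (simp add: loc_def keeps_def)
  have DV: "D \<subseteq> V" using D by (simp add: cds_def)
  have fD: "finite D" by (rule finite_subset[OF DV block_chain.fin[OF block_chain_axioms]])
  have lr: "l \<in> {1..Suc n}" "l \<in> {1..n}" using l1 ln by auto
  have "\<exists>q \<in> Q. q \<in> D"
  proof (rule ccontr)
    assume no: "\<not> (\<exists>q \<in> Q. q \<in> D)"
    have "l - 1 \<le> n" "l - 1 \<noteq> l" using l1 ln by auto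
    then have ne: "c (l - 1) \<noteq> c l" using c_inj[of "l - 1" l] ln by blast
    show False
    proof (cases "c (l - 1) \<in> D")
      case True
      then have "D \<inter> W l = {c (l - 1), c l}" using no W_l cD[OF lr(2)] by auto
      then have "conn E {c (l - 1), c l}" using loc[OF lr(1)] by (simp add: cds_def)
      then show False using conn_pairD ne gap by metis
    next
      case False
      then have "D \<inter> W l = {c l}" using no W_l cD[OF lr(2)] by auto
      then have "cds E (W l) {c l}" using loc[OF lr(1)] by simp
      then have "(c l, c (l - 1)) \<in> E" using ne W_l by (auto simp: cds_def)
      then show False using gap E_sym by blast
    qed
  qed
  then obtain q where q: "q \<in> Q" "q \<in> D" by auto
  have "2 \<le> card (D \<inter> (S \<union> R))"
  \<comment> \<open>A single vertex \<open>z\<close> in \<open>S \<union> R\<close> must lie in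
    \<open>S\<close> to be connected to the head, and then \<open>f z\<close> stays
    undominated.\<close>
  proof (rule ccontr)
    assume small: "\<not> 2 \<le> card (D \<inter> (S \<union> R))"
    have cn: "c n \<in> D" using cD[of n] l1 ln by auto
    have DW: "D \<inter> W (Suc n) = insert (c n) (D \<inter> (S \<union> R))" using cn W_last by auto
    have L: "cds E (insert (c n) (S \<union> R)) (insert (c n) (D \<inter> (S \<union> R)))"
      using loc[of "Suc n"] DW unfolding W_last by simp
    have dom: "x \<in> D \<or> (\<exists>u \<in> insert (c n) (D \<inter> (S \<union> R)). (u, x) \<in> E)" if "x \<in> R" for x
    proof -
      have "x \<in> insert (c n) (D \<inter> (S \<union> R)) \<or> (\<exists>u \<in> insert (c n) (D \<inter> (S \<union> R)). (u, x) \<in> E)"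
        using L that by (simp add: cds_def)
      moreover have "x \<noteq> c n" using that SR_c[of n] by auto
      ultimately show ?thesis by blast
    qed
    obtain s where s: "s \<in> S" using two by blast
    consider "D \<inter> (S \<union> R) = {}" | z where "D \<inter> (S \<union> R) = {z}"
      using small fD by (metis One_nat_def card_0_eq card_1_singletonE finite_Int less_2_cases not_le)
    then show False
    proof cases
      case 1
      then show False using dom[of "f s"] f[OF s] cR by auto
    next
      case 2
      have "conn E {c n, z}" using L 2 by (simp add: cds_def)
      moreover have zc: "c n \<noteq> z" "z \<in> S \<union> R" using 2 SR_c[of n] by auto
      ultimately have "(c n, z) \<in> E" by (intro conn_pairD)
      then have z: "z \<in> S" using zc cR by auto
      then have "f z \<notin> D" using 2 f[OF z] disj(2) by auto
      then show False using dom[of "f z"] f[OF z] SR[OF z f[OF z]] cR 2 by auto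
    qed
  qed
  moreover have "card (c ` {1..n}) = n"
    using inj_on_subset[OF inj, of "{1..n}"] by (simp add: card_image)
  moreover have "card (insert q (c ` {1..n} \<union> D \<inter> (S \<union> R))) = Suc (card (c ` {1..n}) + card (D \<inter> (S \<union> R)))"
  proof -
    have "q \<notin> c ` {1..n} \<union> D \<inter> (S \<union> R)" using q disj(4) Q_c by auto
    moreover have "c ` {1..n} \<inter> (D \<inter> (S \<union> R)) = {}" using SR_c by auto
    ultimately show ?thesis using fD by (simp add: card_Un_disjoint)
  qed
  moreover have "card (insert q (c ` {1..n} \<union> D \<inter> (S \<union> R))) \<le> card D"
    using q cD fD by (intro card_mono) auto
  ultimately show ?thesis by linarith
qed

text \<open>The path through a chosen \<open>q\<close> in \<open>Q\<close>:
  \<open>c 0, ..., c (l - 1), q, c l, ..., c n\<close>, indexed from \<open>0\<close> to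
  \<open>Suc n\<close>. Behind \<open>q\<close> the index of \<open>c\<close> is one less.\<close>

definition p :: "'a \<Rightarrow> nat \<Rightarrow> 'a" where
  "p q j = (if j < l then c j else if j = l then q else c (j - 1))"

lemma p_l: "p q l = q" by (simp add: p_def)
lemma p_last: "p q (Suc n) = c n" using ln by (simp add: p_def)

lemma p_step:
  assumes "q \<in> Q" "j \<le> n"
  shows "(p q j, p q (Suc j)) \<in> E"
proof -
  consider "Suc j < l" | "Suc j = l" | "j = l" | "j > l" by linarith
  then show ?thesis
  proof cases
    case 1
    then show ?thesis using path[of "Suc j"] assms ln by (simp add: p_def)
  next
    case 2
    then show ?thesis using E_sym[OF Qc(1)[OF assms(1)]] by (auto simp: p_def)
  next
    case 3
    then show ?thesis using Qc(2)[OF assms(1)] by (simp add: p_def)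
  next
    case 4
    then show ?thesis using path[of j] assms by (simp add: p_def)
  qed
qed

lemma p_V: "q \<in> Q \<Longrightarrow> j \<le> Suc n \<Longrightarrow> p q j \<in> V"
  using in_V(2)[of q] in_V(3)[of j] in_V(3)[of "j - 1"] ln by (auto simp: p_def)

lemma p_surj:
  assumes "a \<le> n"
  shows "\<exists>j \<le> Suc n. c a = p q j"
proof (cases "a < l")
  case True
  then show ?thesis using assms by (intro exI[of _ a]) (simp add: p_def)
next
  case False
  then show ?thesis using assms by (intro exI[of _ "Suc a"]) (simp add: p_def)
qed

lemma conn_p:
  assumes "q \<in> Q" "a \<le> b" "b \<le> Suc n"
  shows "conn E (p q ` {a..b})"
proof -
  have "conn E (\<Union>j \<in> {a..b}. {p q j})"
    using assms p_step symE by (intro conn_chain) auto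
  moreover have "(\<Union>j \<in> {a..b}. {p q j}) = p q ` {a..b}" by auto
  ultimately show ?thesis by simp
qed

text \<open>The path without its start is connected and dominates everything outside the last block,
  so it remains to choose \<open>Z\<close> there. \<open>F\<close> is kept general for a new edge
  inside that block.\<close>

lemma cds_full:
  assumes q: "q \<in> Q" and Z: "Z \<subseteq> S \<union> R" "conn (E \<union> F) (insert (c n) Z)" and F: "sym F"
    and dom: "\<And>w. w \<in> S \<union> R \<Longrightarrow> w \<in> Z \<or> (\<exists>u \<in> insert (c n) Z. (u, w) \<in> E \<union> F)"
  shows "cds (E \<union> F) V (p q ` {1..Suc n} \<union> Z)"
  unfolding cds_def
proof (intro conjI ballI)
  show "p q ` {1..Suc n} \<union> Z \<subseteq> V" using p_V[OF q] Z in_V(1) by auto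
  have cn: "c n \<in> p q ` {1..Suc n}" using p_last by (intro image_eqI[of _ _ "Suc n"]) auto
  have "conn (E \<union> F) (p q ` {1..Suc n})" by (rule conn_mono[OF conn_p[OF q]]) auto
  then have "conn (E \<union> F) (p q ` {1..Suc n} \<union> insert (c n) Z)"
    using Z(2) cn symE F by (intro conn_Un[of _ _ _ "c n" "c n"]) (auto simp: sym_def)
  moreover have "p q ` {1..Suc n} \<union> insert (c n) Z = p q ` {1..Suc n} \<union> Z" using cn by auto
  ultimately show "conn (E \<union> F) (p q ` {1..Suc n} \<union> Z)" by simp
  have path_dom: "p q j \<in> p q ` {1..Suc n} \<or> (\<exists>u \<in> p q ` {1..Suc n}. (u, p q j) \<in> E)" if "j \<le> Suc n" for j
  proof (cases "j = 0")
    case True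
    have "(p q 1, p q 0) \<in> E" using p_step[OF q, of 0] E_sym by simp
    then show ?thesis using True by auto
  qed (use that in auto)
  fix v assume "v \<in> V"
  then show "v \<in> p q ` {1..Suc n} \<union> Z \<or> (\<exists>u \<in> p q ` {1..Suc n} \<union> Z. (u, v) \<in> E \<union> F)"
  proof (cases rule: V_cases)
    case 1
    then show ?thesis using dom[of v] cn by blast
  next
    case 2
    have "q \<in> p q ` {1..Suc n}" using l1 ln p_l[of q] by (intro image_eqI[of _ _ l]) auto
    then show ?thesis using QQ[OF q 2] by (cases "v = q") auto
  next
    case (3 a)
    then obtain j where "j \<le> Suc n" "v = p q j" using p_surj[of a q] by auto
    then show ?thesis using path_dom[of j] by auto
  qed
qed

text \<open>
  Joining \<open>p q i\<close> to a vertex \<open>t\<close> further down the path makes \<open>p q (i + 1)\<close> superfluous.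
\<close>

lemma cds_skip:
  assumes q: "q \<in> Q" and i: "i \<le> n" and v: "v \<in> S \<union> R" and s: "s \<in> S" "(v, s) \<in> E"
    and dom: "\<And>w. w \<in> S \<union> R \<Longrightarrow> w \<in> {v, s} \<or> (v, w) \<in> E \<or> (s, w) \<in> E"
    and t: "t = v \<or> (\<exists>j \<in> {i + 2..Suc n}. t = p q j)"
  shows "cds (E \<union> link (p q i) t) V (p q ` ({1..Suc n} - {Suc i}) \<union> {v, s})"
proof -
  let ?F = "link (p q i) t"
  \<comment> \<open>The two pieces left after removing \<open>p q (i + 1)\<close>; the new edge ties
    the end of \<open>L\<close> to \<open>T\<close>. For \<open>i = 0\<close> the piece
    \<open>L\<close> is empty and the new edge dominates \<open>p q 0\<close> instead; for
    \<open>i = n\<close> the removed vertex is \<open>c n\<close>, which \<open>s\<close>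
    dominates.\<close>
  define L where "L = p q ` {1..i}"
  define T where "T = p q ` {i + 2..Suc n} \<union> {v, s}"
  have "{1..Suc n} - {Suc i} = {1..i} \<union> {i + 2..Suc n}" using i by auto
  then have eq: "p q ` ({1..Suc n} - {Suc i}) \<union> {v, s} = L \<union> T" by (auto simp: L_def T_def)
  have tT: "t \<in> T" using t by (auto simp: T_def)
  have vs: "conn E {v, s}" by (rule conn_pair[OF s(2) symE])
  have connT: "conn E T"
  proof (cases "i = n")
    case True
    then show ?thesis using vs by (simp add: T_def)
  next
    case False
    then have in2: "i + 2 \<le> Suc n" using i by simp
    have "c n \<in> p q ` {i + 2..Suc n}" using p_last in2 by (intro image_eqI[of _ _ "Suc n"]) auto
    then show ?thesis unfolding T_def using conn_p[OF q in2] vs cS[OF s(1)] symE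
      by (intro conn_Un[of E _ _ "c n" s]) auto
  qed
  have symF: "sym (E \<union> ?F)" using symE sym_link[of "p q i" t] by (auto simp: sym_def)
  have "conn (E \<union> ?F) (L \<union> T)"
  proof (cases "i = 0")
    case True
    then show ?thesis using connT by (auto simp: L_def intro!: conn_mono[OF connT])
  next
    case False
    have "conn (E \<union> ?F) L" unfolding L_def
      by (rule conn_mono[OF conn_p[OF q, of 1 i]]) (use False i in auto)
    moreover have "conn (E \<union> ?F) T" by (rule conn_mono[OF connT]) auto
    moreover have "p q i \<in> L" using False by (auto simp: L_def)
    moreover have "(p q i, t) \<in> E \<union> ?F" by (simp add: link_def)
    ultimately show ?thesis using tT symF by (intro conn_Un[of _ _ _ "p q i" t]) auto
  qed
  moreover have "L \<union> T \<subseteq> V"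
    using p_V[OF q] v s in_V(1) i by (auto simp: L_def T_def)
  moreover have "x \<in> L \<union> T \<or> (\<exists>u \<in> L \<union> T. (u, x) \<in> E \<union> ?F)" if "x \<in> V" for x
  proof -
    have memb: "p q j \<in> L \<union> T" if "j \<in> {1..Suc n}" "j \<noteq> Suc i" for j
    proof (cases "j \<le> i")
      case True
      then show ?thesis using that by (auto simp: L_def)
    next
      case False
      then have "j \<in> {i + 2..Suc n}" using that by auto
      then show ?thesis by (simp add: T_def)
    qed
    have path_dom: "p q j \<in> L \<union> T \<or> (\<exists>u \<in> L \<union> T. (u, p q j) \<in> E \<union> ?F)" if j: "j \<le> Suc n" for j
    proof -
      consider "j = 0" "i = 0" | "j = 0" "i \<noteq> 0" | "j = Suc i" "i = n" | "j = Suc i" "i < n"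
        | "j \<in> {1..Suc n}" "j \<noteq> Suc i" using j i by force
      then show ?thesis
      proof cases
        case 1
        then have "(t, p q j) \<in> ?F" by (simp add: link_def)
        then show ?thesis using tT by blast
      next
        case 2
        then have "p q 1 \<in> L \<union> T" using i by (intro memb) auto
        moreover have "(p q 1, p q j) \<in> E" using 2 p_step[OF q, of 0] E_sym by simp
        ultimately show ?thesis by blast
      next
        case 3
        then have "(s, p q j) \<in> E" using cS[OF s(1)] E_sym p_last by simp
        then show ?thesis by (auto simp: T_def)
      next
        case 4
        then have "p q (Suc j) \<in> L \<union> T" by (intro memb) auto
        moreover have "(p q (Suc j), p q j) \<in> E" using p_step[OF q, of j] E_sym 4 by auto
        ultimately show ?thesis by blast
      next
        case 5
        then show ?thesis using memb by blast
      qed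
    qed
    from that show ?thesis
    proof (cases rule: V_cases)
      case 1
      then show ?thesis using dom[of x] by (auto simp: T_def)
    next
      case 2
      show ?thesis
      proof (cases "l = Suc i")
        \<comment> \<open>Here the removed vertex is \<open>q\<close> itself, and \<open>c l\<close>
          dominates \<open>Q\<close>.\<close>
        case True
        then have "p q (Suc l) \<in> L \<union> T" using ln by (intro memb) auto
        moreover have "(p q (Suc l), x) \<in> E" using E_sym[OF Qc(2)[OF 2]] by (simp add: p_def)
        ultimately show ?thesis by blast
      next
        case False
        then have "q \<in> L \<union> T" using memb[of l] p_l[of q] l1 ln by auto
        then show ?thesis using QQ[OF q 2] by (cases "x = q") auto
      qed
    next
      case (3 a)
      then obtain j where "j \<le> Suc n" "x = p q j" using p_surj[of a q] by auto
      then show ?thesis using path_dom[of j] by auto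
    qed
  qed
  ultimately show ?thesis unfolding eq cds_def by blast
qed

text \<open>For \<open>v\<close> in \<open>S\<close>, a leaf of another star dominates the vertex
  that \<open>v\<close> misses. For \<open>v\<close> in \<open>R\<close>, a leaf not attached to
  \<open>v\<close> dominates \<open>S\<close> while \<open>v\<close> dominates
  \<open>R\<close>.\<close>

lemma partner:
  assumes v: "v \<in> S \<union> R"
  obtains s where "s \<in> S" "(v, s) \<in> E" "s \<noteq> v"
    "\<And>w. w \<in> S \<union> R \<Longrightarrow> w \<in> {v, s} \<or> (v, w) \<in> E \<or> (s, w) \<in> E"
proof -
  obtain s1 s2 where s: "s1 \<in> S" "s2 \<in> S" "f s1 \<noteq> f s2" using two by blast
  show thesis
  proof (cases "v \<in> S")
    case True
    obtain s where s: "s \<in> S" "f s \<noteq> f v" using s by metis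
    have "s \<noteq> v" using s by auto
    then show thesis using that[of s] s True SS[of v] SR[of v] SR[of s] by auto
  next
    case False
    then have vR: "v \<in> R" using v by auto
    obtain s where s: "s \<in> S" "f s \<noteq> v" using s by metis
    have "(v, s) \<in> E" using SR[of s v] s vR E_sym by auto
    moreover have "s \<noteq> v" using s vR disj(2) by auto
    ultimately show thesis using that[of s] s vR RR[of v] SS[of s] by auto
  qed
qed

lemma card_skip:
  assumes "i \<le> n"
  shows "card (p q ` ({1..Suc n} - {Suc i}) \<union> {v, s}) \<le> n + 2"
proof -
  have "card (p q ` ({1..Suc n} - {Suc i})) \<le> card ({1..Suc n} - {Suc i})"
    by (rule card_image_le) simp
  also have "\<dots> = n" using assms by simp
  finally have "card (p q ` ({1..Suc n} - {Suc i})) \<le> n" .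
  moreover have "card {v, s} \<le> 2" by (simp add: card_insert_if)
  ultimately show ?thesis using card_Un_le[of "p q ` ({1..Suc n} - {Suc i})" "{v, s}"] by linarith
qed

lemma card_full:
  "card (p q ` {1..Suc n} \<union> Z) \<le> n + 1 + card Z"
  using card_image_le[of "{1..Suc n}" "p q"] card_Un_le[of "p q ` {1..Suc n}" Z] by simp

lemma Q_nonempty: "\<exists>q. q \<in> Q"
  using card_Q by (cases "Q = {}") auto

lemma crit_path_end:
  assumes u: "u \<in> V" "u \<notin> S \<union> R" and v: "v \<in> S \<union> R" and nE: "(u, v) \<notin> E"
  shows "\<exists>D. cds (E \<union> link u v) V D \<and> card D \<le> n + 2"
proof -
  have "\<exists>q \<in> Q. \<exists>i \<le> Suc n. u = p q i"
    using u(1)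
  proof (cases rule: V_cases)
    case 2
    then show ?thesis using p_l[of u] ln by (intro bexI[of _ u] exI[of _ l]) auto
  next
    case (3 a)
    then show ?thesis using Q_nonempty p_surj[of a] by blast
  qed (use u in simp)
  then obtain q i where q: "q \<in> Q" "i \<le> Suc n" "u = p q i" by auto
  show ?thesis
  proof (cases "i = Suc n")
    case False
    obtain s where s: "s \<in> S" "(v, s) \<in> E"
      "\<And>w. w \<in> S \<union> R \<Longrightarrow> w \<in> {v, s} \<or> (v, w) \<in> E \<or> (s, w) \<in> E" by (rule partner[OF v]) blast
    have "i \<le> n" using False q by simp
    then show ?thesis using cds_skip[OF q(1) _ v s, of i v] card_skip[of i q v s] q(3) by auto
  next
    \<comment> \<open>With the new edge at the head, one further vertex suffices: a leaf of the star
      of \<open>v\<close>, which misses only \<open>v\<close>, or \<open>v\<close> itself if no leaf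
      is attached to it.\<close>
    case True
    then have uc: "u = c n" using q p_last by simp
    then have vR: "v \<in> R" using v nE cS by auto
    have "\<exists>z \<in> S \<union> R. (c n, z) \<in> E \<union> link u v \<and>
      (\<forall>w \<in> S \<union> R. w = z \<or> (c n, w) \<in> E \<union> link u v \<or> (z, w) \<in> E)"
    proof (cases "\<exists>s \<in> S. f s = v")
      case True
      then obtain s where s: "s \<in> S" "f s = v" by auto
      then show ?thesis using cS uc SR[OF s(1)] by (intro bexI[of _ s]) (auto simp: link_def)
    next
      case False
      then have "(v, w) \<in> E" if "w \<in> S" for w using SR[OF that vR] that E_sym by auto
      then show ?thesis using uc vR RR[OF vR] cS by (intro bexI[of _ v]) (auto simp: link_def)
    qed
    then obtain z where z: "z \<in> S \<union> R" "(c n, z) \<in> E \<union> link u v"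
      "\<And>w. w \<in> S \<union> R \<Longrightarrow> w = z \<or> (c n, w) \<in> E \<union> link u v \<or> (z, w) \<in> E" by blast
    have "sym (E \<union> link u v)" using symE sym_link[of u v] by (auto simp: sym_def)
    then have "conn (E \<union> link u v) {c n, z}" using z(2) by (intro conn_pair)
    then have "cds (E \<union> link u v) V (p q ` {1..Suc n} \<union> {z})"
      using z sym_link by (intro cds_full[OF q(1)]) auto
    then show ?thesis using card_full[of q "{z}"] by auto
  qed
qed

text \<open>Two non-adjacent vertices outside \<open>S \<union> R\<close> lie on a common path
  \<open>p q\<close>, since \<open>Q\<close> is complete and contains at most one of them. Inside
  \<open>S \<union> R\<close> a non-edge joins some \<open>s\<close> to \<open>f s\<close>, and with
  the new edge \<open>c n\<close> and \<open>s\<close> dominate the last block.\<close>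

lemma crit_pair:
  assumes u: "u \<in> V" and v: "v \<in> V" and ne: "u \<noteq> v" and nE: "(u, v) \<notin> E"
  shows "\<exists>D. cds (E \<union> link u v) V D \<and> card D \<le> n + 2"
proof -
  have comm: "link u v = link v u" by (auto simp: link_def)
  have nE': "(v, u) \<notin> E" using nE E_sym by blast
  consider "u \<notin> S \<union> R" "v \<in> S \<union> R" | "u \<in> S \<union> R" "v \<notin> S \<union> R"
    | "u \<in> S \<union> R" "v \<in> S \<union> R" | "u \<notin> S \<union> R" "v \<notin> S \<union> R" by blast
  then show ?thesis
  proof cases
    case 1
    then show ?thesis using crit_path_end u nE by blast
  next
    case 2
    then show ?thesis using crit_path_end[OF v _ _ nE'] comm by auto
  next
    case 3
    obtain q where q: "q \<in> Q" using Q_nonempty by auto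
    obtain s where s: "s \<in> S" "link u v = link s (f s)"
    proof (cases "u \<in> S")
      case True
      then have "v \<in> R" "v = f u" using 3 nE SS[OF True _ ne] SR[OF True] by auto
      then show thesis using that[of u] True by simp
    next
      case False
      then have uR: "u \<in> R" using 3 by auto
      then have "v \<in> S" using 3 nE RR[OF uR _ ne] by auto
      then have "u = f v" using nE' SR uR by auto
      then show thesis using that[of v] \<open>v \<in> S\<close> comm by simp
    qed
    have "sym (E \<union> link u v)" using symE sym_link[of u v] by (auto simp: sym_def)
    then have "conn (E \<union> link u v) {c n, s}" using cS[OF s(1)] by (intro conn_pair) auto
    then have "cds (E \<union> link u v) V (p q ` {1..Suc n} \<union> {s})"
      using s cS sym_link SR[OF s(1)] unfolding s(2)
      by (intro cds_full[OF q]) (auto simp: link_def)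
    then show ?thesis using card_full[of q "{s}"] by auto
  next
    case 4
    have "\<exists>q \<in> Q. \<exists>i \<le> Suc n. \<exists>j \<le> Suc n. u = p q i \<and> v = p q j"
      using u
    proof (cases rule: V_cases)
      case 2
      then have "v \<notin> Q" using QQ nE ne by blast
      from v obtain a where "v = c a" "a \<le> n" by (cases rule: V_cases) (use 4 \<open>v \<notin> Q\<close> in auto)
      then show ?thesis using p_surj[of a u] p_l[of u] 2 ln by (metis le_SucI)
    next
      case (3 a)
      note ua = this
      from v show ?thesis
      proof (cases rule: V_cases)
        case 2
        then show ?thesis using p_surj[of a v] p_l[of v] ua ln by (metis le_SucI)
      next
        case (3 b)
        then show ?thesis using Q_nonempty p_surj[of a] p_surj[of b] ua by metis
      qed (use 4 in simp)
    qed (use 4 in simp)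
    then obtain q i j where q: "q \<in> Q" and ij: "i \<le> Suc n" "j \<le> Suc n" "u = p q i" "v = p q j" by blast
    obtain s0 where "s0 \<in> S" using two by blast
    then have s0: "s0 \<in> S \<union> R" by simp
    obtain s where s: "s \<in> S" "(s0, s) \<in> E"
      "\<And>w. w \<in> S \<union> R \<Longrightarrow> w \<in> {s0, s} \<or> (s0, w) \<in> E \<or> (s, w) \<in> E" by (rule partner[OF s0]) blast
    have main: "\<exists>D. cds (E \<union> link (p q i) (p q j)) V D \<and> card D \<le> n + 2"
      if ij: "i < j" "j \<le> Suc n" "(p q i, p q j) \<notin> E" for i j
    proof -
      have "j \<noteq> Suc i" using ij p_step[OF q, of i] by auto
      then have "j \<in> {i + 2..Suc n}" "i \<le> n" using ij by auto
      then show ?thesis using cds_skip[OF q _ s0 s, of i "p q j"] card_skip[of i q s0 s] by blast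
    qed
    have "i \<noteq> j" using ij ne by auto
    then consider "i < j" | "j < i" by linarith
    then show ?thesis
    proof cases
      case 1
      then show ?thesis using main[of i j] ij nE by simp
    next
      case 2
      then show ?thesis using main[of j i] ij nE' comm by simp
    qed
  qed
qed

text \<open>The size is squeezed between \<open>card_full\<close> and \<open>card_cds_ge\<close>,
  which spares a proof that the vertices are distinct.\<close>

lemma gamma_set:
  obtains q s1 s2 where "q \<in> Q" "s1 \<in> S" "s2 \<in> S" "s1 \<noteq> s2"
    "cds E V (p q ` {1..Suc n} \<union> {s1, s2})" "card (p q ` {1..Suc n} \<union> {s1, s2}) = n + 3"
proof -
  obtain s1 s2 where s: "s1 \<in> S" "s2 \<in> S" "f s1 \<noteq> f s2" using two by blast
  obtain q where q: "q \<in> Q" using Q_nonempty by auto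
  have "conn (E \<union> {}) {c n, s1, s2}"
    by (rule conn_hub[of "c n"]) (use s cS symE in auto)
  then have D: "cds (E \<union> {}) V (p q ` {1..Suc n} \<union> {s1, s2})"
    using s SR[of s1] SR[of s2] cS by (intro cds_full[OF q]) (auto simp: sym_def)
  have "s1 \<noteq> s2" using s by auto
  then have "card {s1, s2} = 2" by simp
  then have "card (p q ` {1..Suc n} \<union> {s1, s2}) = n + 3"
    using card_full[of q "{s1, s2}"] card_cds_ge D by (simp add: le_antisym)
  then show thesis using that[of q s1 s2] q s D \<open>s1 \<noteq> s2\<close> by simp
qed

end


text \<open>Recovers leaves, other vertices and the map \<open>f\<close> from leaf to centre, the
  form in which \<open>blown_path\<close> describes the last block.\<close>

lemma B22E:
  assumes "B22 K h"
  obtains S R f where "finite S" "finite R" "S \<inter> R = {}" "h \<notin> S \<union> R" "pverts K = insert h (S \<union> R)"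
    "parcs K \<subseteq> pverts K \<times> pverts K" "sym (parcs K)" "\<And>x. (x, x) \<notin> parcs K"
    "\<And>x y. x \<in> S \<Longrightarrow> y \<in> S \<Longrightarrow> x \<noteq> y \<Longrightarrow> (x, y) \<in> parcs K"
    "\<And>x y. x \<in> R \<Longrightarrow> y \<in> R \<Longrightarrow> x \<noteq> y \<Longrightarrow> (x, y) \<in> parcs K"
    "\<And>x. x \<in> S \<Longrightarrow> f x \<in> R"
    "\<And>x y. x \<in> S \<Longrightarrow> y \<in> R \<Longrightarrow> (x, y) \<in> parcs K \<longleftrightarrow> y \<noteq> f x"
    "\<And>x. x \<in> S \<Longrightarrow> (h, x) \<in> parcs K" "\<And>x. x \<in> R \<Longrightarrow> (h, x) \<notin> parcs K"
    "\<exists>x \<in> S. \<exists>y \<in> S. f x \<noteq> f y"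
proof -
  obtain l m r T S where l2: "2 \<le> l" and m1: "\<forall>i \<in> {1..l}. 1 \<le> m i"
    and si: "stars_and_isolated l m r T S" and h: "h \<notin> pverts T"
    and K: "K = add_vertex (complement T) h S"
    using assms unfolding B22_def by blast
  obtain x L R0 where L: "\<forall>i \<in> {1..l}. finite (L i) \<and> card (L i) = m i \<and> x i \<notin> L i"
    and dis: "disjoint_family_on (\<lambda>i. insert (x i) (L i)) {1..l}"
    and R0: "finite R0" "(\<Union>i \<in> {1..l}. insert (x i) (L i)) \<inter> R0 = {}"
    and pT: "pverts T = (\<Union>i \<in> {1..l}. insert (x i) (L i)) \<union> R0"
    and aT: "parcs T = (\<Union>i \<in> {1..l}. {x i} \<times> L i \<union> L i \<times> {x i})"
    and S: "S = (\<Union>i \<in> {1..l}. L i)"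
    using si unfolding stars_and_isolated_def by blast
  define R where "R = x ` {1..l} \<union> R0"
  have S_iff: "s \<in> S \<longleftrightarrow> (\<exists>i \<in> {1..l}. s \<in> L i)" for s unfolding S by blast
  have same: "i = j" if "i \<in> {1..l}" "j \<in> {1..l}" "z \<in> insert (x i) (L i)" "z \<in> insert (x j) (L j)" for i j z
    using dis that unfolding disjoint_family_on_def by blast
  have xS: "x i \<notin> S" if i: "i \<in> {1..l}" for i
  proof
    assume "x i \<in> S"
    then obtain j where j: "j \<in> {1..l}" "x i \<in> L j" unfolding S by blast
    then have "i = j" using same[of i j "x i"] i by simp
    then show False using L i j by blast
  qed
  have R0S: "z \<notin> S" if "z \<in> R0" for z using R0(2) that unfolding S by blast
  have disj: "S \<inter> R = {}" using xS R0S by (auto simp: R_def)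
  have pT': "pverts T = S \<union> R" unfolding pT S R_def by blast
  \<comment> \<open>The stars are disjoint, so the chosen index is the only one.\<close>
  define g where "g s = (SOME i. i \<in> {1..l} \<and> s \<in> L i)" for s
  define f where "f s = x (g s)" for s
  have g: "g s \<in> {1..l}" "s \<in> L (g s)" if "s \<in> S" for s
  proof -
    have "\<exists>i. i \<in> {1..l} \<and> s \<in> L i" using that unfolding S_iff by blast
    then have "g s \<in> {1..l} \<and> s \<in> L (g s)" unfolding g_def by (rule someI_ex)
    then show "g s \<in> {1..l}" "s \<in> L (g s)" by simp_all
  qed
  have g_eq: "g s = i" if i: "i \<in> {1..l}" "s \<in> L i" for s i
  proof -
    have "s \<in> S" using i unfolding S_iff by (rule bexI[rotated])
    then show ?thesis using g[of s] by (intro same[of "g s" i s] i insertI2)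
  qed
  have T: "(u, v) \<in> parcs T \<longleftrightarrow> u \<in> S \<and> v = f u \<or> v \<in> S \<and> u = f v" for u v
  proof
    assume "(u, v) \<in> parcs T"
    then obtain i where i: "i \<in> {1..l}" "u = x i \<and> v \<in> L i \<or> u \<in> L i \<and> v = x i"
      unfolding aT by blast
    have LS: "s \<in> S \<and> f s = x i" if "s \<in> L i" for s
    proof
      show "s \<in> S" using that i(1) unfolding S_iff by (rule bexI)
      show "f s = x i" using g_eq[OF i(1) that] by (simp add: f_def)
    qed
    from i(2) show "u \<in> S \<and> v = f u \<or> v \<in> S \<and> u = f v"
      by (elim disjE conjE) (simp_all add: LS)
  next
    have T_I: "(x i, v) \<in> parcs T \<and> (v, x i) \<in> parcs T" if "i \<in> {1..l}" "v \<in> L i" for i v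
      unfolding aT using that by blast
    assume "u \<in> S \<and> v = f u \<or> v \<in> S \<and> u = f v"
    then show "(u, v) \<in> parcs T"
      using T_I[OF g] unfolding f_def by (elim disjE conjE) simp_all
  qed
  have fR: "f s \<in> R" if "s \<in> S" for s using g(1)[OF that] by (simp add: f_def R_def)
  have pK: "pverts K = insert h (S \<union> R)"
    unfolding K by (simp add: add_vertex_def complement_def pT')
  have aK: "(u, v) \<in> parcs K \<longleftrightarrow> u \<in> S \<union> R \<and> v \<in> S \<union> R \<and> u \<noteq> v \<and> (u, v) \<notin> parcs T
      \<or> u = h \<and> v \<in> S \<or> u \<in> S \<and> v = h" for u v
    unfolding K add_vertex_def complement_def pT' by simp
  have RS: "z \<notin> S" if "z \<in> R" for z using that disj by blast
  have h': "h \<notin> S" "h \<notin> R" using h unfolding pT' by auto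
  have Tsym: "(u, v) \<in> parcs T \<longleftrightarrow> (v, u) \<in> parcs T" for u v unfolding T by blast
  have ne: "L i \<noteq> {}" if "i \<in> {1..l}" for i using L m1 that by fastforce
  have 12: "1 \<in> {1..l}" "2 \<in> {1..l}" using l2 by auto
  obtain s1 s2 where s: "s1 \<in> L 1" "s2 \<in> L 2" using ne[OF 12(1)] ne[OF 12(2)] by blast
  have "g s1 = 1" "g s2 = 2" using g_eq[OF 12(1) s(1)] g_eq[OF 12(2) s(2)] by auto
  moreover have "x 1 \<noteq> x 2" using same[OF 12, of "x 1"] by auto
  moreover have "s1 \<in> S" "s2 \<in> S" using s 12 unfolding S by blast+
  ultimately have two: "\<exists>x \<in> S. \<exists>y \<in> S. f x \<noteq> f y"
    by (intro bexI[of _ s1] bexI[of _ s2]) (simp_all add: f_def)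
  show thesis
  proof (rule that[of S R f])
    show "finite S" unfolding S using L by blast
    show "finite R" using R0 by (simp add: R_def)
    show "sym (parcs K)"
    proof (rule symI)
      fix u v assume "(u, v) \<in> parcs K"
      then show "(v, u) \<in> parcs K" unfolding aK using Tsym[of u v] by blast
    qed
    show "(x, x) \<notin> parcs K" for x using h' unfolding aK by blast
    show "(x, y) \<in> parcs K" if "x \<in> S" "y \<in> S" "x \<noteq> y" for x y
      using that RS[OF fR[of x]] RS[OF fR[of y]] by (auto simp: aK T)
    show "(x, y) \<in> parcs K" if "x \<in> R" "y \<in> R" "x \<noteq> y" for x y
      using that RS[of x] RS[of y] by (simp add: aK T)
    show "(x, y) \<in> parcs K \<longleftrightarrow> y \<noteq> f x" if "x \<in> S" "y \<in> R" for x y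
      using that RS[of y] h' by (auto simp: aK T)
    show "(h, x) \<notin> parcs K" if "x \<in> R" for x using that h' RS[of x] by (auto simp: aK)
    show "parcs K \<subseteq> pverts K \<times> pverts K"
    proof (rule subrelI)
      fix u v assume "(u, v) \<in> parcs K"
      then show "(u, v) \<in> pverts K \<times> pverts K" unfolding aK pK by blast
    qed
    show "(h, x) \<in> parcs K" if "x \<in> S" for x using that unfolding aK by blast
    show "h \<notin> S \<union> R" using h' by simp
  qed (fact disj pK fR two)+
qed

lemma G1_class_subset_H_class:
  fixes G :: "'a pair_pre_digraph"
  assumes k: "k \<ge> 4" and G: "G \<in> G1_class k b"
  shows "G \<in> H_class k (b(k-2 := 2))"
proof -
  define n where "n = k - 3"
  have kn: "k - 3 = n" "k - 2 = Suc n" "k = n + 3" "1 \<le> n" using k by (auto simp: n_def)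
  obtain l c nq Q K P J where l: "l \<in> {1..n}" "b l = 1" "\<forall>i \<in> {1..n} - {l}. b i = 0"
    and inj: "inj_on c {0..n}" and nq: "2 \<le> nq" and Q: "complete_digraph nq (with_proj Q)"
    and Qc: "pverts Q \<inter> c ` {0..n} = {}" and K: "B22 K (c n)"
    and Kd: "pverts K \<inter> (c ` {0..n} \<union> pverts Q) = {c n}"
    and P: "P = {(c (i - 1), c i) | i. i \<in> {1..n} - {l}}" and J: "J = pverts Q \<times> {c (l - 1), c l}"
    and pG: "pverts G = c ` {0..n} \<union> pverts Q \<union> pverts K"
    and aG: "parcs G = P \<union> P\<inverse> \<union> parcs Q \<union> J \<union> J\<inverse> \<union> parcs K"
    using G unfolding G1_class_def kn(1) by (elim CollectE exE conjE) (rule that; assumption)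
  define X where "X = pverts Q"
  define E where "E = parcs G"
  have aQ: "parcs Q = {(u, v). (u, v) \<in> X \<times> X \<and> u \<noteq> v}" and cardX: "2 \<le> card X"
    using Q nq by (auto simp: complete_digraph_def X_def)
  then have finX: "finite X" using card.infinite by fastforce
  obtain S R f where SRK: "finite S" "finite R" "S \<inter> R = {}" "c n \<notin> S \<union> R" "pverts K = insert (c n) (S \<union> R)"
    and K1: "parcs K \<subseteq> pverts K \<times> pverts K" "sym (parcs K)" "\<And>x. (x, x) \<notin> parcs K"
    and K2: "\<And>x y. x \<in> S \<Longrightarrow> y \<in> S \<Longrightarrow> x \<noteq> y \<Longrightarrow> (x, y) \<in> parcs K"
      "\<And>x y. x \<in> R \<Longrightarrow> y \<in> R \<Longrightarrow> x \<noteq> y \<Longrightarrow> (x, y) \<in> parcs K"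
      "\<And>x. x \<in> S \<Longrightarrow> f x \<in> R"
      "\<And>x y. x \<in> S \<Longrightarrow> y \<in> R \<Longrightarrow> (x, y) \<in> parcs K \<longleftrightarrow> y \<noteq> f x"
      "\<And>x. x \<in> S \<Longrightarrow> (c n, x) \<in> parcs K" "\<And>x. x \<in> R \<Longrightarrow> (c n, x) \<notin> parcs K"
      "\<exists>x \<in> S. \<exists>y \<in> S. f x \<noteq> f y"
    by (rule B22E[OF K]) (rule that; assumption)
  have c_inj: "i = j" if "c i = c j" "i \<le> n" "j \<le> n" for i j
    using inj_onD[OF inj that(1)] that by auto
  have ln: "1 \<le> l" "l \<le> n" using l by auto
  have Xc: "c j \<notin> X" if "j \<le> n" for j using Qc that by (auto simp: X_def)
  have Kc: "j = n" if "c j \<in> pverts K" "j \<le> n" for j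
  proof -
    have "c j \<in> pverts K \<inter> (c ` {0..n} \<union> pverts Q)" using that by auto
    then have "c j = c n" unfolding Kd by simp
    then show ?thesis using c_inj that by auto
  qed
  have KX: "x \<notin> X" if "x \<in> pverts K" for x
  proof
    assume "x \<in> X"
    then have "x \<in> pverts K \<inter> (c ` {0..n} \<union> pverts Q)" using that by (auto simp: X_def)
    then have "x = c n" unfolding Kd by simp
    then show False using Xc[of n] \<open>x \<in> X\<close> by simp
  qed
  have PE: "\<exists>i. i \<in> {1..n} \<and> i \<noteq> l \<and> (u = c (i - 1) \<and> v = c i \<or> u = c i \<and> v = c (i - 1))"
    if "(u, v) \<in> P \<union> P\<inverse>" for u v using that unfolding P by auto
  have JE: "u \<in> X \<and> v \<in> {c (l - 1), c l} \<or> v \<in> X \<and> u \<in> {c (l - 1), c l}"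
    if "(u, v) \<in> J \<union> J\<inverse>" for u v using that unfolding J X_def by auto
  have E_cases: "(u, v) \<in> P \<union> P\<inverse> \<or> (u, v) \<in> parcs Q \<or> (u, v) \<in> J \<union> J\<inverse> \<or> (u, v) \<in> parcs K"
    if "(u, v) \<in> E" for u v using that unfolding E_def aG by blast
  have symE: "sym E"
  proof (rule symI)
    fix u v assume "(u, v) \<in> E"
    then show "(v, u) \<in> E" using symD[OF K1(2)] unfolding E_def aG aQ by blast
  qed
  \<comment> \<open>No other kind of edge has both ends in \<open>K\<close>, which shares only
    \<open>c n\<close> with the rest.\<close>
  have EK: "(u, v) \<in> E \<longleftrightarrow> (u, v) \<in> parcs K" if uv: "u \<in> pverts K" "v \<in> pverts K" for u v
  proof
    assume "(u, v) \<in> E"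
    then consider "(u, v) \<in> P \<union> P\<inverse>" | "(u, v) \<in> parcs Q" | "(u, v) \<in> J \<union> J\<inverse>" | "(u, v) \<in> parcs K"
      using E_cases by blast
    then show "(u, v) \<in> parcs K"
    proof cases
      case 1
      then obtain i where i: "i \<in> {1..n}" "c (i - 1) \<in> pverts K" "c i \<in> pverts K"
        using PE[OF 1] uv by blast
      then have "i - 1 = n" "i = n" using Kc[of "i - 1"] Kc[of i] by auto
      then show ?thesis using kn by auto
    next
      case 2
      then show ?thesis using KX uv by (auto simp: aQ)
    next
      case 3
      then show ?thesis using JE[OF 3] KX uv by blast
    qed
  qed (simp add: E_def aG)
  have l1n: "l - 1 \<le> n" "l - 1 \<noteq> l" using ln by auto
  interpret blown_path n l c X S R f E
  proof
    show "X \<inter> c ` {0..n} = {}" using Qc by (simp add: X_def)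
    have "x \<notin> c ` {0..n}" if x: "x \<in> S \<union> R" for x
    proof
      assume "x \<in> c ` {0..n}"
      then obtain j where "x = c j" "j \<le> n" by auto
      then have "x = c n" using Kc[of j] x SRK(5) by auto
      then show False using x SRK(4) by simp
    qed
    then show "(S \<union> R) \<inter> c ` {0..n} = {}" by blast
    show "(S \<union> R) \<inter> X = {}" using KX SRK(5) by auto
    show "(x, x) \<notin> E" for x
    proof
      assume "(x, x) \<in> E"
      then consider "(x, x) \<in> P \<union> P\<inverse>" | "(x, x) \<in> J \<union> J\<inverse>"
        using E_cases[of x x] aQ K1(3) by blast
      then show False
      proof cases
        case 1
        then obtain i where i: "i \<in> {1..n}" "c (i - 1) = c i" using PE[OF 1] by metis
        then have "i - 1 = i" by (intro c_inj) auto
        then show False using i by auto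
      next
        case 2
        then show False using JE[OF 2] Xc[of l] Xc[of "l - 1"] ln l1n by auto
      qed
    qed
    show "(c (i - 1), c i) \<in> E" if "i \<in> {1..n}" "i \<noteq> l" for i
      using that unfolding E_def aG P by blast
    show "(x, y) \<in> E" if "x \<in> X" "y \<in> X" "x \<noteq> y" for x y
      using that unfolding E_def aG aQ by blast
    show "(x, c (l - 1)) \<in> E" "(x, c l) \<in> E" if "x \<in> X" for x
      using that unfolding E_def aG J X_def by blast+
    show "(x, y) \<in> E" if "x \<in> S" "y \<in> S" "x \<noteq> y" for x y
      using K2(1)[OF that] unfolding E_def aG by blast
    show "(x, y) \<in> E" if "x \<in> R" "y \<in> R" "x \<noteq> y" for x y
      using K2(2)[OF that] unfolding E_def aG by blast
    show "(x, y) \<in> E \<longleftrightarrow> y \<noteq> f x" if "x \<in> S" "y \<in> R" for x y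
      using K2(4)[OF that] EK[of x y] SRK(5) that by simp
    show "(c n, x) \<in> E" if "x \<in> S" for x using K2(5)[OF that] unfolding E_def aG by blast
    show "(c n, x) \<notin> E" if "x \<in> R" for x using K2(6)[OF that] EK[of "c n" x] SRK(5) that by simp
    show "(c (l - 1), c l) \<notin> E"
    proof
      assume "(c (l - 1), c l) \<in> E"
      then consider "(c (l - 1), c l) \<in> P \<union> P\<inverse>" | "(c (l - 1), c l) \<in> parcs Q"
        | "(c (l - 1), c l) \<in> J \<union> J\<inverse>" | "(c (l - 1), c l) \<in> parcs K"
        using E_cases by blast
      then show False
      proof cases
        case 1
        then obtain i where i: "i \<in> {1..n}" "i \<noteq> l"
          "c (l - 1) = c (i - 1) \<and> c l = c i \<or> c (l - 1) = c i \<and> c l = c (i - 1)"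
          using PE[OF 1] by blast
        then have "l = i \<or> l - 1 = i \<and> l = i - 1"
          using c_inj[of l i] c_inj[of "l - 1" i] c_inj[of l "i - 1"] ln l1n by auto
        then show False using i ln by auto
      next
        case 2
        then show False using Xc[of l] ln by (simp add: aQ)
      next
        case 3
        then show False using JE[OF 3] Xc[of l] Xc[of "l - 1"] ln l1n by auto
      next
        case 4
        then have "l - 1 = n" "l = n" using K1(1) Kc[of l] Kc[of "l - 1"] ln l1n by auto
        then show False using ln by auto
      qed
    qed
    fix x y assume "(x, y) \<in> E"
    then consider "(x, y) \<in> P \<union> P\<inverse>" | "(x, y) \<in> parcs Q" | "(x, y) \<in> J \<union> J\<inverse>" | "(x, y) \<in> parcs K"
      using E_cases by blast
    then show "(\<exists>i \<in> {1..n} - {l}. {x, y} = {c (i - 1), c i}) \<or>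
      {x, y} \<subseteq> X \<union> {c (l - 1), c l} \<or> {x, y} \<subseteq> insert (c n) (S \<union> R)"
    proof cases
      case 1
      from PE[OF 1] show ?thesis by blast
    next
      case 2
      then show ?thesis by (auto simp: aQ)
    next
      case 3
      from JE[OF 3] show ?thesis by blast
    next
      case 4
      then show ?thesis using K1(1) SRK(5) by auto
    qed
  qed (use ln inj finX SRK cardX symE K2 in auto)
  have VG: "V = pverts G"
  proof (intro equalityI subsetI)
    fix x assume "x \<in> V"
    then show "x \<in> pverts G" unfolding pG SRK(5) by (cases rule: V_cases) (auto simp: X_def)
  next
    fix x assume "x \<in> pverts G"
    then show "x \<in> V" unfolding pG SRK(5) X_def[symmetric] using in_V by auto
  qed
  have finV: "finite V" by (rule block_chain.fin[OF block_chain_axioms])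
  have pg: "pair_graph G"
    using symE EV irr finV by (intro pair_graphI) (simp_all add: E_def VG)
  have cds_iff: "connected_dominating_set G D \<longleftrightarrow> cds E V D" for D
    using connected_dominating_set_iff_cds[of G] symE by (simp add: VG E_def)
  obtain q s1 s2 where q: "q \<in> X" and s: "s1 \<in> S" "s2 \<in> S" "s1 \<noteq> s2"
    and D: "cds E V (p q ` {1..Suc n} \<union> {s1, s2})" and card_D: "card (p q ` {1..Suc n} \<union> {s1, s2}) = n + 3"
    by (rule gamma_set) blast
  define D0 where "D0 = p q ` {1..Suc n} \<union> {s1, s2}"
  have finG: "finite (pverts G)" using finV by (simp add: VG)
  have gG: "gamma_c G = n + 3"
  proof (rule antisym)
    show "gamma_c G \<le> n + 3" using gamma_c_le[OF finG] cds_iff D card_D by metis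
    obtain D' where "connected_dominating_set G D'" "card D' = gamma_c G"
      using gamma_c_witness[OF finG] cds_iff D by metis
    then show "n + 3 \<le> gamma_c G" using card_cds_ge cds_iff by metis
  qed
  have conG: "connected (with_proj G)"
    using conn_V symE by (subst connected_iff_conn) (simp_all add: VG E_def)
  have crit: "gamma_c (add_edge G u v) < k"
    if uv: "u \<in> pverts G" "v \<in> pverts G" "u \<noteq> v \<and> (u, v) \<notin> parcs G" for u v
  proof -
    obtain D' where D': "cds (E \<union> link u v) V D'" "card D' \<le> n + 2"
      using crit_pair[of u v] uv by (auto simp: VG E_def)
    have "sym (parcs (add_edge G u v))" using symE sym_link[of u v] by (auto simp: E_def sym_def)
    then have "connected_dominating_set (add_edge G u v) D'"
      using connected_dominating_set_iff_cds[of "add_edge G u v"] D' by (simp add: VG E_def)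
    then have "gamma_c (add_edge G u v) \<le> card D'" using finG by (intro gamma_c_le) auto
    then show ?thesis using D' kn by simp
  qed
  have cut: "cut_vertices (with_proj G) = c ` {1..n}"
  proof -
    have cV: "c ` {1..n} \<subseteq> V" using c_V by auto
    have "cut_vertices (with_proj G) = {v \<in> V. V - {v} \<noteq> {} \<and> \<not> conn E (V - {v})}"
      using cut_vertices_eq[OF pg] conn_V by (simp add: VG E_def)
    also have "\<dots> = {v \<in> V. v \<in> c ` {1..n}}" using disconnected_iff by (intro Collect_cong) blast
    also have "\<dots> = c ` {1..n}" using cV by blast
    finally show ?thesis .
  qed
  have inj1: "inj_on c {1..n}" by (rule inj_on_subset[OF inj]) auto
  define Bl where "Bl j = with_proj (induce_pair G (W j))" for j
  have vB: "verts (Bl j) = W j" for j by (simp add: Bl_def induce_pair_def)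
  have bij: "bij_betw Bl {1..Suc n} (blocks (with_proj G))"
    unfolding Bl_def using pg
  proof (rule blocks_eq_induced)
    show "W j \<subseteq> pverts G" if "j \<in> {1..Suc n}" for j using W_sub_V[OF that] by (simp add: VG)
    show "nonsep (parcs G) (W j)" if "j \<in> {1..Suc n}" for j using nonsep_W[OF that] by (simp add: E_def)
    show "\<exists>j \<in> {1..Suc n}. U \<subseteq> W j" if "nonsep (parcs G) U" "U \<subseteq> pverts G" for U
      using nonsep_in_block[of U] that by (simp add: E_def VG)
    show "i = j" if "i \<in> {1..Suc n}" "j \<in> {1..Suc n}" "W i \<subseteq> W j" for i j
      by (rule W_antichain[OF that])
  qed
  have lab: "block_labeling k G Bl c"
    unfolding block_labeling_def kn(1,2) vB cut
  proof (intro conjI ballI)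
    show "bij_betw Bl {1..Suc n} (blocks (with_proj G))" by (rule bij)
    show "bij_betw c {1..n} (c ` {1..n})" using inj1 by (simp add: bij_betw_def)
    show "c 1 \<in> W 1" "c n \<in> W (Suc n)" using c_in_W kn by auto
    fix i assume i: "i \<in> {2..n}"
    show "c i \<in> W i" using c_in_W(1)[of i] i by auto
    show "c (i - 1) \<in> W i" using c_in_W(2)[of "i - 1"] i by auto
  qed
  \<comment> \<open>\<open>c 0\<close> does not occur: the path starts at index \<open>1\<close>,
    which is \<open>q\<close> if \<open>l = 1\<close> and \<open>c 1\<close> otherwise.\<close>
  have D0_sub: "D0 \<subseteq> c ` {1..n} \<union> {q, s1, s2}"
  proof
    fix x assume "x \<in> D0"
    then consider j where "x = p q j" "j \<in> {1..Suc n}" | "x \<in> {s1, s2}" by (auto simp: D0_def)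
    then show "x \<in> c ` {1..n} \<union> {q, s1, s2}"
    proof cases
      case 1
      then consider "j < l" | "j = l" | "j > l" by linarith
      then show ?thesis
      proof cases
        case a: 1
        then have "x = c j" "j \<in> {1..n}" using 1 ln by (auto simp: p_def)
        then show ?thesis by blast
      next
        case 2
        then show ?thesis using 1 by (simp add: p_def)
      next
        case 3
        then have "x = c (j - 1)" using 1 by (simp add: p_def)
        moreover have "1 \<le> j - 1" using 3 l1 by linarith
        moreover have "j \<le> Suc n" using 1 by simp
        then have "j - 1 \<le> n" by linarith
        ultimately have "x = c (j - 1)" "j - 1 \<in> {1..n}" by simp_all
        then show ?thesis by blast
      qed
    qed auto
  qed
  have mem: "q \<in> D0" "s1 \<in> D0" "s2 \<in> D0"
  proof -
    have "p q l \<in> p q ` {1..Suc n}" using l1 ln by (intro imageI) simp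
    then show "q \<in> D0" "s1 \<in> D0" "s2 \<in> D0" by (simp_all add: D0_def p_l)
  qed
  have qc: "q \<notin> c ` {1..n}" using q Q_c by auto
  have sc: "s1 \<notin> c ` {1..n}" "s2 \<notin> c ` {1..n}" using s SR_c by auto
  \<comment> \<open>Apart from cut vertices, \<open>D0\<close> contains only \<open>q\<close> in
    block \<open>l\<close> and \<open>s1\<close>, \<open>s2\<close> in the last block.\<close>
  have b: "card ((W i - c ` {1..n}) \<inter> D0) = (b(Suc n := 2)) i" if i: "i \<in> {1..Suc n}" for i
  proof -
    consider "i = Suc n" | "i = l" | "i \<in> {1..n}" "i \<noteq> l" using i by force
    then show ?thesis
    proof cases
      case 1
      have "q \<notin> W (Suc n)" unfolding W_last using q disj(4) Q_c[of n] by auto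
      moreover have "s1 \<in> W (Suc n)" "s2 \<in> W (Suc n)" using s W_last by auto
      ultimately have "(W i - c ` {1..n}) \<inter> D0 = {s1, s2}" using 1 D0_sub mem sc by blast
      then show ?thesis using 1 s(3) by simp
    next
      case 2
      have "s' \<notin> W l" if "s' \<in> S" for s'
        unfolding W_l using that disj(4) SR_c[of l] SR_c[of "l - 1"] ln l1n by auto
      moreover have "q \<in> W l" using q W_l by auto
      ultimately have "(W i - c ` {1..n}) \<inter> D0 = {q}" using 2 D0_sub mem qc s by blast
      then show ?thesis using 2 ln l by simp
    next
      case 3
      have i1: "i - 1 \<le> n" "i \<le> n" using 3 by auto
      have "z \<notin> W i" if "z \<in> X \<or> z \<in> S" for z
        unfolding W_path[OF 3] using that Q_c[OF i1(1)] Q_c[OF i1(2)] SR_c[OF i1(1)] SR_c[OF i1(2)] by auto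
      then have "(W i - c ` {1..n}) \<inter> D0 = {}" using D0_sub q s by blast
      then show ?thesis using 3 l by simp
    qed
  qed
  have "gamma_c_set G D0" using cds_iff D card_D gG by (simp add: gamma_c_set_def D0_def)
  moreover have "G \<in> Z_class k n"
    using pg conG gG crit kn cut inj1 by (auto simp: Z_class_def gamma_c_critical_def card_image)
  moreover have "\<forall>i \<in> {1..Suc n}.
      card ((verts (Bl i) - cut_vertices (with_proj G)) \<inter> D0) = (b(Suc n := 2)) i"
    unfolding vB cut using b by blast
  ultimately show ?thesis
    unfolding H_class_def kn(1,2) using lab by blast
qed

theorem theorem10:
  fixes k :: nat and b :: "nat \<Rightarrow> nat"
  assumes "k \<ge> 4"
    and "\<forall>i \<in> {1..k-3}. b i \<in> {0, 1}"
    and "\<exists>!i. i \<in> {1..k-3} \<and> b i = 1"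
  shows "(H_class k (b(k-2 := 2)) :: 'a pair_pre_digraph set) = G1_class k b"
proof (intro equalityI subsetI)
  fix G :: "'a pair_pre_digraph"
  assume "G \<in> H_class k (b(k-2 := 2))"
  moreover obtain l where l: "l \<in> {1..k-3}" "b l = 1" using assms(3) by blast
  moreover have "b i = 0" if "i \<in> {1..k-3}" "i \<noteq> l" for i
    using assms(2,3) l that by blast
  ultimately show "G \<in> G1_class k b" using assms(1) by (intro H_class_subset_G1_class[of k l])
qed (use G1_class_subset_H_class[OF assms(1)] in auto)

end
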